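(* Let $d\ge2$ and fix any $\xi\in\mathbb S^{d-1}$. For every $\mathcal L\in\mathscr P$, there are at most countably many values of $h>0$ for which $\mathcal L\oplus h\notin\mathscr P_{\mathrm{length}}(\xi)$.
   Context: $\mathscr P$ is the set of Borel probability measures on $[0,\infty)$; $\mathbb S^{d-1}$ is the Euclidean unit sphere in $\mathbb R^d$. If $\mathcal L\in\mathscr P$ is the law of $\tau_e$, then $\mathcal L\oplus h$ denotes the law of $\tau_e+h$. First-passage percolation on $\mathbb Z^d$, $d\ge2$, with a given edge-weight law in $\mathscr P$: the weights $(\tau_e)_{e\in E(\mathbb Z^d)}$ are i.i.d. with that law, indexed by undirected nearest-neighbor edges, on a complete probability space. For $x\in\mathbb R^d$, $[x]\in\mathbb Z^d$ is the unique integer point with $x\in[x]+[0,1)^d$. $\mathcal P(x,y)$ is the set of self-avoiding nearest-neighbor paths (viewed as sets of edges) from $[x]$ to $[y]$, $T(\gamma)=\sum_{e\in\gamma}\tau_e$, $T(x,y)=\inf_{\gamma\in\mathcal P(x,y)}T(\gamma)$, $\mathrm{Geo}(x,y)=\{\gamma\in\mathcal P(x,y):T(\gamma)=T(x,y)\}$. $|\gamma|_+=|\{e\in\gamma:\tau_e>0\}|$. Definition: a law belongs to $\mathscr P_{\mathrm{length}}(\xi)$ if, for the model with that edge-weight law, there is a deterministic constant $\lambda$ such that, almost surely, $\lim_{n\to\infty}|\gamma_n|_+/n=\lambda$ for any choice of $\gamma_n\in\mathrm{Geo}(0,n\xi)$. Limits $n\to\infty$ are along real $n$. *)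

theory Defs
  imports "HOL-Probability.Probability"
begin

text \<open>First-passage percolation on the lattice of integer points \<open>int ^ 'd\<close>, of dimension
  \<open>CARD('d)\<close>.\<close>

definition adjacent :: "int ^ 'd \<Rightarrow> int ^ 'd \<Rightarrow> bool" where
  "adjacent u v \<longleftrightarrow> (\<Sum>i\<in>UNIV. \<bar>u $ i - v $ i\<bar>) = 1"

definition lattice_edges :: "(int ^ 'd) set set" where
  "lattice_edges = {{u, v} | u v. adjacent u v}"

text \<open>The unique integer point \<open>z\<close> with \<open>x\<close> in \<open>z + [0,1)^d\<close>.\<close>

definition int_point :: "real ^ 'd \<Rightarrow> int ^ 'd" where
  "int_point x = (\<chi> i. \<lfloor>x $ i\<rfloor>)"

definition edges_of_walk :: "(int ^ 'd) list \<Rightarrow> (int ^ 'd) set set" where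
  "edges_of_walk p = {{p ! i, p ! Suc i} | i. Suc i < length p}"

text \<open>Self-avoiding paths, as sets of edges. If \<open>x\<close> and \<open>y\<close> have the same integer point,
  the only path is the empty set of edges.\<close>

definition paths :: "real ^ 'd \<Rightarrow> real ^ 'd \<Rightarrow> (int ^ 'd) set set set" where
  "paths x y = {edges_of_walk p | p.
     p \<noteq> [] \<and> hd p = int_point x \<and> last p = int_point y \<and> distinct p \<and> successively adjacent p}"

text \<open>In the following, \<open>\<tau>\<close> is a realisation of the edge weights.\<close>

definition path_time :: "((int ^ 'd) set \<Rightarrow> real) \<Rightarrow> (int ^ 'd) set set \<Rightarrow> real" where
  "path_time \<tau> \<gamma> = (\<Sum>e\<in>\<gamma>. \<tau> e)"

definition passage_time :: "((int ^ 'd) set \<Rightarrow> real) \<Rightarrow> real ^ 'd \<Rightarrow> real ^ 'd \<Rightarrow> real" where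
  "passage_time \<tau> x y = (INF \<gamma>\<in>paths x y. path_time \<tau> \<gamma>)"

definition geodesics ::
  "((int ^ 'd) set \<Rightarrow> real) \<Rightarrow> real ^ 'd \<Rightarrow> real ^ 'd \<Rightarrow> (int ^ 'd) set set set" where
  "geodesics \<tau> x y = {\<gamma> \<in> paths x y. path_time \<tau> \<gamma> = passage_time \<tau> x y}"

definition pos_length :: "((int ^ 'd) set \<Rightarrow> real) \<Rightarrow> (int ^ 'd) set set \<Rightarrow> nat" where
  "pos_length \<tau> \<gamma> = card {e \<in> \<gamma>. \<tau> e > 0}"

definition nonneg_borel :: "real measure" where
  "nonneg_borel = restrict_space borel {0..}"

definition weight_laws :: "real measure set" where
  "weight_laws = {L. prob_space L \<and> sets L = sets nonneg_borel}"

definition shift_law :: "real measure \<Rightarrow> real \<Rightarrow> real measure" where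
  "shift_law L h = distr L nonneg_borel (\<lambda>t. t + h)"

text \<open>The law of the i.i.d. weights, completed. This is the canonical realisation of the model.
  An almost sure property of the weights here holds almost surely for every i.i.d. family with
  law \<open>L\<close> on any probability space, by pulling back null sets.\<close>

definition fpp_model :: "real measure \<Rightarrow> ((int ^ 'd) set \<Rightarrow> real) measure" where
  "fpp_model L = completion (\<Pi>\<^sub>M e\<in>lattice_edges. L)"

text \<open>The limit is along real \<open>n\<close>. The exceptional null set depends neither on the
  choice of geodesics \<open>\<gamma>\<close> nor on \<open>n\<close>.\<close>

definition length_laws :: "real ^ 'd \<Rightarrow> real measure set" where
  "length_laws \<xi> = {L \<in> weight_laws. \<exists>l::real. AE \<tau> in fpp_model L.
     \<forall>\<gamma> :: real \<Rightarrow> (int ^ 'd) set set.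
       (\<forall>n>0. \<gamma> n \<in> geodesics \<tau> 0 (n *\<^sub>R \<xi>)) \<longrightarrow>
       ((\<lambda>n. real (pos_length \<tau> (\<gamma> n)) / n) \<longlongrightarrow> l) at_top}"

end

theory Submission
  imports Defs "HOL-Computational_Algebra.Nth_Powers"
begin

text \<open>Raising all weights by \<open>\<delta>\<close> costs a geodesic \<open>\<gamma>\<close> exactly \<open>\<delta> |\<gamma>|\<close>. Hence \<open>|\<gamma>|\<close> lies between the
  difference quotients of the passage time in the shift \<open>h\<close>, to the right and to the left. The passage
  time is concave in \<open>h\<close>, so its time constant is differentiable at all but countably many \<open>h\<close>, and
  there both quotients converge to the derivative.

  As \<open>L\<close> need not have moments, passage times need not have a time constant in the almost sure sense. At
  distance \<open>n\<close> the weights are therefore truncated at a small power of \<open>n\<close>. A Peierls estimate,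
  together with the unicoherence of the lattice, surrounds every point by a connected shell
  of cheap edges, so that a geodesic of the truncated weights uses no long edge except near its
  endpoints, and the errors are of order \<open>o(n)\<close>. For the truncated passage times, the means are
  subadditive up to a small error, and the Efron--Stein inequality bounds the variance well enough for the
  Borel--Cantelli lemma along the squares. The gaps are filled by Lipschitz continuity.\<close>

text \<open>The shift is added after the truncation, as \<open>min (\<tau> e) M + s\<close>. Hence
  bad edges and clusters do not depend on \<open>s\<close>, and the passage time is an infimum of
  affine functions of \<open>s\<close> whose slopes are numbers of edges, exactly concave at every
  level. A shift \<open>s > 0\<close> also bounds all weights away from 0: geodesics exist, all
  their edges count as positive, and at distance n the truncated ones have at most order n (M + s) /
  s edges, so that only a box of radius n^2 matters. Far from the endpoints a geodesic can go around
  a long edge; near them it may be forced through edges of arbitrary cost. This cost belongs to the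
  passage time but not to the truncated one, which is why lengths are compared only between two
  shells, while the edges near the endpoints are merely counted. On the sizes: going around a shell
  of radius r costs order r^d, so r^(d+1) serves as truncation level, and r is taken about
  n^(1/(12(d+1))). The variance bound is of order n M^3, too large for Borel-Cantelli along all
  n.\<close>

definition l1_dist :: "int ^ 'd \<Rightarrow> int ^ 'd \<Rightarrow> int" where
  "l1_dist u v = (\<Sum>i\<in>UNIV. \<bar>u $ i - v $ i\<bar>)"

definition cube :: "int ^ 'd \<Rightarrow> int \<Rightarrow> (int ^ 'd) set" where
  "cube v k = {x. \<forall>i. \<bar>x $ i - v $ i\<bar> \<le> k}"

definition int_hull :: "int ^ 'd \<Rightarrow> int ^ 'd \<Rightarrow> (int ^ 'd) set" where
  "int_hull u v = {x. \<forall>i. min (u $ i) (v $ i) \<le> x $ i \<and> x $ i \<le> max (u $ i) (v $ i)}"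

definition walk :: "(int ^ 'd) list \<Rightarrow> int ^ 'd \<Rightarrow> int ^ 'd \<Rightarrow> bool" where
  "walk p u v \<longleftrightarrow> p \<noteq> [] \<and> hd p = u \<and> last p = v \<and> successively adjacent p"

section \<open>Distances and cubes in the lattice\<close>

lemma adjacent_l1: "adjacent u v \<longleftrightarrow> l1_dist u v = 1"
  by (simp add: adjacent_def l1_dist_def)

lemma adjacent_sym: "adjacent u v \<longleftrightarrow> adjacent v u"
  by (simp add: adjacent_def abs_minus_commute)

lemma adjacent_neq: "adjacent u v \<Longrightarrow> u \<noteq> v"
  by (auto simp: adjacent_def)

lemma l1_nonneg: "l1_dist u v \<ge> 0"
  by (simp add: l1_dist_def sum_nonneg)

lemma l1_triangle: "l1_dist u w \<le> l1_dist u v + l1_dist v w"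
  unfolding l1_dist_def sum.distrib[symmetric] by (rule sum_mono) auto

lemma coord_le_l1: "\<bar>u $ i - v $ i\<bar> \<le> l1_dist u v"
  unfolding l1_dist_def by (rule member_le_sum) auto

lemma l1_le_coord: 
  fixes u v :: "int ^ 'd"
  assumes "\<And>i. \<bar>u $ i - v $ i\<bar> \<le> k" shows "l1_dist u v \<le> int CARD('d) * k"
proof -
  have "l1_dist u v \<le> (\<Sum>i\<in>(UNIV::'d set). k)"
    unfolding l1_dist_def by (rule sum_mono) (use assms in auto)
  then show ?thesis by simp
qed

lemma cube_subset_image:
  "cube v k \<subseteq> (\<lambda>f. \<chi> i. f i) ` (PiE UNIV (\<lambda>i. {v $ i - k .. v $ i + k}))"
proof
  fix x assume x: "x \<in> cube v k"
  have "v $ i - k \<le> x $ i \<and> x $ i \<le> v $ i + k" for i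
    using x unfolding cube_def by (auto simp: abs_le_iff algebra_simps dest: spec[of _ i])
  then have "(\<lambda>i. x $ i) \<in> PiE UNIV (\<lambda>i. {v $ i - k .. v $ i + k})" by auto
  moreover have "x = (\<chi> i. x $ i)" by simp
  ultimately show "x \<in> (\<lambda>f. \<chi> i. f i) ` (PiE UNIV (\<lambda>i. {v $ i - k .. v $ i + k}))"
    using rev_image_eqI by blast
qed

lemma finite_cube: "finite (cube v k)"
  by (rule finite_subset[OF cube_subset_image]) (auto intro!: finite_imageI finite_PiE)

lemma card_cube_le:
  fixes v :: "int ^ 'd"
  shows "card (cube v k) \<le> nat (2 * k + 1) ^ CARD('d)"
proof -
  have "card (cube v k) \<le> card ((\<lambda>f. (\<chi> i. f i) :: int ^ 'd) ` (PiE UNIV (\<lambda>i. {v $ i - k .. v $ i + k})))"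
    by (rule card_mono[OF _ cube_subset_image]) (auto intro!: finite_imageI finite_PiE)
  also have "\<dots> \<le> card (PiE UNIV (\<lambda>i. {v $ i - k .. v $ i + k}))"
    by (rule card_image_le) (auto intro!: finite_PiE)
  also have "\<dots> = nat (2 * k + 1) ^ CARD('d)"
    by (simp add: card_PiE algebra_simps)
  finally show ?thesis .
qed

section \<open>Walks, their edge sets and loop erasure\<close>

lemma walk_Cons: "walk (x # p) u v \<longleftrightarrow> x = u \<and> (p = [] \<and> u = v \<or> (\<exists>y. adjacent u y \<and> walk p y v))"
  by (cases p) (auto simp: walk_def)

text \<open>Each step moves one coordinate by one unit towards \<open>v\<close>, so the walk is
  monotone in every coordinate and cannot leave the box spanned by its endpoints. The containment
  serves the connectivity proofs, the length serves the Lipschitz bounds.\<close>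

lemma walk_hull_exists:
  "\<exists>p. walk p u v \<and> length p = nat (l1_dist u v) + 1 \<and> set p \<subseteq> int_hull u v"
proof (induction "nat (l1_dist u v)" arbitrary: u rule: less_induct)
  case less
  show ?case
  proof (cases "u = v")
    case True
    then show ?thesis
      by (intro exI[of _ "[u]"]) (auto simp: walk_def l1_dist_def int_hull_def)
  next
    case False
    then obtain i where i: "u $ i \<noteq> v $ i" by (auto simp: vec_eq_iff)
    define u' where "u' = (\<chi> j. if j = i then u $ j + sgn (v $ i - u $ i) else u $ j)"
    have u'i: "\<bar>u $ i - u' $ i\<bar> = 1" "\<bar>u' $ i - v $ i\<bar> = \<bar>u $ i - v $ i\<bar> - 1"
      using i by (auto simp: u'_def sgn_if)
    have u'j: "u' $ j = u $ j" if "j \<noteq> i" for j using that by (simp add: u'_def)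
    have adj: "adjacent u u'"
    proof -
      have "(\<Sum>j\<in>UNIV. \<bar>u $ j - u' $ j\<bar>) = (\<Sum>j\<in>UNIV. if j = i then 1 else 0)"
        by (rule sum.cong) (use u'i u'j in auto)
      then show ?thesis by (simp add: adjacent_def)
    qed
    have "l1_dist u' v = (\<Sum>j\<in>UNIV. \<bar>u $ j - v $ j\<bar> - (if j = i then 1 else 0))"
      unfolding l1_dist_def by (rule sum.cong) (use u'i u'j in auto)
    then have l: "l1_dist u' v = l1_dist u v - 1" by (simp add: l1_dist_def sum_subtractf)
    have "int_hull u' v \<subseteq> int_hull u v"
    proof
      fix x assume x: "x \<in> int_hull u' v"
      show "x \<in> int_hull u v" unfolding int_hull_def
      proof (safe)
        fix j
        have "min (u' $ j) (v $ j) \<le> x $ j \<and> x $ j \<le> max (u' $ j) (v $ j)" using x by (auto simp: int_hull_def)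
        moreover have "min (u $ j) (v $ j) \<le> min (u' $ j) (v $ j) \<and> max (u' $ j) (v $ j) \<le> max (u $ j) (v $ j)"
          using i by (cases "j = i") (auto simp: u'_def sgn_if)
        ultimately show "min (u $ j) (v $ j) \<le> x $ j" "x $ j \<le> max (u $ j) (v $ j)" by linarith+
      qed
    qed
    moreover have "nat (l1_dist u' v) < nat (l1_dist u v)" using l l1_nonneg[of u' v] by simp
    then obtain p where p: "walk p u' v" "length p = nat (l1_dist u' v) + 1" "set p \<subseteq> int_hull u' v"
      using less by blast
    moreover have "u \<in> int_hull u v" by (auto simp: int_hull_def)
    ultimately show ?thesis
      using l l1_nonneg[of u' v] adj by (intro exI[of _ "u # p"]) (auto simp: walk_Cons)
  qed
qed

lemma edges_of_walk_single [simp]: "edges_of_walk [x] = {}"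
  by (simp add: edges_of_walk_def)

lemma edges_of_walk_Nil [simp]: "edges_of_walk [] = {}"
  by (simp add: edges_of_walk_def)

lemma edges_of_walk_Cons2 [simp]: "edges_of_walk (x # y # p) = insert {x, y} (edges_of_walk (y # p))"
proof (intro equalityI subsetI)
  fix e assume "e \<in> edges_of_walk (x # y # p)"
  then obtain i where i: "e = {(x # y # p) ! i, (x # y # p) ! Suc i}" "Suc i < length (x # y # p)"
    unfolding edges_of_walk_def by auto
  show "e \<in> insert {x, y} (edges_of_walk (y # p))"
    using i by (cases i) (auto simp: edges_of_walk_def)
next
  fix e assume "e \<in> insert {x, y} (edges_of_walk (y # p))"
  then consider "e = {x, y}" | i where "e = {(y # p) ! i, (y # p) ! Suc i}" "Suc i < length (y # p)"
    unfolding edges_of_walk_def by auto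
  then show "e \<in> edges_of_walk (x # y # p)"
  proof cases
    case 1
    then show ?thesis unfolding edges_of_walk_def by (intro CollectI exI[of _ 0]) auto
  next
    case 2
    then show ?thesis unfolding edges_of_walk_def by (intro CollectI exI[of _ "Suc i"]) auto
  qed
qed

lemma edges_of_walk_append: "edges_of_walk (p @ x # q) = edges_of_walk (p @ [x]) \<union> edges_of_walk (x # q)"
proof (induction p)
  case (Cons a p)
  then show ?case by (cases p) auto
qed simp

lemma finite_edges_of_walk [simp]: "finite (edges_of_walk p)"
proof (induction p rule: induct_list012)
  case (3 x y zs)
  then show ?case by simp
qed auto

lemma edges_of_walk_subset_set: "e \<in> edges_of_walk p \<Longrightarrow> e \<subseteq> set p"
  by (auto simp: edges_of_walk_def)

lemma edges_of_walk_lattice: "successively adjacent p \<Longrightarrow> edges_of_walk p \<subseteq> lattice_edges"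
proof (induction p rule: induct_list012)
  case (3 x y zs)
  then show ?case by (auto simp: lattice_edges_def)
qed auto

lemma edges_of_walk_ends:
  assumes "successively adjacent p" "e \<in> edges_of_walk p"
  obtains p1 x y p2 where "p = p1 @ x # y # p2" "e = {x, y}" "adjacent x y"
  using assms
proof (induction p arbitrary: thesis rule: induct_list012)
  case (3 a b zs)
  show ?case
  proof (cases "e = {a, b}")
    case True
    then show ?thesis using 3(3)[of "[]" a b zs] 3(4) by auto
  next
    case False
    then have "e \<in> edges_of_walk (b # zs)" using 3(5) by auto
    moreover have "successively adjacent (b # zs)" using 3(4) by auto
    ultimately obtain p1 x y p2 where "b # zs = p1 @ x # y # p2" "e = {x, y}" "adjacent x y"
      using 3(2) by metis
    then show ?thesis using 3(3)[of "a # p1" x y p2] by auto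
  qed
qed auto

lemma walk_edges_lattice: "walk p u v \<Longrightarrow> edges_of_walk p \<subseteq> lattice_edges"
  by (simp add: walk_def edges_of_walk_lattice)

lemma walk_append_split:
  "walk (p @ x # q) u v \<longleftrightarrow> walk (p @ [x]) u x \<and> walk (x # q) x v"
  by (cases p rule: rev_cases) (auto simp: walk_def successively_append_iff successively_Cons hd_append)

lemma walk_join:
  assumes "walk p u v" "walk q v w"
  obtains r where "walk r u w" "edges_of_walk r = edges_of_walk p \<union> edges_of_walk q" "set r = set p \<union> set q"
proof -
  obtain p' where p: "p = p' @ [v]" using assms(1) unfolding walk_def by (metis append_butlast_last_id)
  obtain q' where q: "q = v # q'" using assms(2) unfolding walk_def by (metis list.collapse)
  have "walk (p' @ v # q') u w" using assms unfolding p q walk_append_split[of p' v q'] by auto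
  then show ?thesis using that[of "p' @ v # q'"] edges_of_walk_append[of p' v q'] by (auto simp: p q)
qed

lemma edges_of_walk_rev: "edges_of_walk (rev p) = edges_of_walk p"
proof (induction p rule: induct_list012)
  case (3 x y zs)
  have "edges_of_walk (rev (x # y # zs)) = edges_of_walk (rev zs @ y # [x])" by simp
  also have "\<dots> = edges_of_walk (rev (y # zs)) \<union> edges_of_walk [y, x]"
    by (subst edges_of_walk_append) simp
  finally show ?case using 3 by (auto simp: insert_commute)
qed auto

lemma walk_rev: "walk p u v \<Longrightarrow> walk (rev p) v u"
proof -
  have "successively (\<lambda>x y. adjacent y x) p = successively adjacent p"
    by (rule successively_cong) (auto simp: adjacent_sym)
  then show "walk p u v \<Longrightarrow> walk (rev p) v u" by (auto simp: walk_def hd_rev last_rev)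
qed

lemma loop_erasure:
  assumes "walk p u v"
  shows "\<exists>q. walk q u v \<and> distinct q \<and> edges_of_walk q \<subseteq> edges_of_walk p \<and> set q \<subseteq> set p"
  using assms
proof (induction "length p" arbitrary: p rule: less_induct)
  case less
  show ?case
  proof (cases "distinct p")
    case False
    then obtain xs ys zs y where p: "p = xs @ [y] @ ys @ [y] @ zs" using not_distinct_decomp by blast
    have w: "walk (xs @ y # zs) u v"
    proof -
      have "walk (xs @ [y]) u y" "walk (y # ys @ y # zs) y v" using less.prems walk_append_split[of xs y "ys @ y # zs"] by (auto simp: p)
      moreover have "walk (y # zs) y v" using calculation(2) walk_append_split[of "y # ys" y zs] by auto
      ultimately show ?thesis using walk_append_split by blast
    qed
    have e: "edges_of_walk (xs @ y # zs) \<subseteq> edges_of_walk p"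
      using edges_of_walk_append[of xs y "ys @ y # zs"] edges_of_walk_append[of "y # ys" y zs]
        edges_of_walk_append[of xs y zs] by (auto simp: p)
    have "length (xs @ y # zs) < length p" by (simp add: p)
    from less.hyps[OF this w] obtain q where "walk q u v" "distinct q" "edges_of_walk q \<subseteq> edges_of_walk (xs @ y # zs)" "set q \<subseteq> set (xs @ y # zs)" by blast
    then show ?thesis using e by (intro exI[of _ q]) (auto simp: p)
  qed (use less in auto)
qed

lemma card_edges_distinct: 
  assumes "distinct p" shows "card (edges_of_walk p) = length p - 1"
  using assms
proof (induction p rule: induct_list012)
  case (3 x y zs)
  have "{x, y} \<notin> edges_of_walk (y # zs)"
    using 3(3) edges_of_walk_subset_set[of "{x,y}" "y # zs"] by auto
  then show ?case using 3 by simp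
qed auto

text \<open>A common edge would lie inside the only common vertex \<open>x\<close>, but an edge has
  two distinct endpoints. This makes the cost of a path additive at a cut, although costs are sums
  over edge sets.\<close>

lemma edges_split_disjoint:
  assumes "distinct (p @ x # q)" "successively adjacent (p @ x # q)"
  shows "edges_of_walk (p @ [x]) \<inter> edges_of_walk (x # q) = {}"
proof (rule ccontr)
  assume "\<not> ?thesis"
  then obtain e where e: "e \<in> edges_of_walk (p @ [x])" "e \<in> edges_of_walk (x # q)" by auto
  then have "e \<subseteq> {x}" using assms(1) edges_of_walk_subset_set[of e] by fastforce
  moreover have "e \<in> lattice_edges" 
    using e(2) assms(2) edges_of_walk_lattice[of "x # q"] by (auto simp: successively_append_iff)
  then obtain a b where "e = {a, b}" "a \<noteq> b" unfolding lattice_edges_def using adjacent_neq by blast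
  ultimately show False by auto
qed

subsection \<open>Passage times between lattice points\<close>

text \<open>Arbitrary walks compete, not only self-avoiding ones, and a repeated edge is paid once.
  For nonnegative weights loop erasure shows that the infimum is unaffected, and concatenation gives
  the triangle inequality directly.\<close>

definition walk_dist :: "((int ^ 'd) set \<Rightarrow> real) \<Rightarrow> int ^ 'd \<Rightarrow> int ^ 'd \<Rightarrow> real" where
  "walk_dist w u v = (INF p\<in>{p. walk p u v}. sum w (edges_of_walk p))"

lemma walk_exists: "\<exists>p. walk p u v" using walk_hull_exists by blast

lemma sum_edges_nonneg:
  assumes "\<And>e. e \<in> lattice_edges \<Longrightarrow> 0 \<le> w e" "walk p u v"
  shows "0 \<le> (sum w (edges_of_walk p) :: real)"
  using assms walk_edges_lattice[OF assms(2)] by (intro sum_nonneg) auto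

lemma walk_dist_bdd:
  assumes "\<And>e. e \<in> lattice_edges \<Longrightarrow> 0 \<le> w e"
  shows "bdd_below ((\<lambda>p. sum w (edges_of_walk p) :: real) ` {p. walk p u v})"
  using sum_edges_nonneg[OF assms] by (intro bdd_belowI2[of _ 0]) auto

lemma walk_dist_le:
  assumes "\<And>e. e \<in> lattice_edges \<Longrightarrow> 0 \<le> w e" "walk p u v"
  shows "walk_dist w u v \<le> sum w (edges_of_walk p)"
  unfolding walk_dist_def using assms by (intro cINF_lower walk_dist_bdd) auto

text \<open>Loop erasure discards only nonnegative weights, so a lower bound has to be checked on
  self-avoiding walks alone.\<close>

lemma walk_dist_greatest:
  assumes "\<And>p. walk p u v \<Longrightarrow> distinct p \<Longrightarrow> c \<le> sum w (edges_of_walk p)"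
    "\<And>e. e \<in> lattice_edges \<Longrightarrow> 0 \<le> w e"
  shows "c \<le> walk_dist w u v"
  unfolding walk_dist_def
proof (rule cINF_greatest)
  show "{p. walk p u v} \<noteq> {}" using walk_exists by auto
next
  fix p assume "p \<in> {p. walk p u v}"
  then have p: "walk p u v" by simp
  then obtain q where q: "walk q u v" "distinct q" "edges_of_walk q \<subseteq> edges_of_walk p" using loop_erasure by blast
  then have "c \<le> sum w (edges_of_walk q)" using assms by blast
  also have "\<dots> \<le> sum w (edges_of_walk p)"
    using q assms(2) walk_edges_lattice[OF p] by (intro sum_mono2) auto
  finally show "c \<le> sum w (edges_of_walk p)" .
qed

lemma walk_dist_nonneg:
  assumes "\<And>e. e \<in> lattice_edges \<Longrightarrow> 0 \<le> w e" shows "0 \<le> walk_dist w u v"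
  using sum_edges_nonneg[OF assms] assms by (intro walk_dist_greatest) auto

lemma sum_Un_le:
  fixes w :: "'a \<Rightarrow> real"
  assumes "finite A" "finite B" "\<And>e. e \<in> A \<union> B \<Longrightarrow> 0 \<le> w e"
  shows "sum w (A \<union> B) \<le> sum w A + sum w B"
  using assms by (simp add: sum_Un) (rule sum_nonneg, auto)

lemma walk_dist_triangle:
  assumes w: "\<And>e. e \<in> lattice_edges \<Longrightarrow> 0 \<le> w e"
  shows "walk_dist w u z \<le> walk_dist w u v + walk_dist w v z"
proof -
  have "walk_dist w u z - sum w (edges_of_walk p) \<le> walk_dist w v z" if p: "walk p u v" for p
  proof (rule walk_dist_greatest)
    fix q assume q: "walk q v z"
    obtain r where r: "walk r u z" "edges_of_walk r = edges_of_walk p \<union> edges_of_walk q" "set r = set p \<union> set q"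
      by (rule walk_join[OF p q])
    have "walk_dist w u z \<le> sum w (edges_of_walk r)" by (rule walk_dist_le[OF w r(1)])
    also have "\<dots> \<le> sum w (edges_of_walk p) + sum w (edges_of_walk q)"
      unfolding r(2) using w walk_edges_lattice[OF p] walk_edges_lattice[OF q] by (intro sum_Un_le) auto
    finally show "walk_dist w u z - sum w (edges_of_walk p) \<le> sum w (edges_of_walk q)" by simp
  qed (use w in auto)
  then have "walk_dist w u z - walk_dist w v z \<le> walk_dist w u v"
    by (intro walk_dist_greatest w) (simp add: algebra_simps)
  then show ?thesis by simp
qed

lemma walk_dist_commute: "walk_dist w u v = walk_dist w v u"
proof -
  have "(\<lambda>p. sum w (edges_of_walk p)) ` {p. walk p a b} \<subseteq> (\<lambda>p. sum w (edges_of_walk p)) ` {p. walk p b a}" for a b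
  proof clarify
    fix p assume "walk p a b"
    then have "rev p \<in> {p. walk p b a}" by (simp add: walk_rev)
    then show "sum w (edges_of_walk p) \<in> (\<lambda>p. sum w (edges_of_walk p)) ` {p. walk p b a}"
      by (rule image_eqI[rotated]) (simp add: edges_of_walk_rev)
  qed
  then have "(\<lambda>p. sum w (edges_of_walk p)) ` {p. walk p u v} = (\<lambda>p. sum w (edges_of_walk p)) ` {p. walk p v u}"
    by blast
  then show ?thesis by (simp add: walk_dist_def)
qed

lemma walk_dist_le_l1:
  assumes w: "\<And>e. e \<in> lattice_edges \<Longrightarrow> 0 \<le> w e \<and> w e \<le> K" and "0 \<le> K"
  shows "walk_dist w u v \<le> K * l1_dist u v"
proof -
  obtain p where p: "walk p u v" "length p = nat (l1_dist u v) + 1" using walk_hull_exists by blast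
  obtain q where q: "walk q u v" "distinct q" "edges_of_walk q \<subseteq> edges_of_walk p" using loop_erasure[OF p(1)] by blast
  have le: "card (edges_of_walk p) \<le> length p - 1" for p :: "(int ^ 'a) list"
  proof (induction p rule: induct_list012)
    case (3 x y zs)
    have "card (insert {x, y} (edges_of_walk (y # zs))) \<le> Suc (card (edges_of_walk (y # zs)))"
      by (rule card_insert_le_m1) auto
    then show ?case using 3 by simp
  qed auto
  have "walk_dist w u v \<le> sum w (edges_of_walk p)" using w p by (intro walk_dist_le) auto
  also have "\<dots> \<le> of_nat (card (edges_of_walk p)) * K"
    using w walk_edges_lattice[OF p(1)] by (intro sum_bounded_above) auto
  also have "\<dots> \<le> real (nat (l1_dist u v)) * K"
    using le[of p] p(2) assms(2) by (intro mult_right_mono) auto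
  finally show ?thesis using l1_nonneg[of u v] by (simp add: mult.commute)
qed

lemma walk_set_l1:
  assumes "walk p u v" "x \<in> set p"
  shows "l1_dist u x \<le> int (length p) - 1"
proof -
  obtain p1 p2 where p: "p = p1 @ x # p2" using split_list[OF assms(2)] by blast
  have "walk q u x \<Longrightarrow> l1_dist u x \<le> int (length q) - 1" for q
  proof (induction q arbitrary: u)
    case (Cons a q)
    show ?case
    proof (cases q)
      case Nil
      then show ?thesis using Cons(2) by (auto simp: walk_def l1_dist_def)
    next
      case (Cons b r)
      then obtain y where "adjacent u y" "walk q y x" using Cons.prems by (auto simp: walk_Cons)
      moreover have "l1_dist u x \<le> l1_dist u y + l1_dist y x" by (rule l1_triangle)
      ultimately show ?thesis using Cons.IH[of y] by (auto simp: adjacent_l1)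
    qed
  qed (auto simp: walk_def)
  moreover have "walk (p1 @ [x]) u x" using assms(1) walk_append_split unfolding p by blast
  ultimately have "l1_dist u x \<le> int (length (p1 @ [x])) - 1" by blast
  then show ?thesis by (simp add: p)
qed

lemma walk_length_le:
  assumes "0 < s" "\<And>e. e \<in> lattice_edges \<Longrightarrow> s \<le> w e" "walk p u v" "distinct p"
  shows "s * (real (length p) - 1) \<le> sum w (edges_of_walk p)"
proof -
  have "of_nat (card (edges_of_walk p)) * s \<le> sum w (edges_of_walk p)"
    using assms(2) walk_edges_lattice[OF assms(3)] by (intro sum_bounded_below) auto
  then show ?thesis using assms(3,4) by (auto simp: card_edges_distinct walk_def of_nat_diff Suc_leI mult.commute)
qed

text \<open>Weights bounded below by a positive constant only leave finitely many competitors.\<close>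

lemma walk_geodesic_exists:
  assumes s: "0 < s" and w: "\<And>e. e \<in> lattice_edges \<Longrightarrow> s \<le> w e"
  shows "\<exists>p. walk p u v \<and> distinct p \<and> sum w (edges_of_walk p) = walk_dist w u v"
proof -
  have w0: "0 \<le> w e" if "e \<in> lattice_edges" for e using w[OF that] s by simp
  \<comment> \<open>The slack 1 makes \<open>A\<close> nonempty before the infimum is known to be
    attained.\<close>
  define C where "C = walk_dist w u v + 1"
  define A where "A = {p. walk p u v \<and> distinct p \<and> sum w (edges_of_walk p) \<le> C}"
  define n where "n = nat \<lceil>C / s + 1\<rceil>"
  have lenA: "length p \<le> n" if "p \<in> A" for p
  proof -
    have "s * (real (length p) - 1) \<le> C" using walk_length_le[of s w p u v] s w that by (force simp: A_def)
    then have "real (length p) \<le> C / s + 1" using s by (simp add: field_simps)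
    then show ?thesis unfolding n_def by linarith
  qed
  have "A \<subseteq> {p. set p \<subseteq> cube u (int n) \<and> length p \<le> n}"
  proof (clarify, intro conjI)
    fix p assume p: "p \<in> A"
    show "length p \<le> n" by (rule lenA[OF p])
    show "set p \<subseteq> cube u (int n)"
    proof
      fix x assume "x \<in> set p"
      then have "l1_dist u x \<le> int n" using walk_set_l1[of p u v x] lenA[OF p] p by (auto simp: A_def)
      then show "x \<in> cube u (int n)" unfolding cube_def using coord_le_l1[of u _ x] by (auto simp: abs_minus_commute intro: order_trans)
    qed
  qed
  then have fin: "finite A" using finite_lists_length_le[OF finite_cube] finite_subset by blast
  have ex: "\<exists>p\<in>A. sum w (edges_of_walk p) \<le> c" if "walk_dist w u v < c" "c \<le> C" for c
  proof (rule ccontr)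
    assume "\<not> ?thesis"
    then have "\<And>p. walk p u v \<Longrightarrow> distinct p \<Longrightarrow> c \<le> sum w (edges_of_walk p)"
      using that(2) by (force simp: A_def)
    then have "c \<le> walk_dist w u v" using w0 by (rule walk_dist_greatest)
    then show False using that by simp
  qed
  have "A \<noteq> {}" using ex[of C] by (auto simp: C_def)
  define m where "m = Min ((\<lambda>p. sum w (edges_of_walk p)) ` A)"
  have "m \<in> (\<lambda>p. sum w (edges_of_walk p)) ` A" unfolding m_def using fin \<open>A \<noteq> {}\<close> by (intro Min_in) auto
  then obtain p where p: "p \<in> A" "sum w (edges_of_walk p) = m" by auto
  have "m \<le> walk_dist w u v"
  proof (rule ccontr)
    assume "\<not> ?thesis"
    then have lt: "walk_dist w u v < min C m" by (simp add: C_def)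
    define c where "c = (walk_dist w u v + min C m) / 2"
    have c: "walk_dist w u v < c" "c < m" "c \<le> C" using lt by (auto simp: c_def)
    from ex[OF c(1,3)] obtain q where "q \<in> A" "sum w (edges_of_walk q) \<le> c" by blast
    moreover then have "m \<le> sum w (edges_of_walk q)" unfolding m_def using fin by (intro Min_le) auto
    ultimately show False using c by simp
  qed
  moreover have "walk_dist w u v \<le> m" using walk_dist_le[of w p u v] p w0 by (auto simp: A_def)
  ultimately show ?thesis using p by (auto simp: A_def)
qed

lemma walk_dist_eq_passage_time:
  assumes w: "\<And>e. e \<in> lattice_edges \<Longrightarrow> 0 \<le> w e"
  shows "passage_time w x y = walk_dist w (int_point x) (int_point y)"
proof (rule antisym)
  have paths: "paths x y = {edges_of_walk p |p. walk p (int_point x) (int_point y) \<and> distinct p}"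
    by (auto simp: paths_def walk_def)
  show "passage_time w x y \<le> walk_dist w (int_point x) (int_point y)"
  proof (rule walk_dist_greatest)
    fix p assume "walk p (int_point x) (int_point y)" "distinct p"
    then have "edges_of_walk p \<in> paths x y" by (auto simp: paths)
    moreover have "bdd_below (path_time w ` paths x y)"
      using sum_edges_nonneg[OF w] by (intro bdd_belowI2[of _ 0]) (auto simp: paths path_time_def)
    ultimately show "passage_time w x y \<le> sum w (edges_of_walk p)"
      unfolding passage_time_def by (metis cINF_lower path_time_def)
  qed (use w in auto)
  obtain q where "walk q (int_point x) (int_point y)" "distinct q"
    using walk_exists loop_erasure by blast
  then have "paths x y \<noteq> {}" by (auto simp: paths)
  then show "walk_dist w (int_point x) (int_point y) \<le> passage_time w x y"
    unfolding passage_time_def using walk_dist_le[OF w]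
    by (intro cINF_greatest) (auto simp: paths path_time_def)
qed

subsection \<open>Connected sets of lattice points\<close>

text \<open>Connectedness in terms of locally constant predicates instead of paths: a proof only has
  to propagate an arbitrary predicate, and the unicoherence argument can turn such a predicate into
  an integer cochain.\<close>

definition lconn :: "(int ^ 'd) set \<Rightarrow> bool" where
  "lconn S \<longleftrightarrow> (\<forall>P. (\<forall>x\<in>S. \<forall>y\<in>S. adjacent x y \<longrightarrow> (P x \<longleftrightarrow> P y)) \<longrightarrow> (\<forall>x\<in>S. \<forall>y\<in>S. P x \<longleftrightarrow> P y))"

text \<open>Adjacency including diagonals, and reflexive. It is dual to \<open>adjacent\<close>: the
  outer boundary of a star-connected cluster is connected in the nearest-neighbour sense.\<close>

definition star_adj :: "int ^ 'd \<Rightarrow> int ^ 'd \<Rightarrow> bool" where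
  "star_adj x y \<longleftrightarrow> (\<forall>i. \<bar>x $ i - y $ i\<bar> \<le> 1)"

lemma star_adj_sym: "star_adj x y \<longleftrightarrow> star_adj y x"
  by (simp add: star_adj_def abs_minus_commute)

lemma walk_invariant:
  assumes "walk p u v" "\<And>x y. x \<in> set p \<Longrightarrow> y \<in> set p \<Longrightarrow> adjacent x y \<Longrightarrow> P x \<longleftrightarrow> P y"
  shows "P u \<longleftrightarrow> P v"
  using assms
proof (induction p arbitrary: u)
  case (Cons a p)
  show ?case
  proof (cases "p = []")
    case False
    then obtain y where y: "adjacent u y" "walk p y v" "a = u" using Cons.prems(1) by (auto simp: walk_Cons)
    have "y \<in> set p" using y(2) by (auto simp: walk_def)
    then have "P u \<longleftrightarrow> P y" using Cons.prems(2) y by auto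
    moreover have "P y \<longleftrightarrow> P v" using Cons.IH[OF y(2)] Cons.prems(2) by auto
    ultimately show ?thesis by simp
  qed (use Cons.prems in \<open>auto simp: walk_def\<close>)
qed (auto simp: walk_def)

lemma walk_crossing:
  assumes "walk p u v" "\<not> P u" "P v"
  shows "\<exists>x y. x \<in> set p \<and> y \<in> set p \<and> adjacent x y \<and> \<not> P x \<and> P y"
  using walk_invariant[OF assms(1), of P] assms(2,3) adjacent_sym by blast

lemma hull_invariant:
  assumes "\<And>x y. x \<in> int_hull u v \<Longrightarrow> y \<in> int_hull u v \<Longrightarrow> adjacent x y \<Longrightarrow> P x \<longleftrightarrow> P y"
  shows "P u \<longleftrightarrow> P v"
proof -
  obtain p where "walk p u v" "set p \<subseteq> int_hull u v" using walk_hull_exists by blast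
  then show ?thesis using walk_invariant[of p u v P] assms by blast
qed

lemma lconnI:
  assumes "\<And>P x y. (\<And>x y. x \<in> S \<Longrightarrow> y \<in> S \<Longrightarrow> adjacent x y \<Longrightarrow> P x \<longleftrightarrow> P y) \<Longrightarrow> x \<in> S \<Longrightarrow> y \<in> S \<Longrightarrow> P x \<longleftrightarrow> P y"
  shows "lconn S"
  unfolding lconn_def
proof (intro allI impI ballI)
  fix P :: "int ^ 'a \<Rightarrow> bool" and x y
  assume P: "\<forall>x\<in>S. \<forall>y\<in>S. adjacent x y \<longrightarrow> (P x \<longleftrightarrow> P y)" and xy: "x \<in> S" "y \<in> S"
  show "P x \<longleftrightarrow> P y" by (rule assms[OF _ xy]) (use P in blast)
qed

lemma lconnD:
  assumes "lconn S" "\<And>x y. x \<in> S \<Longrightarrow> y \<in> S \<Longrightarrow> adjacent x y \<Longrightarrow> P x \<longleftrightarrow> P y" "x \<in> S" "y \<in> S"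
  shows "P x \<longleftrightarrow> P y"
proof -
  have "\<forall>x\<in>S. \<forall>y\<in>S. adjacent x y \<longrightarrow> (P x \<longleftrightarrow> P y)" using assms(2) by blast
  then show ?thesis using assms(1,3,4) unfolding lconn_def by blast
qed

text \<open>Apply connectedness to the predicate that \<open>x\<close> reaches a point inside
  \<open>S\<close>, which is locally constant.\<close>

lemma lconn_walk:
  assumes "lconn S" "x \<in> S" "y \<in> S"
  shows "\<exists>p. walk p x y \<and> set p \<subseteq> S"
proof -
  define P where "P = (\<lambda>z. \<exists>p. walk p x z \<and> set p \<subseteq> S)"
  have step: "P b" if h: "a \<in> S" "b \<in> S" "adjacent a b" "P a" for a b
  proof -
    obtain p where p: "walk p x a" "set p \<subseteq> S" using h(4) unfolding P_def by blast
    have "walk [a, b] a b" using h by (auto simp: walk_def)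
    then obtain r where "walk r x b" "edges_of_walk r = edges_of_walk p \<union> edges_of_walk [a, b]"
      "set r = set p \<union> set [a, b]" by (rule walk_join[OF p(1)])
    then show ?thesis unfolding P_def using p h by (intro exI[of _ r]) auto
  qed
  have "P x \<longleftrightarrow> P y"
    by (rule lconnD[OF assms(1) _ assms(2,3)]) (use step adjacent_sym in blast)
  moreover have "P x" unfolding P_def using assms by (intro exI[of _ "[x]"]) (auto simp: walk_def)
  ultimately show ?thesis by (simp add: P_def)
qed

text \<open>A point outside the cube has a coordinate \<open>i\<close> out of range, and moving
  while that coordinate is frozen stays outside. Two such moves reach the corner \<open>t\<close>:
  first \<open>i\<close> is frozen, then some \<open>j\<close> different from \<open>i\<close>,
  which by then agrees with \<open>t\<close>. In dimension one there is no such
  \<open>j\<close>.\<close>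

lemma lconn_Compl_cube:
  fixes v :: "int ^ 'd"
  assumes "CARD('d) \<ge> 2"
  shows "lconn (- cube v R)"
proof (rule lconnI)
  fix P :: "int ^ 'd \<Rightarrow> bool" and x y
  assume inv: "\<And>x y. x \<in> - cube v R \<Longrightarrow> y \<in> - cube v R \<Longrightarrow> adjacent x y \<Longrightarrow> P x \<longleftrightarrow> P y"
    and xy: "x \<in> - cube v R" "y \<in> - cube v R"
  define t where "t = (\<chi> i. v $ i + \<bar>R\<bar> + 1)"
  have move: "P a \<longleftrightarrow> P b" if "a $ i = b $ i" "\<bar>a $ i - v $ i\<bar> > R" for a b i
  proof (rule hull_invariant)
    fix x y assume h: "x \<in> int_hull a b" "y \<in> int_hull a b" and adj: "adjacent x y"
    have "x $ i = a $ i" "y $ i = a $ i"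
      using h that(1) by (auto simp: int_hull_def dest!: spec[of _ i])
    then have "x \<in> - cube v R" "y \<in> - cube v R" using that(2) by (auto simp: cube_def not_le intro!: exI[of _ i])
    then show "P x \<longleftrightarrow> P y" by (rule inv[OF _ _ adj])
  qed
  have "P z \<longleftrightarrow> P t" if h: "z \<in> - cube v R" for z
  proof -
    obtain i where i: "\<bar>z $ i - v $ i\<bar> > R" using h by (auto simp: cube_def not_le)
    have "\<exists>j. j \<noteq> i"
    proof (rule ccontr)
      assume "\<not> ?thesis"
      then have "(UNIV :: 'd set) = {i}" by auto
      then have "CARD('d) = card {i}" by (rule arg_cong)
      then show False using assms by simp
    qed
    then obtain j where j: "j \<noteq> i" by blast
    define y where "y = (\<chi> k. if k = i then z $ i else t $ k)"
    have "P z \<longleftrightarrow> P y" by (rule move[of _ i]) (use i in \<open>auto simp: y_def\<close>)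
    also have "P y \<longleftrightarrow> P t" by (rule move[of _ j]) (use j in \<open>auto simp: y_def t_def\<close>)
    finally show ?thesis .
  qed
  then show "P x \<longleftrightarrow> P y" using xy by simp
qed

subsection \<open>Closed cochains are exact\<close>

lemma adjacent_axis: "adjacent x y \<longleftrightarrow> (\<exists>i. y = x + axis i 1 \<or> x = y + axis i 1)"
proof
  assume a: "adjacent x y"
  then have "\<exists>i. x $ i \<noteq> y $ i" using adjacent_neq by (auto simp: vec_eq_iff)
  then obtain i where i: "x $ i \<noteq> y $ i" by blast
  have s: "\<bar>x $ i - y $ i\<bar> + (\<Sum>j\<in>UNIV - {i}. \<bar>x $ j - y $ j\<bar>) = 1"
    using a unfolding adjacent_def by (subst (asm) sum.remove[of _ i]) auto
  have n: "(\<Sum>j\<in>UNIV - {i}. \<bar>x $ j - y $ j\<bar>) \<ge> 0" by (rule sum_nonneg) auto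
  have one: "\<bar>x $ i - y $ i\<bar> = 1" using s n i by linarith
  then have "(\<Sum>j\<in>UNIV - {i}. \<bar>x $ j - y $ j\<bar>) = 0" using s by simp
  then have eq: "x $ j = y $ j" if "j \<noteq> i" for j using that by (subst (asm) sum_nonneg_eq_0_iff) auto
  from one consider "y $ i = x $ i + 1" | "x $ i = y $ i + 1" by linarith
  then show "\<exists>i. y = x + axis i 1 \<or> x = y + axis i 1"
  proof cases
    case 1
    then have "y = x + axis i 1" using eq by (auto simp: vec_eq_iff axis_def)
    then show ?thesis by blast
  next
    case 2
    then have "x = y + axis i 1" using eq by (auto simp: vec_eq_iff axis_def)
    then show ?thesis by blast
  qed
next
  have "adjacent z (z + axis i 1)" for z :: "int ^ 'a" and i
  proof -
    have "(\<Sum>j\<in>UNIV. \<bar>z $ j - (z + axis i 1) $ j\<bar>) = (\<Sum>j\<in>UNIV. if j = i then 1 else 0)"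
      by (rule sum.cong) (auto simp: axis_def)
    then show ?thesis by (simp add: adjacent_def)
  qed
  then show "\<exists>i. y = x + axis i 1 \<or> x = y + axis i 1 \<Longrightarrow> adjacent x y" using adjacent_sym by blast
qed

lemma int_antidifference: "\<exists>S. \<forall>n::int. S (n + 1) - S n = (a n :: int)"
proof -
  define S where "S n = (if 0 \<le> n then \<Sum>k\<in>{0..<n}. a k else - (\<Sum>k\<in>{n..<0}. a k))" for n
  have "S (n + 1) - S n = a n" for n
  proof (cases "0 \<le> n")
    case True
    then have "{0..<n + 1} = insert n {0..<n}" by auto
    then show ?thesis using True by (simp add: S_def)
  next
    case False
    then have "{n..<0} = insert n {n + 1..<0}" by auto
    then show ?thesis using False by (auto simp: S_def)
  qed
  then show ?thesis by blast
qed

text \<open>A discrete Poincare lemma, by induction over the directions already integrated. By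
  closedness the defect in a new direction \<open>j\<close> is constant along the earlier ones, so
  adding its primitive along \<open>j\<close> corrects \<open>j\<close> without spoiling
  them.\<close>

lemma closed_cochain_exact:
  fixes c :: "int ^ 'd \<Rightarrow> 'd \<Rightarrow> int"
  assumes closed: "\<And>x i j. i \<noteq> j \<Longrightarrow> c x i + c (x + axis i 1) j = c x j + c (x + axis j 1) i"
  shows "\<exists>f. \<forall>x i. f (x + axis i 1) - f x = c x i"
proof -
  have "\<forall>a. \<exists>S. \<forall>n::int. S (n + 1) - S n = (a n :: int)" using int_antidifference by blast
  \<comment> \<open>\<open>D\<close> depends on the function \<open>a\<close> alone, so equal
    functions get equal primitives, with no freedom in the constant. The invariance of
    \<open>g\<close> below rests on this.\<close>
  then obtain D where "\<forall>a. \<forall>n::int. D a (n + 1) - D a n = (a n :: int)" unfolding choice_iff by blast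
  then have D: "D a (n + 1) - D a n = a n" for a n by blast
  have "\<exists>f. \<forall>x. \<forall>i\<in>S. f (x + axis i 1) - f x = c x i" for S :: "'d set"
    using finite[of S]
  proof (induction S rule: finite_induct)
    case (insert j S)
    then obtain f where f: "\<And>x i. i \<in> S \<Longrightarrow> f (x + axis i 1) - f x = c x i" by auto
    define c' where "c' = (\<lambda>x. c x j - (f (x + axis j 1) - f x))"
    define put where "put x k = (\<chi> l. if l = j then k else x $ l)" for x :: "int ^ 'd" and k
    define g where "g x = D (\<lambda>k. c' (put x k)) (x $ j)" for x
    have c'_inv: "c' (x + axis i 1) = c' x" if "i \<in> S" for x i
    proof -
      have "i \<noteq> j" using that insert by auto
      have "x + axis i 1 + axis j 1 = x + axis j 1 + axis i 1" by (simp add: algebra_simps)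
      then show ?thesis
        unfolding c'_def using closed[OF \<open>i \<noteq> j\<close>, of x] f[OF that, of x] f[OF that, of "x + axis j 1"]
        by (simp only: algebra_simps)
    qed
    have "g (x + axis i 1) = g x" if "i \<in> S" for x i
    proof -
      have ij: "i \<noteq> j" using that insert by auto
      then have "put (x + axis i 1) k = put x k + axis i 1" for k
        by (auto simp: put_def vec_eq_iff axis_def)
      then have "c' (put (x + axis i 1) k) = c' (put x k)" for k using c'_inv[OF that] by simp
      moreover have "(x + axis i 1) $ j = x $ j" using ij by (simp add: axis_def)
      ultimately show ?thesis by (simp add: g_def)
    qed
    moreover have "g (x + axis j 1) - g x = c' x" for x
    proof -
      have "put (x + axis j 1) k = put x k" for k by (auto simp: put_def vec_eq_iff axis_def)
      moreover have "(x + axis j 1) $ j = x $ j + 1" by (simp add: axis_def)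
      moreover have "put x (x $ j) = x" by (auto simp: put_def vec_eq_iff)
      ultimately show ?thesis using D[of "\<lambda>k. c' (put x k)" "x $ j"] by (simp add: g_def)
    qed
    ultimately have "\<forall>x. \<forall>i\<in>insert j S. (f (x + axis i 1) + g (x + axis i 1)) - (f x + g x) = c x i"
      using f unfolding c'_def by (auto simp: algebra_simps)
    then show ?case by (intro exI[of _ "\<lambda>x. f x + g x"])
  qed auto
  from this[of UNIV] show ?thesis by auto
qed

text \<open>A separation of the intersection would give a closed cochain that vanishes on Y and is the
  coboundary of an indicator on X. Its primitive is constant on Y.\<close>

lemma lattice_unicoherent:
  fixes X Y :: "(int ^ 'd) set"
  assumes X: "lconn X" and Y: "lconn Y"
    and sq: "\<And>x i j. i \<noteq> j \<Longrightarrow> {x, x + axis i 1, x + axis j 1, x + axis i 1 + axis j 1} \<subseteq> X \<or>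
        {x, x + axis i 1, x + axis j 1, x + axis i 1 + axis j 1} \<subseteq> Y"
  shows "lconn (X \<inter> Y)"
proof (rule lconnI)
  fix P :: "int ^ 'd \<Rightarrow> bool" and a b
  assume inv: "\<And>x y. x \<in> X \<inter> Y \<Longrightarrow> y \<in> X \<inter> Y \<Longrightarrow> adjacent x y \<Longrightarrow> P x \<longleftrightarrow> P y"
    and ab: "a \<in> X \<inter> Y" "b \<in> X \<inter> Y"
  define F where "F x = (if P x then 1 else 0 :: int)" for x
  define c where "c x i = (if x \<in> X \<and> x + axis i 1 \<in> X then F (x + axis i 1) - F x else 0)" for x i
  have c0: "c x i = 0" if "x \<in> Y" "x + axis i 1 \<in> Y" for x i
    using that inv[of x "x + axis i 1"] by (auto simp: c_def F_def adjacent_axis)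
  \<comment> \<open>By \<open>sq\<close> every unit square lies wholly in \<open>X\<close>, where
    \<open>c\<close> is a coboundary, or wholly in \<open>Y\<close>, where it vanishes.\<close>
  have "c x i + c (x + axis i 1) j = c x j + c (x + axis j 1) i" if "i \<noteq> j" for x i j
  proof -
    have comm: "x + axis j 1 + axis i 1 = x + axis i 1 + axis j 1" by (simp add: algebra_simps)
    from sq[OF that, of x] show ?thesis
    proof
      assume "{x, x + axis i 1, x + axis j 1, x + axis i 1 + axis j 1} \<subseteq> X"
      then show ?thesis by (auto simp: c_def comm)
    next
      assume Q: "{x, x + axis i 1, x + axis j 1, x + axis i 1 + axis j 1} \<subseteq> Y"
      then have "c x i = 0" "c x j = 0" "c (x + axis i 1) j = 0" by (auto intro!: c0)
      moreover have "c (x + axis j 1) i = 0" by (rule c0) (use Q in \<open>auto simp: comm\<close>)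
      ultimately show ?thesis by simp
    qed
  qed
  then obtain g where g: "\<And>x i. g (x + axis i 1) - g x = c x i" using closed_cochain_exact[of c] by blast
  have gY: "g x = g y" if "x \<in> Y" "y \<in> Y" "adjacent x y" for x y
    using that(3) unfolding adjacent_axis using g c0 that(1,2) by (metis eq_iff_diff_eq_0)
  have gX: "g x - F x = g y - F y" if xy: "x \<in> X" "y \<in> X" "adjacent x y" for x y
  proof -
    have "g (z + axis i 1) - F (z + axis i 1) = g z - F z" if "z \<in> X" "z + axis i 1 \<in> X" for z i
      using g[of z i] that by (simp add: c_def)
    then show ?thesis using xy unfolding adjacent_axis by metis
  qed
  \<comment> \<open>On \<open>Y\<close> the primitive is constant, on \<open>X\<close> it differs
    from \<open>F\<close> by a constant; comparing both at \<open>a\<close> and \<open>b\<close>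
    yields \<open>F a = F b\<close>.\<close>
  have "g a = g a \<longleftrightarrow> g b = g a"
    by (rule lconnD[OF Y, of "\<lambda>z. g z = g a"]) (use gY ab in auto)
  moreover have "g a - F a = g a - F a \<longleftrightarrow> g b - F b = g a - F a"
    by (rule lconnD[OF X, of "\<lambda>z. g z - F z = g a - F a"]) (use gX ab in auto)
  ultimately have "F a = F b" by simp
  then show "P a \<longleftrightarrow> P b" by (auto simp: F_def split: if_splits)
qed

subsection \<open>Shells around finite clusters\<close>

text \<open>The seed \<open>C\<close> belongs to the cluster whether bad or not, so that a cube and
  all bad clusters touching it form one obstacle.\<close>

inductive_set star_cluster :: "(int ^ 'd) set \<Rightarrow> (int ^ 'd) set \<Rightarrow> (int ^ 'd) set" for B C where
  base: "x \<in> C \<Longrightarrow> x \<in> star_cluster B C"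
| step: "x \<in> star_cluster B C \<Longrightarrow> star_adj x y \<Longrightarrow> y \<in> B \<Longrightarrow> y \<in> star_cluster B C"

lemma int_hull_star_adj:
  assumes "star_adj x w" "y \<in> int_hull x w" shows "star_adj x y"
  unfolding star_adj_def
proof
  fix i
  have "min (x $ i) (w $ i) \<le> y $ i \<and> y $ i \<le> max (x $ i) (w $ i)" "\<bar>x $ i - w $ i\<bar> \<le> 1"
    using assms by (auto simp: int_hull_def star_adj_def)
  then show "\<bar>x $ i - y $ i\<bar> \<le> 1" by linarith
qed

lemma int_hull_cube: "x \<in> cube v k \<Longrightarrow> y \<in> cube v k \<Longrightarrow> int_hull x y \<subseteq> cube v k"
proof
  fix z assume a: "x \<in> cube v k" "y \<in> cube v k" "z \<in> int_hull x y"
  show "z \<in> cube v k" unfolding cube_def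
  proof safe
    fix i
    have "min (x $ i) (y $ i) \<le> z $ i \<and> z $ i \<le> max (x $ i) (y $ i)" "\<bar>x $ i - v $ i\<bar> \<le> k" "\<bar>y $ i - v $ i\<bar> \<le> k"
      using a by (auto simp: int_hull_def cube_def)
    then show "\<bar>z $ i - v $ i\<bar> \<le> k" by linarith
  qed
qed

text \<open>The last conjunct expresses separation: \<open>S\<close> is a contour that cannot be
  avoided on the way from the inner cube out of the outer one.\<close>

definition shell :: "(int ^ 'd) set \<Rightarrow> int ^ 'd \<Rightarrow> int \<Rightarrow> int \<Rightarrow> (int ^ 'd) set \<Rightarrow> bool" where
  "shell B v k R S \<longleftrightarrow> S \<subseteq> cube v R - cube v k \<and> S \<inter> B = {} \<and> lconn S \<and>
    (\<forall>p u w. walk p u w \<longrightarrow> u \<in> cube v k \<longrightarrow> w \<notin> cube v R \<longrightarrow> set p \<inter> S \<noteq> {})"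

lemma shellD:
  assumes "shell B v k R S"
  shows "S \<subseteq> cube v R - cube v k" "S \<inter> B = {}" "lconn S"
    "walk p u w \<Longrightarrow> u \<in> cube v k \<Longrightarrow> w \<notin> cube v R \<Longrightarrow> set p \<inter> S \<noteq> {}"
  using assms unfolding shell_def by auto

text \<open>The shell is the outer boundary of the cluster \<open>A\<close>. \<open>D\<close> is the
  unbounded component of its complement, and \<open>Y\<close> is the star neighbourhood of the rest,
  that is, of \<open>A\<close> with its holes filled. Both are connected and every unit square lies
  in one of them, so \<open>D \<inter> Y\<close> is connected by unicoherence. Its points are
  star-adjacent to \<open>A\<close> but outside \<open>A\<close>; a bad one would have joined the
  cluster.\<close>

lemma shell_exists:
  fixes v :: "int ^ 'd"
  assumes d: "CARD('d) \<ge> 2" and k: "0 \<le> k"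
    and A: "star_cluster B (cube v k) \<subseteq> cube v (R - 1)"
  shows "\<exists>S. shell B v k R S"
proof -
  define A where "A = star_cluster B (cube v k)"
  define D where "D = {x. \<exists>y p. y \<notin> cube v R \<and> walk p x y \<and> set p \<inter> A = {}}"
  define Y where "Y = {x. \<exists>w. w \<notin> D \<and> star_adj x w}"
  have cubes: "cube v (R - 1) \<subseteq> cube v R" by (auto simp: cube_def) (metis less_imp_le)
  have DA: "x \<notin> A" if "x \<in> D" for x
    using that by (auto simp: D_def walk_def) (metis disjoint_iff list.set_sel(1))
  have out: "x \<in> D" if "x \<notin> cube v R" for x
    unfolding D_def using that A cubes by (intro CollectI exI[of _ x] exI[of _ "[x]"]) (auto simp: walk_def A_def)
  have Dext: "x' \<in> D" if x: "x \<in> D" and adj: "adjacent x' x" and n: "x' \<notin> A" for x x'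
  proof -
    obtain y p where "y \<notin> cube v R" "walk p x y" "set p \<inter> A = {}" using x unfolding D_def by blast
    then show ?thesis unfolding D_def using adj n by (intro CollectI exI[of _ y] exI[of _ "x' # p"]) (auto simp: walk_Cons)
  qed
  have vA: "v \<in> A" unfolding A_def using k by (intro star_cluster.base) (auto simp: cube_def)
  have conD: "lconn D"
  proof (rule lconnI)
    fix P :: "int ^ 'd \<Rightarrow> bool" and x y
    assume inv: "\<And>x y. x \<in> D \<Longrightarrow> y \<in> D \<Longrightarrow> adjacent x y \<Longrightarrow> P x \<longleftrightarrow> P y" and xy: "x \<in> D" "y \<in> D"
    have link: "\<exists>z. z \<notin> cube v R \<and> (P x \<longleftrightarrow> P z)" if h: "x \<in> D" for x
    proof -
      obtain z p where p: "z \<notin> cube v R" "walk p x z" "set p \<inter> A = {}" using h unfolding D_def by blast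
      have sub: "set p \<subseteq> D"
      proof
        fix t assume t: "t \<in> set p"
        obtain p1 p2 where "p = p1 @ t # p2" using split_list[OF t] by blast
        then have "walk (t # p2) t z" "set (t # p2) \<inter> A = {}" using p walk_append_split[of p1 t p2] by auto
        then show "t \<in> D" unfolding D_def using p(1) by blast
      qed
      have "P x \<longleftrightarrow> P z" by (rule walk_invariant[OF p(2)]) (use inv sub in blast)
      then show ?thesis using p(1) by blast
    qed
    obtain x' y' where x': "x' \<notin> cube v R" "P x \<longleftrightarrow> P x'" and y': "y' \<notin> cube v R" "P y \<longleftrightarrow> P y'"
      using link xy by meson
    have "P x' \<longleftrightarrow> P y'" by (rule lconnD[OF lconn_Compl_cube[OF d, of v R]]) (use inv out x' y' in auto)
    then show "P x \<longleftrightarrow> P y" using x' y' by simp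
  qed
  \<comment> \<open>Otherwise the box between \<open>x\<close> and \<open>w\<close> would avoid
    \<open>A\<close>, and membership in \<open>D\<close> would spread from \<open>x\<close> to
    \<open>w\<close>.\<close>
  have DY: "\<exists>a\<in>A. star_adj x a" if h: "x \<in> D" "x \<in> Y" for x
  proof (rule ccontr)
    assume no: "\<not> ?thesis"
    obtain w where w: "w \<notin> D" "star_adj x w" using h unfolding Y_def by blast
    have "x \<in> D \<longleftrightarrow> w \<in> D"
    proof (rule hull_invariant)
      fix y z assume h: "y \<in> int_hull x w" "z \<in> int_hull x w" and adj: "adjacent y z"
      have "y \<notin> A" "z \<notin> A" using no int_hull_star_adj[OF w(2)] h by auto
      then show "y \<in> D \<longleftrightarrow> z \<in> D" using Dext adj adjacent_sym by blast
    qed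
    then show False using w h by simp
  qed
  have conY: "lconn Y"
  proof (rule lconnI)
    fix P :: "int ^ 'd \<Rightarrow> bool" and x y
    assume inv: "\<And>x y. x \<in> Y \<Longrightarrow> y \<in> Y \<Longrightarrow> adjacent x y \<Longrightarrow> P x \<longleftrightarrow> P y" and xy: "x \<in> Y" "y \<in> Y"
    have near: "P a \<longleftrightarrow> P z" if a: "a \<notin> D" and az: "star_adj a z" for a z
    proof (rule hull_invariant)
      fix b c assume h: "b \<in> int_hull a z" "c \<in> int_hull a z" and adj: "adjacent b c"
      have "b \<in> Y" "c \<in> Y" unfolding Y_def using int_hull_star_adj[OF az] h a star_adj_sym by blast+
      then show "P b \<longleftrightarrow> P c" using inv adj by blast
    qed
    have An: "a \<notin> D" if "a \<in> A" for a using DA that by blast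
    have nY: "a \<in> Y" if "a \<notin> D" for a using that unfolding Y_def star_adj_def by fastforce
    have Acon: "P a \<longleftrightarrow> P v" if "a \<in> A" for a
      using that unfolding A_def
    proof (induction rule: star_cluster.induct)
      case (base a)
      show ?case
      proof (rule hull_invariant)
        fix b c assume h: "b \<in> int_hull a v" "c \<in> int_hull a v" and adj: "adjacent b c"
        have "v \<in> cube v k" using k by (simp add: cube_def)
        then have "b \<in> cube v k" "c \<in> cube v k" using int_hull_cube[OF base] h by auto
        then have "b \<in> A" "c \<in> A" by (auto simp: A_def intro: star_cluster.base)
        then show "P b \<longleftrightarrow> P c" using inv adj An nY by blast
      qed
    next
      case (step a b)
      then have "a \<in> A" by (simp add: A_def)
      then have "P a \<longleftrightarrow> P b" by (intro near An step)
      then show ?case using step by simp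
    qed
    \<comment> \<open>This covers the holes of \<open>A\<close>. If \<open>P\<close> at
      \<open>a\<close> differed from \<open>P\<close> at \<open>v\<close>, the points outside
      \<open>D\<close> with the value of \<open>a\<close> would never meet \<open>A\<close>, hence
      would be closed under adjacency and include the far point \<open>t\<close>, which is in
      \<open>D\<close>.\<close>
    have Dc: "P a \<longleftrightarrow> P v" if "a \<notin> D" for a
    proof (rule ccontr)
      assume neq: "\<not> (P a \<longleftrightarrow> P v)"
      define Q where "Q = (\<lambda>z. z \<notin> D \<and> (P z \<longleftrightarrow> P a))"
      have Qstep: "Q z" if "Q y" "adjacent y z" for y z
      proof -
        have "y \<notin> A" using Acon that neq by (auto simp: Q_def)
        have "z \<notin> D" using Dext[of z y] that \<open>y \<notin> A\<close> by (auto simp: Q_def)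
        moreover have "P y \<longleftrightarrow> P z" using that nY inv \<open>z \<notin> D\<close> by (auto simp: Q_def)
        ultimately show ?thesis using that by (auto simp: Q_def)
      qed
      define t where "t = (\<chi> i. v $ i + \<bar>R\<bar> + 1)"
      have "Q a \<longleftrightarrow> Q t" by (rule hull_invariant) (use Qstep adjacent_sym in blast)
      moreover have "Q a" using that by (simp add: Q_def)
      moreover have "t \<in> D" by (rule out) (auto simp: cube_def t_def)
      ultimately show False by (simp add: Q_def)
    qed
    have "P z \<longleftrightarrow> P v" if h: "z \<in> Y" for z
    proof -
      obtain w where "w \<notin> D" "star_adj w z" using h star_adj_sym unfolding Y_def by blast
      then show ?thesis using near Dc by blast
    qed
    then show "P x \<longleftrightarrow> P y" using xy by simp
  qed
  have con: "lconn (D \<inter> Y)"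
  proof (rule lattice_unicoherent[OF conD conY])
    fix x :: "int ^ 'd" and i j :: 'd assume ij: "i \<noteq> j"
    let ?Q = "{x, x + axis i 1, x + axis j 1, x + axis i 1 + axis j 1}"
    have st: "star_adj a b" if "a \<in> ?Q" "b \<in> ?Q" for a b
      using that ij by (auto simp: star_adj_def axis_def)
    show "?Q \<subseteq> D \<or> ?Q \<subseteq> Y"
    proof (cases "?Q \<subseteq> D")
      case False
      then obtain w where "w \<in> ?Q" "w \<notin> D" by blast
      then have "?Q \<subseteq> Y" using st unfolding Y_def by blast
      then show ?thesis ..
    qed simp
  qed
  have cross: "set p \<inter> (D \<inter> Y) \<noteq> {}" if p: "walk p u w" "u \<in> cube v k" "w \<notin> cube v R" for p u w
  proof -
    have "u \<in> A" unfolding A_def using p by (intro star_cluster.base)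
    then have "u \<notin> D" using DA by blast
    moreover have "w \<in> D" using out p by blast
    ultimately obtain x y where xy: "y \<in> set p" "adjacent x y" "x \<notin> D" "y \<in> D"
      using walk_crossing[OF p(1), of "\<lambda>z. z \<in> D"] by blast
    have "\<bar>y $ i - x $ i\<bar> \<le> 1" for i using coord_le_l1[of y i x] xy(2) adjacent_l1 adjacent_sym by metis
    then have "y \<in> Y" unfolding Y_def star_adj_def using xy by blast
    then show ?thesis using xy by blast
  qed
  have "D \<inter> Y \<subseteq> cube v R - cube v k"
  proof
    fix x assume x: "x \<in> D \<inter> Y"
    then obtain a where a: "a \<in> A" "star_adj x a" using DY by blast
    have "a \<in> cube v (R - 1)" using a A by (auto simp: A_def)
    have "x \<in> cube v R" unfolding cube_def
    proof safe
      fix i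
      have "\<bar>a $ i - v $ i\<bar> \<le> R - 1" "\<bar>x $ i - a $ i\<bar> \<le> 1"
        using \<open>a \<in> cube v (R - 1)\<close> a(2) by (auto simp: cube_def star_adj_def)
      then show "\<bar>x $ i - v $ i\<bar> \<le> R" by linarith
    qed
    moreover have "x \<notin> cube v k" using DA[of x] x by (auto simp: A_def intro: star_cluster.base)
    ultimately show "x \<in> cube v R - cube v k" by simp
  qed
  moreover have "(D \<inter> Y) \<inter> B = {}"
  proof (rule ccontr)
    assume "\<not> ?thesis"
    then obtain x where x: "x \<in> D" "x \<in> Y" "x \<in> B" by blast
    then obtain a where a: "a \<in> A" "star_adj x a" using DY by blast
    then have "x \<in> A" using x star_adj_sym unfolding A_def by (blast intro: star_cluster.step)
    then show False using DA x by blast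
  qed
  ultimately show ?thesis unfolding shell_def using con cross by (intro exI[of _ "D \<inter> Y"]) blast
qed

subsection \<open>Truncated weights in a good environment\<close>

definition trunc_weight :: "('e \<Rightarrow> real) \<Rightarrow> real \<Rightarrow> real \<Rightarrow> 'e \<Rightarrow> real" where
  "trunc_weight \<tau> M s e = min (\<tau> e) M + s"

definition bad_points :: "((int ^ 'd) set \<Rightarrow> real) \<Rightarrow> real \<Rightarrow> (int ^ 'd) set" where
  "bad_points \<tau> K = {x. \<exists>e\<in>lattice_edges. x \<in> e \<and> \<tau> e > K}"

text \<open>Here \<open>z\<close> is the target. \<open>clusters\<close> controls bad clusters
  around the points of a box of radius \<open>N\<close>, and \<open>reach\<close> keeps the
  geodesics of the truncated weights in that box. \<open>\<kappa>\<close> is a bound on the number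
  of points of a cube of radius \<open>2 * \<rho>\<close> times the largest cost of an edge at a
  good point, so it bounds any detour along a shell, and \<open>M\<close> exceeds it.
  \<open>far\<close> makes the cubes of radius \<open>2 * \<rho>\<close> around \<open>0\<close> and
  \<open>z\<close> disjoint.\<close>

locale good_environment =
  fixes \<tau> :: "(int ^ 'd) set \<Rightarrow> real" and K M s \<kappa> :: real and \<rho> N :: int and z :: "int ^ 'd"
  assumes dim: "CARD('d) \<ge> 2"
    and nonneg: "\<And>e. e \<in> lattice_edges \<Longrightarrow> 0 \<le> \<tau> e"
    and s: "0 < s" and K: "0 \<le> K" and \<rho>: "1 \<le> \<rho>"
    and clusters: "\<And>v k. v \<in> cube 0 N \<Longrightarrow> 0 \<le> k \<Longrightarrow> k \<le> \<rho> \<Longrightarrow>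
      star_cluster (bad_points \<tau> K) (cube v k) \<subseteq> cube v (k + \<rho> - 1)"
    and \<kappa>: "\<kappa> = real_of_int (4 * \<rho> + 1) ^ CARD('d) * (K + s)" and M: "\<kappa> < M"
    and far: "\<exists>i. \<bar>z $ i\<bar> > 4 * \<rho>"
    and reach: "(M + s) * l1_dist 0 z / s \<le> N"
begin

abbreviation w where "w \<equiv> trunc_weight \<tau> M s"
abbreviation w' where "w' \<equiv> \<lambda>e. \<tau> e + s"

lemma M_pos: "0 < M" and \<kappa>_nonneg: "0 \<le> \<kappa>"
proof -
  show "0 \<le> \<kappa>" unfolding \<kappa> using \<rho> K s by auto
  then show "0 < M" using M by simp
qed

lemma w_bounds: "e \<in> lattice_edges \<Longrightarrow> s \<le> w e \<and> w e \<le> M + s \<and> w e \<le> w' e"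
  using nonneg[of e] M_pos by (auto simp: trunc_weight_def)

lemma w_nonneg: "e \<in> lattice_edges \<Longrightarrow> 0 \<le> w e" and w'_nonneg: "e \<in> lattice_edges \<Longrightarrow> 0 \<le> w' e"
  using w_bounds[of e] s nonneg[of e] by auto

lemmas w'_dist_le = walk_dist_le[where w = w', OF w'_nonneg]

lemmas w'_triangle = walk_dist_triangle[where w = w', OF w'_nonneg]

lemma cube_disjoint: "x \<in> cube 0 (2 * \<rho>) \<Longrightarrow> x \<notin> cube z (2 * \<rho>)"
proof
  assume x: "x \<in> cube 0 (2 * \<rho>)" "x \<in> cube z (2 * \<rho>)"
  obtain i where "\<bar>z $ i\<bar> > 4 * \<rho>" using far by blast
  moreover have "\<bar>x $ i\<bar> \<le> 2 * \<rho>" "\<bar>x $ i - z $ i\<bar> \<le> 2 * \<rho>" using x by (auto simp: cube_def)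
  ultimately show False by linarith
qed

lemma cube_refl: "0 \<le> k \<Longrightarrow> v \<in> cube v k" by (simp add: cube_def)

lemma cube_sym: "x \<in> cube v k \<longleftrightarrow> v \<in> cube x k" by (simp add: cube_def abs_minus_commute)

lemma shell_walk:
  assumes "S \<subseteq> cube v r" "S \<inter> bad_points \<tau> K = {}" "lconn S" "a \<in> S" "b \<in> S" "r \<le> 2 * \<rho>"
  shows "\<exists>p. walk p a b \<and> sum w' (edges_of_walk p) \<le> \<kappa>"
proof -
  obtain q where q: "walk q a b" "set q \<subseteq> S" using lconn_walk[OF assms(3-5)] by blast
  obtain p where p: "walk p a b" "distinct p" "edges_of_walk p \<subseteq> edges_of_walk q" "set p \<subseteq> set q"
    using loop_erasure[OF q(1)] by blast
  have "w' e \<le> K + s" if e: "e \<in> edges_of_walk p" for e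
  proof -
    have "e \<in> lattice_edges" using e walk_edges_lattice[OF p(1)] by blast
    moreover have "e \<subseteq> S" using edges_of_walk_subset_set[OF e] p(4) q(2) by blast
    moreover have "\<exists>x. x \<in> e" using \<open>e \<in> lattice_edges\<close> by (auto simp: lattice_edges_def)
    ultimately show ?thesis using assms(2) by (force simp: bad_points_def)
  qed
  then have "sum w' (edges_of_walk p) \<le> real (card (edges_of_walk p)) * (K + s)"
    by (intro sum_bounded_above) auto
  also have "card (edges_of_walk p) \<le> card (cube v r)"
  proof -
    have "card (edges_of_walk p) \<le> length p" by (simp add: card_edges_distinct[OF p(2)])
    also have "length p = card (set p)" using p(2) by (simp add: distinct_card)
    also have "\<dots> \<le> card (cube v r)" using p(4) q(2) assms(1) by (intro card_mono finite_cube) blast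
    finally show ?thesis .
  qed
  then have "card (edges_of_walk p) \<le> nat (4 * \<rho> + 1) ^ CARD('d)"
  proof (rule order_trans)
    show "card (cube v r) \<le> nat (4 * \<rho> + 1) ^ CARD('d)"
      by (rule order_trans[OF card_cube_le]) (use assms(6) in \<open>auto intro!: power_mono nat_mono\<close>)
  qed
  then have "real (card (edges_of_walk p)) * (K + s) \<le> real (nat (4 * \<rho> + 1) ^ CARD('d)) * (K + s)"
    using K s by (intro mult_right_mono) auto
  also have "\<dots> = \<kappa>" using \<rho> by (simp add: \<kappa>)
  finally show ?thesis using p(1) by blast
qed

text \<open>The endpoints lie outside the cube of radius \<open>\<rho>\<close> around
  \<open>x\<close>, so the geodesic crosses a shell around \<open>x\<close> both before and after
  \<open>x\<close>. Joining the two crossings along the shell costs at most \<open>\<kappa>\<close>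
  and saves the edge \<open>{x, y}\<close>, which would cost \<open>M + s\<close> if it were
  long.\<close>

lemma geodesic_no_long_edge:
  assumes \<eta>: "walk \<eta> 0 z" "distinct \<eta>" "sum w (edges_of_walk \<eta>) = walk_dist w 0 z"
    and eq: "\<eta> = p1 @ x # y # p2" and x: "x \<notin> cube 0 \<rho>" "x \<notin> cube z \<rho>"
  shows "\<tau> {x, y} \<le> M"
proof (rule ccontr)
  assume long: "\<not> \<tau> {x, y} \<le> M"
  \<comment> \<open>Each edge costs at least \<open>s\<close>, so the upper bound for the passage
    time limits the length of the geodesic; hence \<open>clusters\<close> applies at
    \<open>x\<close>.\<close>
  have "x \<in> cube 0 N"
  proof -
    have "s * (real (length \<eta>) - 1) \<le> walk_dist w 0 z"
      using walk_length_le[OF s _ \<eta>(1,2), of w] w_bounds \<eta>(3) by auto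
    also have "\<dots> \<le> (M + s) * l1_dist 0 z" using w_bounds w_nonneg M_pos s by (intro walk_dist_le_l1) auto
    finally have "real (length \<eta>) - 1 \<le> (M + s) * l1_dist 0 z / s" using s by (simp add: field_simps)
    then have "real (length \<eta>) - 1 \<le> N" using reach by linarith
    then have "int (length \<eta>) - 1 \<le> N" by linarith
    moreover have "l1_dist 0 x \<le> int (length \<eta>) - 1" using walk_set_l1[OF \<eta>(1), of x] eq by simp
    ultimately have "l1_dist 0 x \<le> N" by linarith
    then show ?thesis unfolding cube_def using coord_le_l1[of 0 _ x] order_trans by fastforce
  qed
  then have "star_cluster (bad_points \<tau> K) (cube x 0) \<subseteq> cube x (\<rho> - 1)" using clusters[of x 0] \<rho> by simp
  then obtain S where shell: "shell (bad_points \<tau> K) x 0 \<rho> S" using shell_exists[OF dim, of 0] by blast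
  note S = shellD[OF shell]
  have xS: "x \<notin> S" using S(1) cube_refl[of 0 x] by blast
  have pre: "walk (p1 @ [x]) 0 x" and suf: "walk (x # y # p2) x z"
    using \<eta>(1) walk_append_split[of p1 x "y # p2"] unfolding eq by auto
  have "set (rev (p1 @ [x])) \<inter> S \<noteq> {}"
    using S(4)[OF walk_rev[OF pre]] x cube_refl[of 0 x] cube_sym[of x 0 \<rho>] by simp
  then obtain c where c: "c \<in> set p1" "c \<in> S" using xS by auto
  have "set (x # y # p2) \<inter> S \<noteq> {}"
    using S(4)[OF suf] x cube_refl[of 0 x] cube_sym[of x z \<rho>] by simp
  then obtain c' where c': "c' \<in> set (y # p2)" "c' \<in> S" using xS by auto
  obtain a b where ab: "p1 = a @ c # b" using split_list[OF c(1)] by blast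
  obtain a' b' where ab': "y # p2 = a' @ c' # b'" using split_list[OF c'(1)] by blast
  have wa: "walk (a @ [c]) 0 c" using pre walk_append_split[of a c "b @ [x]"] by (simp add: ab)
  have wb: "walk (c' # b') c' z" using suf walk_append_split[of "x # a'" c' b'] by (simp add: ab')
  obtain \<sigma> where \<sigma>: "walk \<sigma> c c'" "sum w' (edges_of_walk \<sigma>) \<le> \<kappa>"
    using shell_walk[OF _ S(2,3) c(2) c'(2), of x \<rho>] S(1) \<rho> by auto
  obtain r1 where r1: "walk r1 0 c'" "edges_of_walk r1 = edges_of_walk (a @ [c]) \<union> edges_of_walk \<sigma>" "set r1 = set (a @ [c]) \<union> set \<sigma>"
    by (rule walk_join[OF wa \<sigma>(1)])
  obtain r where r: "walk r 0 z" "edges_of_walk r = edges_of_walk r1 \<union> edges_of_walk (c' # b')" "set r = set r1 \<union> set (c' # b')"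
    by (rule walk_join[OF r1(1) wb])
  let ?E = "edges_of_walk (a @ [c]) \<union> edges_of_walk (c' # b')"
  have "x \<notin> set (a @ [c])" "x \<notin> set (c' # b')"
    using \<eta>(2) unfolding eq ab' by (auto simp: ab)
  then have "{x, y} \<notin> ?E" using edges_of_walk_subset_set by fastforce
  moreover have "?E \<subseteq> edges_of_walk \<eta>"
  proof -
    have "edges_of_walk \<eta> = edges_of_walk (a @ c # b @ x # y # p2)" by (simp add: eq ab)
    then have "edges_of_walk (a @ [c]) \<subseteq> edges_of_walk \<eta>" using edges_of_walk_append[of a c "b @ x # y # p2"] by blast
    moreover have "edges_of_walk \<eta> = edges_of_walk ((p1 @ x # a') @ c' # b')" unfolding eq ab' by simp
    then have "edges_of_walk (c' # b') \<subseteq> edges_of_walk \<eta>" using edges_of_walk_append[of "p1 @ x # a'" c' b'] by blast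
    ultimately show ?thesis by blast
  qed
  moreover have "{x, y} \<in> edges_of_walk \<eta>"
    using edges_of_walk_append[of p1 x "y # p2"] by (simp add: eq)
  ultimately have sub: "insert {x, y} ?E \<subseteq> edges_of_walk \<eta>" "{x, y} \<notin> ?E" by auto
  have lat: "edges_of_walk \<eta> \<subseteq> lattice_edges" by (rule walk_edges_lattice[OF \<eta>(1)])
  have "walk_dist w 0 z \<le> sum w (edges_of_walk r)" by (rule walk_dist_le[OF w_nonneg r(1)])
  also have "edges_of_walk r = ?E \<union> edges_of_walk \<sigma>" using r(2) r1(2) by auto
  also have "sum w \<dots> \<le> sum w ?E + sum w (edges_of_walk \<sigma>)"
    using walk_edges_lattice[OF wa] walk_edges_lattice[OF wb] walk_edges_lattice[OF \<sigma>(1)] w_nonneg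
    by (intro sum_Un_le) auto
  also have "sum w (edges_of_walk \<sigma>) \<le> sum w' (edges_of_walk \<sigma>)"
    using walk_edges_lattice[OF \<sigma>(1)] w_bounds by (intro sum_mono) auto
  also have "\<dots> \<le> \<kappa>" by (rule \<sigma>(2))
  also have "sum w ?E = sum w (insert {x, y} ?E) - w {x, y}" using sub(2) by simp
  also have "sum w (insert {x, y} ?E) \<le> sum w (edges_of_walk \<eta>)"
    using sub(1) lat w_nonneg by (intro sum_mono2) auto
  also have "w {x, y} = M + s" using long by (simp add: trunc_weight_def)
  finally show False using \<eta>(3) M s by simp
qed

lemma z_in: "z \<in> cube 0 N"
proof -
  have "s * l1_dist 0 z \<le> (M + s) * l1_dist 0 z"
    using l1_nonneg[of 0 z] M_pos by (intro mult_right_mono) auto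
  then have "real_of_int (l1_dist 0 z) \<le> (M + s) * l1_dist 0 z / s" using s by (simp add: field_simps)
  then have "l1_dist 0 z \<le> N" using reach by linarith
  then show ?thesis unfolding cube_def using coord_le_l1[of 0 _ z] by (auto intro: order_trans)
qed

lemma N_nonneg: "0 \<le> N"
  using z_in by (auto simp: cube_def intro: order_trans[OF abs_ge_zero])

text \<open>Cut the truncated geodesic at its last visit to the shell around \<open>0\<close> and
  the next visit to the shell around \<open>z\<close>. In between it stays away from both inner
  cubes, so it has no long edge there and truncation does not change its cost.\<close>

lemma bulk_walk:
  obtains S0 Sz c c' q where
    "shell (bad_points \<tau> K) 0 \<rho> (2 * \<rho>) S0" "shell (bad_points \<tau> K) z \<rho> (2 * \<rho>) Sz"
    "c \<in> S0" "c' \<in> Sz" "walk q c c'" "sum w' (edges_of_walk q) \<le> walk_dist w 0 z"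
proof -
  have ex: "\<exists>S. shell (bad_points \<tau> K) v \<rho> (2 * \<rho>) S" if "v \<in> cube 0 N" for v
  proof (rule shell_exists[OF dim])
    show "star_cluster (bad_points \<tau> K) (cube v \<rho>) \<subseteq> cube v (2 * \<rho> - 1)"
      using clusters[OF that, of \<rho>] \<rho> by (simp only: mult_2)
  qed (use \<rho> in simp)
  obtain S0 where sh0: "shell (bad_points \<tau> K) 0 \<rho> (2 * \<rho>) S0" using ex[OF cube_refl[OF N_nonneg]] by blast
  obtain Sz where shz: "shell (bad_points \<tau> K) z \<rho> (2 * \<rho>) Sz" using ex[OF z_in] by blast
  note sh = sh0 shz
  note S0 = shellD[OF sh(1)] and Sz = shellD[OF sh(2)]
  obtain \<eta> where \<eta>: "walk \<eta> 0 z" "distinct \<eta>" "sum w (edges_of_walk \<eta>) = walk_dist w 0 z"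
    using walk_geodesic_exists[of s w 0 z, OF s conjunct1[OF w_bounds]] by blast
  have z0: "z \<notin> cube 0 (2 * \<rho>)" using cube_disjoint[of z] cube_refl[of "2 * \<rho>" z] \<rho> by auto
  have "set \<eta> \<inter> S0 \<noteq> {}" using S0(4)[OF \<eta>(1)] cube_refl[of \<rho> 0] \<rho> z0 by simp
  then have "\<exists>x\<in>set \<eta>. x \<in> S0" by blast
  obtain p1 c p2 where p: "\<eta> = p1 @ c # p2" "c \<in> S0" "\<forall>x\<in>set p2. x \<notin> S0"
    using split_list_last_prop[of \<eta> "\<lambda>x. x \<in> S0", OF \<open>\<exists>x\<in>set \<eta>. x \<in> S0\<close>] by blast
  have wc: "walk (c # p2) c z" using \<eta>(1) walk_append_split[of p1 c p2] by (simp add: p)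
  have cz: "c \<notin> cube z (2 * \<rho>)" using cube_disjoint p(2) S0(1) by blast
  have "set (rev (c # p2)) \<inter> Sz \<noteq> {}" using Sz(4)[OF walk_rev[OF wc]] cube_refl[of \<rho> z] \<rho> cz by simp
  then have "\<exists>x\<in>set (c # p2). x \<in> Sz" by auto
  then obtain q1 c' q2 where q: "c # p2 = q1 @ c' # q2" "c' \<in> Sz" "\<forall>x\<in>set q1. x \<notin> Sz"
    using split_list_first_prop[of "c # p2" "\<lambda>x. x \<in> Sz"] by blast
  have wq: "walk (q1 @ [c']) c c'" using wc walk_append_split[of q1 c' q2] by (simp add: q)
  have short: "\<tau> e \<le> M" if e: "e \<in> edges_of_walk (q1 @ [c'])" for e
  proof -
    have "successively adjacent (q1 @ [c'])" using wq by (simp add: walk_def)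
    then obtain r1 x y r2 where r: "q1 @ [c'] = r1 @ x # y # r2" "e = {x, y}" "adjacent x y"
      by (rule edges_of_walk_ends[OF _ e])
    define t where "t = butlast (y # r2)"
    have "butlast (q1 @ [c']) = butlast (r1 @ x # y # r2)" "last (q1 @ [c']) = last (r1 @ x # y # r2)"
      by (simp_all only: r(1))
    then have q1: "q1 = r1 @ x # t" and "last (y # r2) = c'" by (simp_all add: butlast_append t_def)
    then have t: "y # r2 = t @ [c']" using append_butlast_last_id[of "y # r2"] by (simp only: t_def) simp
    have "t @ c' # q2 = (t @ [c']) @ q2" by simp
    then have tq: "t @ c' # q2 = y # r2 @ q2" by (simp only: t[symmetric] append_Cons)
    have \<eta>eq: "\<eta> = (p1 @ r1) @ x # y # (r2 @ q2)"
      unfolding p(1) q(1) q1 using tq by simp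
    have cp: "c # p2 = r1 @ x # (t @ c' # q2)" unfolding q(1) q1 by simp
    \<comment> \<open>From inside the inner cube the walk would have to cross \<open>S0\<close>
      again, after the last visit \<open>c\<close>.\<close>
    have "x \<notin> cube 0 \<rho>"
    proof
      assume x: "x \<in> cube 0 \<rho>"
      then have "x \<noteq> c" using p(2) S0(1) by blast
      have wx: "walk (x # (t @ c' # q2)) x z" using wc walk_append_split[of r1 x "t @ c' # q2"] unfolding cp by simp
      have "set (x # (t @ c' # q2)) \<inter> S0 \<noteq> {}" by (rule S0(4)[OF wx x z0])
      moreover have "r1 \<noteq> []" using cp \<open>x \<noteq> c\<close> by (cases r1) auto
      then have "set (x # (t @ c' # q2)) \<subseteq> set p2" using cp by (cases r1) auto
      ultimately show False using p(3) by blast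
    qed
    \<comment> \<open>Read backwards from \<open>x\<close> to \<open>c\<close>, the walk would meet
      \<open>Sz\<close> before its first visit \<open>c'\<close>.\<close>
    moreover have "x \<notin> cube z \<rho>"
    proof
      assume x: "x \<in> cube z \<rho>"
      have wx: "walk (r1 @ [x]) c x" using wq walk_append_split[of r1 x "t @ [c']"] by (simp add: q1)
      have "set (rev (r1 @ [x])) \<inter> Sz \<noteq> {}" by (rule Sz(4)[OF walk_rev[OF wx] x cz])
      then show False using q(3) by (auto simp: q1)
    qed
    ultimately show ?thesis using geodesic_no_long_edge[OF \<eta> \<eta>eq] r(2) by simp
  qed
  have "sum w' (edges_of_walk (q1 @ [c'])) = sum w (edges_of_walk (q1 @ [c']))"
    using short by (intro sum.cong) (auto simp: trunc_weight_def)
  also have "\<dots> \<le> sum w (edges_of_walk \<eta>)"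
  proof (rule sum_mono2)
    show "edges_of_walk (q1 @ [c']) \<subseteq> edges_of_walk \<eta>"
      using edges_of_walk_append[of p1 c p2] edges_of_walk_append[of q1 c' q2] p(1) q(1) by auto
    show "0 \<le> w e" if "e \<in> edges_of_walk \<eta> - edges_of_walk (q1 @ [c'])" for e
      using that walk_edges_lattice[OF \<eta>(1)] w_nonneg by blast
  qed auto
  finally have "sum w' (edges_of_walk (q1 @ [c'])) \<le> walk_dist w 0 z" using \<eta>(3) by simp
  then show thesis by (rule that[OF sh p(2) q(2) wq])
qed

lemma l1_cube: "(x :: int ^ 'd) \<in> cube v r \<Longrightarrow> l1_dist v x \<le> int CARD('d) * r"
  by (rule l1_le_coord) (auto simp: cube_def abs_minus_commute)

lemma trunc_dist_cube:
  fixes M' s' :: real and x :: "int ^ 'd"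
  assumes "x \<in> cube v (2 * \<rho>)" "0 < s'" "0 \<le> M'"
  shows "walk_dist (trunc_weight \<tau> M' s') v x \<le> (M' + s') * (2 * CARD('d) * \<rho>)"
proof -
  have "walk_dist (trunc_weight \<tau> M' s') v x \<le> (M' + s') * l1_dist v x"
    using nonneg assms by (intro walk_dist_le_l1) (auto simp: trunc_weight_def)
  also have "real_of_int (l1_dist v x) \<le> real_of_int (int CARD('d) * (2 * \<rho>))"
    using l1_cube[OF assms(1)] by (simp only: of_int_le_iff)
  then have "(M' + s') * l1_dist v x \<le> (M' + s') * real_of_int (int CARD('d) * (2 * \<rho>))"
    using assms by (intro mult_left_mono) auto
  finally show ?thesis by (simp add: mult_ac)
qed

text \<open>The bulk walk is charged its untruncated cost, which dominates its cost at every level.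
  Only the two end pieces are charged at level \<open>M'\<close>, which may be above or below
  \<open>M\<close>.\<close>

lemma trunc_level_irrelevant:
  assumes "0 \<le> M'"
  shows "walk_dist (trunc_weight \<tau> M' s) 0 z \<le> walk_dist w 0 z + 2 * ((M' + s) * (2 * CARD('d) * \<rho>))"
proof -
  let ?w = "trunc_weight \<tau> M' s"
  have nn: "0 \<le> ?w e" and le: "?w e \<le> w' e" if "e \<in> lattice_edges" for e
    using nonneg[OF that] assms s by (auto simp: trunc_weight_def)
  obtain S0 Sz c c' q where sh: "shell (bad_points \<tau> K) 0 \<rho> (2 * \<rho>) S0" "shell (bad_points \<tau> K) z \<rho> (2 * \<rho>) Sz"
    and c: "c \<in> S0" "c' \<in> Sz" and q: "walk q c c'" "sum w' (edges_of_walk q) \<le> walk_dist w 0 z"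
    by (rule bulk_walk)
  have S: "c \<in> cube 0 (2 * \<rho>)" "c' \<in> cube z (2 * \<rho>)"
    using shellD(1)[OF sh(1)] shellD(1)[OF sh(2)] c by blast+
  have "walk_dist ?w 0 z \<le> walk_dist ?w 0 c + walk_dist ?w c z" by (rule walk_dist_triangle[OF nn])
  also have "walk_dist ?w c z \<le> walk_dist ?w c c' + walk_dist ?w c' z" by (rule walk_dist_triangle[OF nn])
  also have "walk_dist ?w c c' \<le> sum ?w (edges_of_walk q)" by (rule walk_dist_le[OF nn q(1)])
  also have "\<dots> \<le> sum w' (edges_of_walk q)" using le walk_edges_lattice[OF q(1)] by (intro sum_mono) auto
  also have "walk_dist ?w 0 c \<le> (M' + s) * (2 * CARD('d) * \<rho>)" using S assms s by (intro trunc_dist_cube) auto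
  also have "walk_dist ?w c' z \<le> (M' + s) * (2 * CARD('d) * \<rho>)"
    unfolding walk_dist_commute[of _ c'] using S assms s by (intro trunc_dist_cube) auto
  finally show ?thesis using q(2) by (simp add: algebra_simps)
qed

text \<open>Here \<open>m\<close> counts the edges of \<open>p\<close> between its first visit to
  the shell around \<open>0\<close> and its last visit to the shell around \<open>z\<close>. The
  remaining edges lie in two small cubes but may be arbitrarily expensive, so they are counted and
  not priced. As a competitor for the shift \<open>s'\<close>, the middle part costs at most its old
  untruncated cost plus \<open>(s' - s) * m\<close>. Since \<open>s' - s\<close> may have either
  sign, this bounds \<open>m\<close> from both sides.\<close>

lemma length_vs_derivative:
  assumes p: "walk p 0 z" "distinct p" "sum w' (edges_of_walk p) = walk_dist w' 0 z"
  shows "\<exists>m::nat. m \<le> card (edges_of_walk p) \<and>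
    int (card (edges_of_walk p)) \<le> int m + 2 * (4 * \<rho> + 1) ^ CARD('d) \<and>
    (\<forall>s'>0. walk_dist (trunc_weight \<tau> M s') 0 z - walk_dist w 0 z \<le>
      (s' - s) * m + 2 * \<kappa> + 2 * ((M + s') * (2 * CARD('d) * \<rho>)))"
proof -
  obtain S0 Sz c c' q where sh: "shell (bad_points \<tau> K) 0 \<rho> (2 * \<rho>) S0" "shell (bad_points \<tau> K) z \<rho> (2 * \<rho>) Sz"
    and c: "c \<in> S0" "c' \<in> Sz" and q: "walk q c c'" "sum w' (edges_of_walk q) \<le> walk_dist w 0 z"
    by (rule bulk_walk)
  note S0 = shellD[OF sh(1)] and Sz = shellD[OF sh(2)]
  have z0: "z \<notin> cube 0 (2 * \<rho>)" using cube_disjoint[of z] cube_refl[of "2 * \<rho>" z] \<rho> by auto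
  have "set p \<inter> S0 \<noteq> {}" using S0(4)[OF p(1)] cube_refl[of \<rho> 0] \<rho> z0 by simp
  then have "\<exists>x\<in>set p. x \<in> S0" by blast
  then obtain p1 a p2 where p12: "p = p1 @ a # p2" "a \<in> S0" "\<forall>x\<in>set p1. x \<notin> S0"
    using split_list_first_prop[of p "\<lambda>x. x \<in> S0"] by blast
  have wpre: "walk (p1 @ [a]) 0 a" and wa: "walk (a # p2) a z"
    using p(1) walk_append_split[of p1 a p2] by (auto simp: p12)
  \<comment> \<open>Leaving the outer cube would require crossing \<open>S0\<close>, which is met
    first at \<open>a\<close>.\<close>
  have pre_in: "set p1 \<subseteq> cube 0 (2 * \<rho>)"
  proof
    fix x assume x: "x \<in> set p1"
    obtain t1 t2 where t: "p1 = t1 @ x # t2" using split_list[OF x] by blast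
    have "walk (t1 @ [x]) 0 x" using wpre walk_append_split[of t1 x "t2 @ [a]"] by (simp add: t)
    then show "x \<in> cube 0 (2 * \<rho>)" using S0(4)[of "t1 @ [x]" 0 x] cube_refl[of \<rho> 0] \<rho> p12(3) by (auto simp: t)
  qed
  have az: "a \<notin> cube z (2 * \<rho>)" using cube_disjoint p12(2) S0(1) by blast
  have "set (rev (a # p2)) \<inter> Sz \<noteq> {}" using Sz(4)[OF walk_rev[OF wa]] cube_refl[of \<rho> z] \<rho> az by simp
  then have "\<exists>x\<in>set (a # p2). x \<in> Sz" by auto
  then obtain q1 b q2 where q12: "a # p2 = q1 @ b # q2" "b \<in> Sz" "\<forall>x\<in>set q2. x \<notin> Sz"
    using split_list_last_prop[of "a # p2" "\<lambda>x. x \<in> Sz"] by blast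
  have wmid: "walk (q1 @ [b]) a b" and wsuf: "walk (b # q2) b z"
    using wa walk_append_split[of q1 b q2] by (auto simp: q12)
  have suf_in: "set q2 \<subseteq> cube z (2 * \<rho>)"
  proof
    fix x assume x: "x \<in> set q2"
    obtain t1 t2 where t: "q2 = t1 @ x # t2" using split_list[OF x] by blast
    have wx: "walk (x # t2) x z" using wsuf walk_append_split[of "b # t1" x t2] by (simp add: t)
    show "x \<in> cube z (2 * \<rho>)" using Sz(4)[OF walk_rev[OF wx]] cube_refl[of \<rho> z] \<rho> q12(3) by (auto simp: t)
  qed
  define m where "m = length q1"
  have peq: "p = p1 @ q1 @ b # q2" using p12(1) q12(1) by simp
  have cardp: "card (edges_of_walk p) = length p1 + m + length q2"
    by (simp add: card_edges_distinct[OF p(2)]) (simp add: peq m_def)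
  have lens: "length t \<le> (4 * \<rho> + 1) ^ CARD('d)" if t: "distinct t" "set t \<subseteq> cube v (2 * \<rho>)" for t and v :: "int ^ 'd"
  proof -
    have "length t = card (set t)" using t by (simp add: distinct_card)
    also have "\<dots> \<le> card (cube v (2 * \<rho>))" using t by (intro card_mono finite_cube)
    also have "\<dots> \<le> nat (4 * \<rho> + 1) ^ CARD('d)" using card_cube_le[of v "2 * \<rho>"] by simp
    finally have "int (length t) \<le> int (nat (4 * \<rho> + 1) ^ CARD('d))" by (simp only: of_nat_le_iff)
    then show ?thesis using \<rho> by simp
  qed
  have len1: "length p1 \<le> (4 * \<rho> + 1) ^ CARD('d)" using pre_in p(2) by (intro lens) (auto simp: peq)
  have len2: "length q2 \<le> (4 * \<rho> + 1) ^ CARD('d)" using suf_in p(2) by (intro lens) (auto simp: peq)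
  have dmid: "distinct (q1 @ [b])" using p(2) by (auto simp: peq)
  have cardmid: "card (edges_of_walk (q1 @ [b])) = m" by (simp add: card_edges_distinct[OF dmid] m_def)
  \<comment> \<open>Optimality of \<open>p\<close> is tested against the route from \<open>a\<close>
    along the shell to \<open>c\<close>, along the bulk walk to \<open>c'\<close>, and along the
    other shell to \<open>b\<close>. The unknown costs of the two ends cancel.\<close>
  have mid: "sum w' (edges_of_walk (q1 @ [b])) \<le> walk_dist w 0 z + 2 * \<kappa>"
  proof -
    have succ: "successively adjacent p" using p(1) by (simp add: walk_def)
    have e1: "edges_of_walk p = edges_of_walk (p1 @ [a]) \<union> edges_of_walk (a # p2)"
      unfolding p12(1) by (rule edges_of_walk_append)
    have d1: "edges_of_walk (p1 @ [a]) \<inter> edges_of_walk (a # p2) = {}"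
      by (rule edges_split_disjoint) (use p(2) succ p12(1) in auto)
    have e2: "edges_of_walk (a # p2) = edges_of_walk (q1 @ [b]) \<union> edges_of_walk (b # q2)"
      unfolding q12(1) by (rule edges_of_walk_append)
    have d2: "edges_of_walk (q1 @ [b]) \<inter> edges_of_walk (b # q2) = {}"
    proof (rule edges_split_disjoint)
      show "distinct (q1 @ b # q2)" using p(2) by (simp add: peq)
      show "successively adjacent (q1 @ b # q2)" using wa by (simp add: walk_def q12(1))
    qed
    have "sum w' (edges_of_walk p) = sum w' (edges_of_walk (p1 @ [a])) +
      (sum w' (edges_of_walk (q1 @ [b])) + sum w' (edges_of_walk (b # q2)))"
      unfolding e1 by (subst sum.union_disjoint[OF _ _ d1]) (simp_all only: finite_edges_of_walk finite_Un e2 sum.union_disjoint[OF _ _ d2])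
    moreover have "walk_dist w' 0 z \<le> walk_dist w' 0 a + walk_dist w' a z"
      "walk_dist w' a z \<le> walk_dist w' a b + walk_dist w' b z"
      "walk_dist w' a b \<le> walk_dist w' a c + walk_dist w' c b"
      "walk_dist w' c b \<le> walk_dist w' c c' + walk_dist w' c' b"
      by (rule w'_triangle, assumption)+
    moreover have "walk_dist w' 0 a \<le> sum w' (edges_of_walk (p1 @ [a]))"
      "walk_dist w' b z \<le> sum w' (edges_of_walk (b # q2))"
      "walk_dist w' c c' \<le> sum w' (edges_of_walk q)"
      using w'_dist_le[OF _ wpre] w'_dist_le[OF _ wsuf] w'_dist_le[OF _ q(1)] by auto
    moreover have "walk_dist w' a c \<le> \<kappa>"
    proof -
      obtain t where t: "walk t a c" "sum w' (edges_of_walk t) \<le> \<kappa>"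
        using shell_walk[OF _ S0(2,3) p12(2) c(1), of 0 "2 * \<rho>"] S0(1) by auto
      then show ?thesis using w'_dist_le[OF _ t(1)] by auto
    qed
    moreover have "walk_dist w' c' b \<le> \<kappa>"
    proof -
      obtain t where t: "walk t c' b" "sum w' (edges_of_walk t) \<le> \<kappa>"
        using shell_walk[OF _ Sz(2,3) c(2) q12(2), of z "2 * \<rho>"] Sz(1) by auto
      then show ?thesis using w'_dist_le[OF _ t(1)] by auto
    qed
    ultimately show ?thesis using p(3) q(2) by linarith
  qed
  have "walk_dist (trunc_weight \<tau> M s') 0 z - walk_dist w 0 z \<le>
      (s' - s) * m + 2 * \<kappa> + 2 * ((M + s') * (2 * CARD('d) * \<rho>))" if s': "s' > 0" for s'
  proof -
    let ?w = "trunc_weight \<tau> M s'"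
    have nn: "0 \<le> ?w e" and le: "?w e \<le> w' e + (s' - s)" if "e \<in> lattice_edges" for e
      using nonneg[OF that] M_pos s' by (auto simp: trunc_weight_def)
    have "walk_dist ?w 0 z \<le> walk_dist ?w 0 a + walk_dist ?w a z" by (rule walk_dist_triangle[OF nn])
    also have "walk_dist ?w a z \<le> walk_dist ?w a b + walk_dist ?w b z" by (rule walk_dist_triangle[OF nn])
    also have "walk_dist ?w a b \<le> sum ?w (edges_of_walk (q1 @ [b]))" by (rule walk_dist_le[OF nn wmid])
    also have "\<dots> \<le> (\<Sum>e\<in>edges_of_walk (q1 @ [b]). w' e + (s' - s))"
      using le walk_edges_lattice[OF wmid] by (intro sum_mono) auto
    also have "\<dots> = sum w' (edges_of_walk (q1 @ [b])) + (s' - s) * m"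
      by (simp only: sum.distrib sum_constant cardmid mult.commute)
    also have "walk_dist ?w 0 a \<le> (M + s') * (2 * CARD('d) * \<rho>)"
      using S0(1) p12(2) M_pos s' by (intro trunc_dist_cube) auto
    also have "walk_dist ?w b z \<le> (M + s') * (2 * CARD('d) * \<rho>)"
      unfolding walk_dist_commute[of _ b] using Sz(1) q12(2) M_pos s' by (intro trunc_dist_cube) auto
    finally show ?thesis using mid by linarith
  qed
  then show ?thesis using len1 len2 cardp by (intro exI[of _ m]) auto
qed

end

subsection \<open>The Efron--Stein inequality\<close>

lemma (in prob_space) integrable_bounded:
  fixes f :: "'a \<Rightarrow> real"
  assumes "f \<in> borel_measurable M" "\<And>x. x \<in> space M \<Longrightarrow> \<bar>f x\<bar> \<le> B"
  shows "integrable M f"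
  by (rule integrable_const_bound[of _ B]) (use assms in auto)

lemma (in prob_space) integral_abs_le_bound:
  fixes f :: "'a \<Rightarrow> real"
  assumes "f \<in> borel_measurable M" "\<And>x. x \<in> space M \<Longrightarrow> \<bar>f x\<bar> \<le> B"
  shows "\<bar>\<integral>x. f x \<partial>M\<bar> \<le> B"
proof -
  have "\<bar>\<integral>x. f x \<partial>M\<bar> \<le> (\<integral>x. \<bar>f x\<bar> \<partial>M)" by (rule integral_abs_bound)
  also have "\<dots> \<le> (\<integral>x. B \<partial>M)"
  proof (rule integral_mono)
    show "integrable M (\<lambda>x. \<bar>f x\<bar>)" by (rule integrable_bounded[of _ B]) (use assms in auto)
  qed (use assms in auto)
  finally show ?thesis by (simp add: prob_space)
qed

lemma square_abs_le: "\<bar>a\<bar> \<le> B \<Longrightarrow> a\<^sup>2 \<le> (B::real)\<^sup>2"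
  using power_mono[of "\<bar>a\<bar>" B 2] by simp

lemma (in prob_space) square_integral_le:
  fixes f :: "'a \<Rightarrow> real"
  assumes f[measurable]: "f \<in> borel_measurable M" and B: "\<And>x. x \<in> space M \<Longrightarrow> \<bar>f x\<bar> \<le> B"
  shows "(\<integral>x. f x \<partial>M)\<^sup>2 \<le> (\<integral>x. (f x)\<^sup>2 \<partial>M)"
proof -
  have i: "integrable M f" by (rule integrable_bounded[OF f B])
  have i2: "integrable M (\<lambda>x. (f x)\<^sup>2)"
    by (rule integrable_bounded[of _ "B\<^sup>2"]) (auto intro!: square_abs_le B)
  have "0 \<le> variance f" by (rule variance_positive)
  then show ?thesis using variance_eq[OF i i2] by simp
qed

text \<open>Jensen's inequality for the convex function that squares the positive part.\<close>

lemma (in prob_space) square_pos_part_integral_le: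
  fixes f :: "'a \<Rightarrow> real"
  assumes f[measurable]: "f \<in> borel_measurable M" and B: "\<And>x. x \<in> space M \<Longrightarrow> \<bar>f x\<bar> \<le> B"
  shows "(max 0 (\<integral>x. f x \<partial>M))\<^sup>2 \<le> (\<integral>x. (max 0 (f x))\<^sup>2 \<partial>M)"
proof -
  have bm: "\<bar>max 0 (f x)\<bar> \<le> B" if "x \<in> space M" for x using B[OF that] by auto
  have "max 0 (\<integral>x. f x \<partial>M) \<le> (\<integral>x. max 0 (f x) \<partial>M)"
  proof (rule max.boundedI)
    show "0 \<le> (\<integral>x. max 0 (f x) \<partial>M)" by (rule integral_nonneg_AE) auto
    show "(\<integral>x. f x \<partial>M) \<le> (\<integral>x. max 0 (f x) \<partial>M)"
      by (rule integral_mono) (auto intro!: integrable_bounded[of _ B] B bm)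
  qed
  then have "(max 0 (\<integral>x. f x \<partial>M))\<^sup>2 \<le> (\<integral>x. max 0 (f x) \<partial>M)\<^sup>2"
    by (intro power_mono) auto
  also have "\<dots> \<le> (\<integral>x. (max 0 (f x))\<^sup>2 \<partial>M)"
    by (rule square_integral_le[OF _ bm]) auto
  finally show ?thesis .
qed

text \<open>The variance is half the mean square of the difference of two independent copies.
  Exchanging the copies swaps the positive and negative parts, so the positive part alone carries
  that half.\<close>

lemma (in prob_space) variance_eq_pos_part_differences:
  fixes f :: "'a \<Rightarrow> real"
  assumes f[measurable]: "f \<in> borel_measurable M" and B: "\<And>x. x \<in> space M \<Longrightarrow> \<bar>f x\<bar> \<le> B"
  shows "(\<integral>x. (f x)\<^sup>2 \<partial>M) - (\<integral>x. f x \<partial>M)\<^sup>2 = (\<integral>x. \<integral>y. (max 0 (f y - f x))\<^sup>2 \<partial>M \<partial>M)"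
proof -
  interpret P: pair_prob_space M M ..
  define q where "q x y = (max 0 (f y - f x))\<^sup>2" for x y
  have qm[measurable]: "(\<lambda>(x, y). q x y) \<in> borel_measurable (M \<Otimes>\<^sub>M M)" unfolding q_def by measurable
  have qb: "\<bar>q x y\<bar> \<le> (2 * B)\<^sup>2" if "x \<in> space M" "y \<in> space M" for x y
  proof -
    have "max 0 (f y - f x) \<le> 2 * B" using B[OF that(1)] B[OF that(2)] by auto
    then have "(max 0 (f y - f x))\<^sup>2 \<le> (2 * B)\<^sup>2" by (intro power_mono) auto
    then show ?thesis by (simp add: q_def)
  qed
  have iq: "integrable (M \<Otimes>\<^sub>M M) (\<lambda>(x, y). q x y)"
    by (rule P.integrable_bounded[of _ "(2 * B)\<^sup>2"]) (use qb in \<open>auto simp: space_pair_measure\<close>)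
  have swap: "(\<integral>y. \<integral>x. q x y \<partial>M \<partial>M) = (\<integral>x. \<integral>y. q x y \<partial>M \<partial>M)"
    using P.Fubini_integral[OF iq] by simp
  have i: "integrable M f" by (rule integrable_bounded[OF f B])
  have i2: "integrable M (\<lambda>x. (f x)\<^sup>2)"
    by (rule integrable_bounded[of _ "B\<^sup>2"]) (auto intro!: square_abs_le B)
  have bq1: "integrable M (\<lambda>y. q x y)" "integrable M (\<lambda>y. q y x)" if x: "x \<in> space M" for x
    by (rule integrable_bounded[of _ "(2 * B)\<^sup>2"]; use qb x in \<open>auto simp: q_def\<close>)+
  have sq: "q x y + q y x = (f y)\<^sup>2 - 2 * f x * f y + (f x)\<^sup>2" for x y
    by (simp add: q_def max_def power2_eq_square algebra_simps)
  have inner: "(\<integral>y. q x y \<partial>M) + (\<integral>y. q y x \<partial>M) = (\<integral>y. (f y)\<^sup>2 \<partial>M) - 2 * f x * (\<integral>y. f y \<partial>M) + (f x)\<^sup>2"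
    if "x \<in> space M" for x
  proof -
    have "(\<integral>y. q x y \<partial>M) + (\<integral>y. q y x \<partial>M) = (\<integral>y. q x y + q y x \<partial>M)" using bq1[OF that] by simp
    also have "\<dots> = (\<integral>y. (f y)\<^sup>2 - 2 * f x * f y + (f x)\<^sup>2 \<partial>M)" by (simp add: sq)
    also have "\<dots> = (\<integral>y. (f y)\<^sup>2 \<partial>M) - 2 * f x * (\<integral>y. f y \<partial>M) + (f x)\<^sup>2"
      using i i2 by (simp add: prob_space)
    finally show ?thesis .
  qed
  have io: "integrable M (\<lambda>x. \<integral>y. q x y \<partial>M)" "integrable M (\<lambda>x. \<integral>y. q y x \<partial>M)"
    using P.integrable_fst[OF iq] P.integrable_snd[OF iq] by simp_all
  have "(\<integral>x. \<integral>y. q x y \<partial>M \<partial>M) + (\<integral>x. \<integral>y. q y x \<partial>M \<partial>M) = (\<integral>x. (\<integral>y. q x y \<partial>M) + (\<integral>y. q y x \<partial>M) \<partial>M)"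
    using io by simp
  also have "\<dots> = (\<integral>x. (\<integral>y. (f y)\<^sup>2 \<partial>M) - 2 * f x * (\<integral>y. f y \<partial>M) + (f x)\<^sup>2 \<partial>M)"
    by (rule Bochner_Integration.integral_cong) (use inner in auto)
  also have "\<dots> = 2 * ((\<integral>x. (f x)\<^sup>2 \<partial>M) - (\<integral>x. f x \<partial>M)\<^sup>2)"
    using i i2 by (simp add: prob_space power2_eq_square algebra_simps)
  finally show ?thesis using swap by (simp add: q_def)
qed

text \<open>Averaging out one coordinate \<open>e\<close> splits the variance exactly into the mean
  conditional variance in \<open>e\<close> and the variance of the average \<open>g\<close>, to
  which the induction applies. Jensen's inequality returns from increments of \<open>g\<close> to
  increments of \<open>f\<close>. Counting only increases of \<open>f\<close> matters later: they
  can come only from edges on a geodesic of the configuration before resampling.\<close>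

lemma efron_stein:
  fixes f :: "('i \<Rightarrow> 'a) \<Rightarrow> real" and L :: "'a measure"
  assumes L: "prob_space L" and J: "finite J"
    and f: "f \<in> borel_measurable (PiM J (\<lambda>_. L))" and B: "\<And>x. x \<in> space (PiM J (\<lambda>_. L)) \<Longrightarrow> \<bar>f x\<bar> \<le> B"
  shows "(\<integral>x. (f x)\<^sup>2 \<partial>PiM J (\<lambda>_. L)) - (\<integral>x. f x \<partial>PiM J (\<lambda>_. L))\<^sup>2 \<le>
    (\<Sum>i\<in>J. \<integral>x. \<integral>y. (max 0 (f (x(i := y)) - f x))\<^sup>2 \<partial>L \<partial>PiM J (\<lambda>_. L))"
  using J f B
proof (induction J arbitrary: f rule: finite_induct)
  case empty
  have "prob_space (PiM {} (\<lambda>_::'i. L))" by (rule prob_space_PiM) (rule L)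
  then interpret P: prob_space "PiM {} (\<lambda>_::'i. L)" .
  have "(\<integral>x. g x \<partial>PiM {} (\<lambda>_. L)) = g (\<lambda>_. undefined)" for g :: "('i \<Rightarrow> 'a) \<Rightarrow> real"
  proof -
    have "(\<integral>x. g x \<partial>PiM {} (\<lambda>_. L)) = (\<integral>x. g (\<lambda>_. undefined) \<partial>PiM {} (\<lambda>_::'i. L))"
      by (rule Bochner_Integration.integral_cong) (auto simp: space_PiM)
    then show ?thesis using P.prob_space by simp
  qed
  then show ?case by simp
next
  case (insert e J)
  interpret L: prob_space L by (rule L)
  interpret PS: product_prob_space "\<lambda>_. L" UNIV by unfold_locales
  let ?P = "PiM J (\<lambda>_. L)" and ?Q = "PiM (insert e J) (\<lambda>_. L)"
  have "prob_space ?P" by (rule prob_space_PiM) (rule L)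
  then interpret P: prob_space ?P .
  have "prob_space ?Q" by (rule prob_space_PiM) (rule L)
  then interpret Q: prob_space ?Q .
  interpret PL: pair_prob_space ?P L ..
  interpret LL: pair_prob_space L L ..
  interpret QL: pair_prob_space ?Q L ..
  note f[measurable] = insert.prems(1)
  have B: "\<bar>f x\<bar> \<le> B" if "x \<in> space ?Q" for x using insert.prems(2)[OF that] .
  have ne: "space ?Q \<noteq> {}" by (rule Q.not_empty)
  have B0: "0 \<le> B" using B ne by (metis abs_ge_zero all_not_in_conv order_trans)
  define F where "F x y = f (x(e := y))" for x y
  have upd[measurable]: "(\<lambda>(x, y). x(e := y)) \<in> ?P \<Otimes>\<^sub>M L \<rightarrow>\<^sub>M ?Q"
    using measurable_add_dim[of e J "\<lambda>_. L"] .
  have Fm[measurable]: "(\<lambda>(x, y). F x y) \<in> borel_measurable (?P \<Otimes>\<^sub>M L)"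
    using measurable_compose[OF upd f] by (simp add: F_def case_prod_beta')
  have updsp: "x(e := y) \<in> space ?Q" if "x \<in> space ?P" "y \<in> space L" for x y
    using that by (auto simp: space_PiM PiE_def Pi_def extensional_def)
  have updJ: "x(i := y) \<in> space ?P" if "x \<in> space ?P" "y \<in> space L" "i \<in> J" for x y i
    using that by (auto simp: space_PiM PiE_def Pi_def extensional_def)
  have updQ: "x(i := y) \<in> space ?Q" if "x \<in> space ?Q" "y \<in> space L" "i \<in> insert e J" for x y i
    using that by (auto simp: space_PiM PiE_def Pi_def extensional_def)
  have FB: "\<bar>F x y\<bar> \<le> B" if "x \<in> space ?P" "y \<in> space L" for x y
    unfolding F_def by (rule B[OF updsp[OF that]])
  define g where "g x = (\<integral>y. F x y \<partial>L)" for x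
  have Fx[measurable]: "F x \<in> borel_measurable L" if "x \<in> space ?P" for x
    using measurable_compose[OF measurable_Pair1'[OF that] Fm] by simp
  have gm[measurable]: "g \<in> borel_measurable ?P"
    unfolding g_def by (rule L.borel_measurable_lebesgue_integral) (rule Fm)
  have gB: "\<bar>g x\<bar> \<le> B" if "x \<in> space ?P" for x
    unfolding g_def by (rule L.integral_abs_le_bound) (use that FB in auto)
  have ins: "(\<integral>x. h x \<partial>?Q) = (\<integral>x. \<integral>y. h (x(e := y)) \<partial>L \<partial>?P)"
    if "h \<in> borel_measurable ?Q" "\<And>x. x \<in> space ?Q \<Longrightarrow> \<bar>h x\<bar> \<le> C" for h :: "('i \<Rightarrow> 'a) \<Rightarrow> real" and C
    by (rule PS.product_integral_insert[OF insert.hyps]) (rule Q.integrable_bounded[OF that])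
  have sqB: "\<bar>a\<^sup>2\<bar> \<le> B\<^sup>2" if "\<bar>a\<bar> \<le> B" for a :: real
    using square_abs_le[OF that] by simp
  have mxB: "\<bar>(max 0 (a - b))\<^sup>2\<bar> \<le> (2 * B)\<^sup>2" if "\<bar>a\<bar> \<le> B" "\<bar>b\<bar> \<le> B" for a b :: real
  proof -
    have "(max 0 (a - b))\<^sup>2 \<le> (2 * B)\<^sup>2" using that B0 by (intro power_mono) auto
    then show ?thesis by simp
  qed
  define h where "h i x = (\<integral>y. (max 0 (f (x(i := y)) - f x))\<^sup>2 \<partial>L)" for i x
  have hupd[measurable]: "(\<lambda>(x, y). x(i := y)) \<in> ?Q \<Otimes>\<^sub>M L \<rightarrow>\<^sub>M ?Q" if "i \<in> insert e J" for i
    unfolding case_prod_beta' using that by (intro measurable_fun_upd[where J = "insert e J"]) auto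
  have hm0: "(\<lambda>(x, y). (max 0 (f (x(i := y)) - f x))\<^sup>2) \<in> borel_measurable (?Q \<Otimes>\<^sub>M L)" if i: "i \<in> insert e J" for i
  proof -
    have "(\<lambda>p. f ((\<lambda>(x, y). x(i := y)) p)) \<in> borel_measurable (?Q \<Otimes>\<^sub>M L)"
      by (rule measurable_compose[OF hupd[OF i] f])
    then have [measurable]: "(\<lambda>(x, y). f (x(i := y))) \<in> borel_measurable (?Q \<Otimes>\<^sub>M L)" by (simp add: case_prod_beta')
    show ?thesis by measurable
  qed
  have hm[measurable]: "h i \<in> borel_measurable ?Q" if "i \<in> insert e J" for i
    unfolding h_def by (rule L.borel_measurable_lebesgue_integral) (rule hm0[OF that])
  have hB: "\<bar>h i x\<bar> \<le> (2 * B)\<^sup>2" if "i \<in> insert e J" "x \<in> space ?Q" for i x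
    unfolding h_def
  proof (rule L.integral_abs_le_bound)
    show "(\<lambda>y. (max 0 (f (x(i := y)) - f x))\<^sup>2) \<in> borel_measurable L"
      using measurable_compose[OF measurable_Pair1'[OF that(2)] hm0[OF that(1)]] by simp
  qed (rule mxB; use B updQ that in blast)
  \<comment> \<open>Integrating \<open>h e\<close> over the present value at \<open>e\<close> as
    well compares two independent copies, so \<open>variance_eq_pos_part_differences\<close> gives
    an equality.\<close>
  have e_term: "(\<integral>x. h e x \<partial>?Q) = (\<integral>x. (\<integral>y. (F x y)\<^sup>2 \<partial>L) \<partial>?P) - (\<integral>x. (g x)\<^sup>2 \<partial>?P)"
  proof -
    have "(\<integral>x. h e x \<partial>?Q) = (\<integral>x. \<integral>z. h e (x(e := z)) \<partial>L \<partial>?P)"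
      by (rule ins[OF hm hB]) auto
    also have "\<dots> = (\<integral>x. (\<integral>y. (F x y)\<^sup>2 \<partial>L) - (g x)\<^sup>2 \<partial>?P)"
    proof (rule Bochner_Integration.integral_cong[OF refl])
      fix x assume x: "x \<in> space ?P"
      show "(\<integral>z. h e (x(e := z)) \<partial>L) = (\<integral>y. (F x y)\<^sup>2 \<partial>L) - (g x)\<^sup>2"
        unfolding g_def h_def by (subst L.variance_eq_pos_part_differences[OF Fx[OF x] FB[OF x]]) (auto simp: F_def)
    qed
    also have "\<dots> = (\<integral>x. (\<integral>y. (F x y)\<^sup>2 \<partial>L) \<partial>?P) - (\<integral>x. (g x)\<^sup>2 \<partial>?P)"
    proof (rule Bochner_Integration.integral_diff)
      have F2: "(\<lambda>(x, y). (F x y)\<^sup>2) \<in> borel_measurable (?P \<Otimes>\<^sub>M L)" by measurable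
      have "integrable (?P \<Otimes>\<^sub>M L) (\<lambda>(x, y). (F x y)\<^sup>2)"
        by (rule PL.integrable_bounded[OF F2, of "B\<^sup>2"]) (use FB sqB in \<open>auto simp: space_pair_measure\<close>)
      from PL.integrable_fst[OF this] show "integrable ?P (\<lambda>x. \<integral>y. (F x y)\<^sup>2 \<partial>L)" .
      show "integrable ?P (\<lambda>x. (g x)\<^sup>2)"
        by (rule P.integrable_bounded[of _ "B\<^sup>2"]) (use gB sqB in auto)
    qed
    finally show ?thesis .
  qed
  \<comment> \<open>For fixed \<open>x\<close> and \<open>y\<close> this is Jensen's inequality over
    the value \<open>z\<close> at \<open>e\<close>; Fubini then exchanges \<open>y\<close> and
    \<open>z\<close>, and the updates at \<open>i\<close> and \<open>e\<close> commute because
    \<open>i \<noteq> e\<close>.\<close>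
  have J_term: "(\<integral>x. \<integral>y. (max 0 (g (x(i := y)) - g x))\<^sup>2 \<partial>L \<partial>?P) \<le> (\<integral>x. h i x \<partial>?Q)" if i: "i \<in> J" for i
  proof -
    have ie: "i \<noteq> e" using i insert.hyps by auto
    have Pupd: "(\<lambda>(x, y). x(i := y)) \<in> ?P \<Otimes>\<^sub>M L \<rightarrow>\<^sub>M ?P"
      unfolding case_prod_beta' using i by (intro measurable_fun_upd[where J = J]) auto
    have gupd[measurable]: "(\<lambda>(x, y). g (x(i := y))) \<in> borel_measurable (?P \<Otimes>\<^sub>M L)"
      using measurable_compose[OF Pupd gm] by (simp add: case_prod_beta')
    have "(\<integral>x. h i x \<partial>?Q) = (\<integral>x. \<integral>z. h i (x(e := z)) \<partial>L \<partial>?P)"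
      by (rule ins[OF hm hB]) (use i in auto)
    also have "\<dots> \<ge> (\<integral>x. \<integral>y. (max 0 (g (x(i := y)) - g x))\<^sup>2 \<partial>L \<partial>?P)"
    proof (rule integral_mono)
      have "(\<lambda>(x, y). (max 0 (g (x(i := y)) - g x))\<^sup>2) \<in> borel_measurable (?P \<Otimes>\<^sub>M L)" by measurable
      then have "integrable (?P \<Otimes>\<^sub>M L) (\<lambda>(x, y). (max 0 (g (x(i := y)) - g x))\<^sup>2)"
        by (rule PL.integrable_bounded[of _ "(2 * B)\<^sup>2"]) (use gB mxB updJ[OF _ _ i] in \<open>auto simp: space_pair_measure\<close>)
      from PL.integrable_fst[OF this]
      show "integrable ?P (\<lambda>x. \<integral>y. (max 0 (g (x(i := y)) - g x))\<^sup>2 \<partial>L)" .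
      have "(\<lambda>p. h i ((\<lambda>(x, y). x(e := y)) p)) \<in> borel_measurable (?P \<Otimes>\<^sub>M L)"
        by (rule measurable_compose[OF upd hm]) (use i in auto)
      then have "(\<lambda>(x, z). h i (x(e := z))) \<in> borel_measurable (?P \<Otimes>\<^sub>M L)" by (simp add: case_prod_beta')
      then have "integrable (?P \<Otimes>\<^sub>M L) (\<lambda>(x, z). h i (x(e := z)))"
        by (rule PL.integrable_bounded[of _ "(2 * B)\<^sup>2"]) (use hB[of i] updsp i in \<open>auto simp: space_pair_measure\<close>)
      from PL.integrable_fst[OF this] show "integrable ?P (\<lambda>x. \<integral>z. h i (x(e := z)) \<partial>L)" .
      fix x assume x: "x \<in> space ?P"
      define d where "d y z = F (x(i := y)) z - F x z" for y z
      have "(\<lambda>y. x(i := y)) \<in> L \<rightarrow>\<^sub>M ?P"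
        using measurable_compose[OF measurable_Pair1'[OF x] Pupd] by simp
      then have "(\<lambda>(y, z). (x(i := y), z)) \<in> L \<Otimes>\<^sub>M L \<rightarrow>\<^sub>M ?P \<Otimes>\<^sub>M L" by measurable
      from measurable_compose[OF this Fm]
      have [measurable]: "(\<lambda>(y, z). F (x(i := y)) z) \<in> borel_measurable (L \<Otimes>\<^sub>M L)" by (simp add: case_prod_beta')
      have [measurable]: "F x \<in> borel_measurable L" by (rule Fx[OF x])
      have dm[measurable]: "(\<lambda>(y, z). d y z) \<in> borel_measurable (L \<Otimes>\<^sub>M L)" unfolding d_def by measurable
      have dB: "\<bar>d y z\<bar> \<le> 2 * B" if "y \<in> space L" "z \<in> space L" for y z
        using FB[OF updJ[OF x that(1) i] that(2)] FB[OF x that(2)] unfolding d_def by linarith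
      have d2B: "\<bar>(max 0 (d y z))\<^sup>2\<bar> \<le> (2 * B)\<^sup>2" if "y \<in> space L" "z \<in> space L" for y z
      proof -
        have "(max 0 (d y z))\<^sup>2 \<le> (2 * B)\<^sup>2" using dB[OF that] by (intro power_mono) auto
        then show ?thesis by simp
      qed
      have d2m: "(\<lambda>(y, z). (max 0 (d y z))\<^sup>2) \<in> borel_measurable (L \<Otimes>\<^sub>M L)" by measurable
      have d2i: "integrable (L \<Otimes>\<^sub>M L) (\<lambda>(y, z). (max 0 (d y z))\<^sup>2)"
        by (rule LL.integrable_bounded[OF d2m, of "(2 * B)\<^sup>2"]) (use d2B in \<open>auto simp: space_pair_measure\<close>)
      have "(\<integral>y. (max 0 (g (x(i := y)) - g x))\<^sup>2 \<partial>L) \<le> (\<integral>y. \<integral>z. (max 0 (d y z))\<^sup>2 \<partial>L \<partial>L)"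
      proof (rule integral_mono)
        show "integrable L (\<lambda>y. \<integral>z. (max 0 (d y z))\<^sup>2 \<partial>L)" using LL.integrable_fst[OF d2i] .
        have [measurable]: "(\<lambda>y. g (x(i := y))) \<in> borel_measurable L"
          using measurable_compose[OF measurable_Pair1'[OF x] gupd] by simp
        show "integrable L (\<lambda>y. (max 0 (g (x(i := y)) - g x))\<^sup>2)"
        proof (rule L.integrable_bounded)
          show "\<bar>(max 0 (g (x(i := y)) - g x))\<^sup>2\<bar> \<le> (2 * B)\<^sup>2" if "y \<in> space L" for y
            by (rule mxB[OF gB[OF updJ[OF x that i]] gB[OF x]])
        qed measurable
        fix y assume y: "y \<in> space L"
        have xy: "x(i := y) \<in> space ?P" by (rule updJ[OF x y i])
        have "g (x(i := y)) - g x = (\<integral>z. d y z \<partial>L)"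
          unfolding g_def d_def
          by (rule Bochner_Integration.integral_diff[symmetric]) (rule L.integrable_bounded[of _ B]; use Fx FB x xy in auto)+
        then have "(max 0 (g (x(i := y)) - g x))\<^sup>2 = (max 0 (\<integral>z. d y z \<partial>L))\<^sup>2" by simp
        also have "\<dots> \<le> (\<integral>z. (max 0 (d y z))\<^sup>2 \<partial>L)"
        proof (rule L.square_pos_part_integral_le)
          show "d y \<in> borel_measurable L" using measurable_compose[OF measurable_Pair1'[OF y] dm] by simp
        qed (rule dB[OF y])
        finally show "(max 0 (g (x(i := y)) - g x))\<^sup>2 \<le> (\<integral>z. (max 0 (d y z))\<^sup>2 \<partial>L)" .
      qed
      also have "\<dots> = (\<integral>z. \<integral>y. (max 0 (d y z))\<^sup>2 \<partial>L \<partial>L)"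
        using LL.Fubini_integral[OF d2i] by simp
      also have "\<dots> = (\<integral>z. h i (x(e := z)) \<partial>L)"
        using ie by (simp add: h_def d_def F_def fun_upd_twist)
      finally show "(\<integral>y. (max 0 (g (x(i := y)) - g x))\<^sup>2 \<partial>L) \<le> (\<integral>z. h i (x(e := z)) \<partial>L)" .
    qed
    finally show ?thesis .
  qed
  have "(\<integral>x. (f x)\<^sup>2 \<partial>?Q) - (\<integral>x. f x \<partial>?Q)\<^sup>2 = (\<integral>x. (\<integral>y. (F x y)\<^sup>2 \<partial>L) \<partial>?P) - (\<integral>x. g x \<partial>?P)\<^sup>2"
  proof -
    have "(\<integral>x. f x \<partial>?Q) = (\<integral>x. g x \<partial>?P)" unfolding g_def F_def by (rule ins[OF f B])
    moreover have "(\<integral>x. (f x)\<^sup>2 \<partial>?Q) = (\<integral>x. (\<integral>y. (F x y)\<^sup>2 \<partial>L) \<partial>?P)"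
      unfolding F_def by (rule ins) (auto intro!: square_abs_le B)
    ultimately show ?thesis by simp
  qed
  also have "\<dots> = (\<integral>x. h e x \<partial>?Q) + ((\<integral>x. (g x)\<^sup>2 \<partial>?P) - (\<integral>x. g x \<partial>?P)\<^sup>2)"
    using e_term by simp
  also have "(\<integral>x. (g x)\<^sup>2 \<partial>?P) - (\<integral>x. g x \<partial>?P)\<^sup>2 \<le>
      (\<Sum>i\<in>J. \<integral>x. \<integral>y. (max 0 (g (x(i := y)) - g x))\<^sup>2 \<partial>L \<partial>?P)"
    by (rule insert.IH[OF gm gB])
  also have "\<dots> \<le> (\<Sum>i\<in>J. \<integral>x. h i x \<partial>?Q)" by (rule sum_mono) (rule J_term)
  finally show ?case unfolding h_def sum.insert[OF insert.hyps] by simp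
qed

subsection \<open>Random weights\<close>

text \<open>The measure of \<open>fpp_model\<close> before completion. Measurability is handled
  here; the completion enters only when the final almost sure statement is transferred.\<close>

definition weights :: "real measure \<Rightarrow> ((int ^ 'd) set \<Rightarrow> real) measure" where
  "weights L = PiM lattice_edges (\<lambda>_. L)"

locale weight_law =
  fixes L :: "real measure"
  assumes law: "L \<in> weight_laws"
begin

sublocale L: prob_space L
  using law by (simp add: weight_laws_def)

lemma sets_L: "sets L = sets nonneg_borel"
  using law by (simp add: weight_laws_def)

lemma space_L: "space L = {0..}"
  using sets_eq_imp_space_eq[OF sets_L] by (simp add: nonneg_borel_def space_restrict_space)

lemma borel_measurable_L: "f \<in> borel_measurable borel \<Longrightarrow> f \<in> borel_measurable L"
  using measurable_restrict_space1[of f borel borel "{0..}"] measurable_cong_sets[OF sets_L refl]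
  unfolding nonneg_borel_def by blast

lemma prob_space_weights: "prob_space (weights L)"
  unfolding weights_def by (rule prob_space_PiM) (rule L.prob_space_axioms)

lemma weights_nonneg: "\<tau> \<in> space (weights L) \<Longrightarrow> e \<in> lattice_edges \<Longrightarrow> 0 \<le> \<tau> e"
  by (auto simp: weights_def space_PiM space_L PiE_def Pi_def)

lemma measurable_weight:
  assumes "e \<in> lattice_edges" shows "(\<lambda>\<tau>. \<tau> e) \<in> borel_measurable (weights L)"
proof -
  have "(\<lambda>\<tau>. (\<lambda>x. x) (\<tau> e)) \<in> borel_measurable (weights L)"
    unfolding weights_def
    by (rule measurable_compose[OF measurable_component_singleton[OF assms]]) (rule borel_measurable_L, simp)
  then show ?thesis .
qed

lemma measurable_walk_dist:
  assumes "\<And>e. e \<in> lattice_edges \<Longrightarrow> (\<lambda>\<tau>. w \<tau> e) \<in> borel_measurable N"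
  shows "(\<lambda>\<tau>. walk_dist (w \<tau>) u v) \<in> borel_measurable N"
  unfolding walk_dist_def
proof (rule borel_measurable_cINF_real)
  fix p :: "(int ^ 'a) list" assume "p \<in> {p. walk p u v}"
  then have "edges_of_walk p \<subseteq> lattice_edges" using walk_edges_lattice by blast
  then show "(\<lambda>\<tau>. sum (w \<tau>) (edges_of_walk p)) \<in> borel_measurable N"
    using assms by (intro borel_measurable_sum) auto
qed auto

lemma measurable_trunc_dist [measurable]:
  "(\<lambda>\<tau>. walk_dist (trunc_weight \<tau> M s) u v) \<in> borel_measurable (weights L)"
  by (rule measurable_walk_dist) (auto simp: trunc_weight_def intro!: borel_measurable_add borel_measurable_min measurable_weight)

lemma trunc_dist_bounds:
  assumes "\<tau> \<in> space (weights L)" "0 \<le> M" "0 < s"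
  shows "0 \<le> walk_dist (trunc_weight \<tau> M s) u v" "walk_dist (trunc_weight \<tau> M s) u v \<le> (M + s) * l1_dist u v"
proof -
  have "0 \<le> trunc_weight \<tau> M s e \<and> trunc_weight \<tau> M s e \<le> M + s" if "e \<in> lattice_edges" for e
    using weights_nonneg[OF assms(1) that] assms(2,3) by (auto simp: trunc_weight_def)
  then show "0 \<le> walk_dist (trunc_weight \<tau> M s) u v" "walk_dist (trunc_weight \<tau> M s) u v \<le> (M + s) * l1_dist u v"
    using assms by (auto intro!: walk_dist_nonneg walk_dist_le_l1)
qed

end

subsection \<open>Variance of truncated passage times\<close>

definition local_edges :: "int ^ 'd \<Rightarrow> int \<Rightarrow> (int ^ 'd) set set" where
  "local_edges u n = {e \<in> lattice_edges. e \<subseteq> cube u n}"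

lemma finite_local_edges: "finite (local_edges u n)"
  by (rule finite_subset[of _ "Pow (cube u n)"]) (auto simp: local_edges_def finite_cube)

lemma geodesic_edges_local:
  assumes "0 < s" and w: "\<And>e. e \<in> lattice_edges \<Longrightarrow> s \<le> w e" and p: "walk p u v" "distinct p"
    and le: "sum w (edges_of_walk p) \<le> C" "C / s \<le> of_int n"
  shows "edges_of_walk p \<subseteq> local_edges u n" "real (card (edges_of_walk p)) \<le> C / s"
proof -
  have "s * (real (length p) - 1) \<le> C" using walk_length_le[OF assms(1) _ p, of w] w le by auto
  then have len: "real (length p) - 1 \<le> C / s" using assms(1) by (simp add: field_simps)
  then have n: "int (length p) - 1 \<le> n" using le(2) by linarith
  have "length p > 0" using p(1) by (auto simp: walk_def)
  then show "real (card (edges_of_walk p)) \<le> C / s" using len by (simp add: card_edges_distinct[OF p(2)] of_nat_diff Suc_leI)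
  have "set p \<subseteq> cube u n"
  proof
    fix x assume "x \<in> set p"
    then have "l1_dist u x \<le> n" using walk_set_l1[OF p(1)] n by fastforce
    then show "x \<in> cube u n" unfolding cube_def using coord_le_l1[of u _ x]
      by (auto simp: abs_minus_commute intro: order_trans)
  qed
  then show "edges_of_walk p \<subseteq> local_edges u n"
    using walk_edges_lattice[OF p(1)] edges_of_walk_subset_set unfolding local_edges_def by blast
qed

text \<open>A geodesic for \<open>w\<close> cannot leave \<open>local_edges u n\<close>, so it is an
  equally expensive competitor for \<open>w'\<close>. Used in both directions, this makes the
  passage time a function of finitely many weights, as \<open>efron_stein\<close> requires.\<close>

lemma walk_dist_local:
  fixes c s :: real
  assumes s: "0 < s" and w: "\<And>e. e \<in> lattice_edges \<Longrightarrow> s \<le> w e \<and> w e \<le> c"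
    and w': "\<And>e. e \<in> lattice_edges \<Longrightarrow> s \<le> w' e"
    and eq: "\<And>e. e \<in> local_edges u n \<Longrightarrow> w e = w' e" and n: "c * l1_dist u v / s \<le> of_int n" and c: "0 \<le> c"
  shows "walk_dist w' u v \<le> walk_dist w u v"
proof -
  have w0: "\<And>e. e \<in> lattice_edges \<Longrightarrow> 0 \<le> w e \<and> w e \<le> c" using w s by force
  obtain p where p: "walk p u v" "distinct p" "sum w (edges_of_walk p) = walk_dist w u v"
    using walk_geodesic_exists[of s w u v, OF s conjunct1[OF w]] by blast
  have "sum w (edges_of_walk p) \<le> c * l1_dist u v" unfolding p(3) by (rule walk_dist_le_l1[OF w0 c])
  then have "edges_of_walk p \<subseteq> local_edges u n"
    using geodesic_edges_local(1)[where w = w, OF s conjunct1[OF w] p(1,2) _ n] by blast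
  then have "sum w (edges_of_walk p) = sum w' (edges_of_walk p)" using eq by (intro sum.cong) auto
  moreover have "0 \<le> w' e" if "e \<in> lattice_edges" for e using w'[OF that] s by simp
  then have "walk_dist w' u v \<le> sum w' (edges_of_walk p)" using walk_dist_le[of w' p u v] p(1) by blast
  ultimately show ?thesis using p(3) by simp
qed

text \<open>Resampling one weight can raise the passage time only if its edge lies on a fixed
  geodesic of the old weights, and then by at most \<open>M\<close>. So the squared increases sum to
  at most \<open>M\<^sup>2\<close> times the number of edges of that geodesic, which is at most its
  cost divided by \<open>s\<close>.\<close>

lemma (in weight_law) variance_walk_dist:
  fixes u v :: "int ^ 'd"
  assumes M: "0 \<le> M" and s: "0 < s"
  shows "prob_space.variance (weights L) (\<lambda>\<tau>. walk_dist (trunc_weight \<tau> M s) u v) \<le> M\<^sup>2 * ((M + s) * l1_dist u v / s)"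
proof -
  interpret W: prob_space "weights L" by (rule prob_space_weights)
  interpret PS: product_prob_space "\<lambda>_. L" "lattice_edges :: (int ^ 'd) set set" by unfold_locales
  define C where "C = (M + s) * l1_dist u v"
  define n where "n = \<lceil>C / s\<rceil>"
  have n: "C / s \<le> of_int n" by (simp add: n_def)
  define J where "J = local_edges u n"
  have J: "finite J" "J \<subseteq> lattice_edges" unfolding J_def by (rule finite_local_edges) (auto simp: local_edges_def)
  \<comment> \<open>With the default 0 the truncated weights outside \<open>J\<close> equal
    \<open>s\<close>. This still confines geodesics to \<open>J\<close>, so the passage time is
    unchanged.\<close>
  define ext :: "((int ^ 'd) set \<Rightarrow> real) \<Rightarrow> (int ^ 'd) set \<Rightarrow> real" where "ext x e = (if e \<in> J then x e else 0)" for x e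
  define f where "f x = walk_dist (trunc_weight (ext x) M s) u v" for x
  let ?P = "PiM J (\<lambda>_. L)"
  let ?D = "\<lambda>\<tau>. walk_dist (trunc_weight \<tau> M s) u v"
  have pos: "0 \<le> ext x e" if "x \<in> space ?P" for x e
    using that by (auto simp: ext_def space_PiM PiE_def Pi_def space_L)
  have bounds: "s \<le> trunc_weight (ext x) M s e \<and> trunc_weight (ext x) M s e \<le> M + s" if "x \<in> space ?P" for x e
    using pos[OF that, of e] M by (auto simp: trunc_weight_def)
  have bounds0: "0 \<le> trunc_weight (ext x) M s e \<and> trunc_weight (ext x) M s e \<le> M + s" if "x \<in> space ?P" for x e
    using bounds[OF that, of e] s by auto
  have fB: "0 \<le> f x" "f x \<le> C" if "x \<in> space ?P" for x
    unfolding f_def C_def using bounds0[OF that] M s by (auto intro!: walk_dist_nonneg walk_dist_le_l1)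
  have fm[measurable]: "f \<in> borel_measurable ?P"
    unfolding f_def
  proof (rule measurable_walk_dist)
    fix e :: "(int ^ 'd) set"
    have "(\<lambda>x. ext x e) \<in> borel_measurable ?P"
    proof (cases "e \<in> J")
      case True
      have "(\<lambda>x. (\<lambda>t. t) (x e)) \<in> borel_measurable ?P"
        by (rule measurable_compose[OF measurable_component_singleton[OF True]]) (rule borel_measurable_L, simp)
      then show ?thesis using True by (simp add: ext_def)
    qed (simp add: ext_def)
    then show "(\<lambda>x. trunc_weight (ext x) M s e) \<in> borel_measurable ?P" unfolding trunc_weight_def by measurable
  qed
  have es: "(\<integral>x. (f x)\<^sup>2 \<partial>?P) - (\<integral>x. f x \<partial>?P)\<^sup>2 \<le> (\<Sum>i\<in>J. \<integral>x. \<integral>y. (max 0 (f (x(i := y)) - f x))\<^sup>2 \<partial>L \<partial>?P)"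
    by (rule efron_stein[OF L.prob_space_axioms J(1) fm, of C]) (use fB in force)
  have pointwise: "(\<Sum>i\<in>J. (max 0 (f (x(i := y)) - f x))\<^sup>2) \<le> M\<^sup>2 * (C / s)"
    if x: "x \<in> space ?P" and y: "y \<in> space L" for x y
  proof -
    obtain p where p: "walk p u v" "distinct p" "sum (trunc_weight (ext x) M s) (edges_of_walk p) = f x"
      using walk_geodesic_exists[of s "trunc_weight (ext x) M s" u v, OF s] bounds[OF x] unfolding f_def by blast
    have cardp: "real (card (edges_of_walk p)) \<le> C / s"
      by (rule geodesic_edges_local(2)[where w = "trunc_weight (ext x) M s", OF s _ p(1,2) _ n]) (use bounds[OF x] p(3) fB[OF x] in auto)
    have le: "(max 0 (f (x(i := y)) - f x))\<^sup>2 \<le> (if i \<in> edges_of_walk p then M\<^sup>2 else 0)" if i: "i \<in> J" for i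
    proof -
      let ?x' = "x(i := y)"
      have x': "?x' \<in> space ?P" using x y i by (auto simp: space_PiM PiE_def Pi_def extensional_def)
      have "f ?x' \<le> sum (trunc_weight (ext ?x') M s) (edges_of_walk p)"
        unfolding f_def using bounds0[OF x'] p(1) by (intro walk_dist_le) auto
      also have "\<dots> \<le> (\<Sum>e\<in>edges_of_walk p. trunc_weight (ext x) M s e + (if e = i then M else 0))"
      proof (rule sum_mono)
        fix e
        show "trunc_weight (ext ?x') M s e \<le> trunc_weight (ext x) M s e + (if e = i then M else 0)"
          using bounds[OF x', of e] bounds[OF x, of e] by (cases "e = i") (auto simp: trunc_weight_def ext_def)
      qed
      also have "\<dots> = f x + (if i \<in> edges_of_walk p then M else 0)"
        using p(3) by (simp add: sum.distrib)
      finally have "max 0 (f ?x' - f x) \<le> (if i \<in> edges_of_walk p then M else 0)" using M by auto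
      then show ?thesis by (cases "i \<in> edges_of_walk p") (auto intro: power_mono)
    qed
    have "(\<Sum>i\<in>J. (max 0 (f (x(i := y)) - f x))\<^sup>2) \<le> (\<Sum>i\<in>J. if i \<in> edges_of_walk p then M\<^sup>2 else 0)"
      by (rule sum_mono) (rule le)
    also have "\<dots> = real (card (J \<inter> edges_of_walk p)) * M\<^sup>2"
      using J(1) by (simp add: sum.If_cases Int_def)
    also have "\<dots> \<le> real (card (edges_of_walk p)) * M\<^sup>2"
      by (intro mult_right_mono) (auto intro!: card_mono)
    also have "\<dots> \<le> M\<^sup>2 * (C / s)" using mult_right_mono[OF cardp, of "M\<^sup>2"] by (simp add: mult.commute)
    finally show ?thesis .
  qed
  have "prob_space ?P" by (rule prob_space_PiM) (rule L.prob_space_axioms)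
  then interpret P: prob_space ?P .
  interpret PL: pair_prob_space ?P L ..
  have C0: "0 \<le> C" using l1_nonneg[of u v] M s by (simp add: C_def)
  have term_m: "(\<lambda>(x, y). (max 0 (f (x(i := y)) - f x))\<^sup>2) \<in> borel_measurable (?P \<Otimes>\<^sub>M L)" if i: "i \<in> J" for i
  proof -
    have "(\<lambda>(x, y). x(i := y)) \<in> ?P \<Otimes>\<^sub>M L \<rightarrow>\<^sub>M ?P"
      unfolding case_prod_beta' using i by (intro measurable_fun_upd[where J = J]) auto
    from measurable_compose[OF this fm] have [measurable]: "(\<lambda>(x, y). f (x(i := y))) \<in> borel_measurable (?P \<Otimes>\<^sub>M L)"
      by (simp add: case_prod_beta')
    show ?thesis by measurable
  qed
  have term_le: "(max 0 (f (x(i := y)) - f x))\<^sup>2 \<le> M\<^sup>2 * (C / s)" if "x \<in> space ?P" "y \<in> space L" "i \<in> J" for x y i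
    by (rule order_trans[OF member_le_sum pointwise[OF that(1,2)]]) (use that J(1) in auto)
  have term_i: "integrable (?P \<Otimes>\<^sub>M L) (\<lambda>(x, y). (max 0 (f (x(i := y)) - f x))\<^sup>2)" if i: "i \<in> J" for i
    by (rule PL.integrable_bounded[OF term_m[OF i], of "M\<^sup>2 * (C / s)"]) (use term_le i in \<open>auto simp: space_pair_measure\<close>)
  have "(\<Sum>i\<in>J. \<integral>x. \<integral>y. (max 0 (f (x(i := y)) - f x))\<^sup>2 \<partial>L \<partial>?P) =
      (\<Sum>i\<in>J. \<integral>q. (case q of (x, y) \<Rightarrow> (max 0 (f (x(i := y)) - f x))\<^sup>2) \<partial>(?P \<Otimes>\<^sub>M L))"
    by (rule sum.cong) (simp_all add: PL.integral_fst[OF term_i])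
  also have "\<dots> = (\<integral>q. (\<Sum>i\<in>J. case q of (x, y) \<Rightarrow> (max 0 (f (x(i := y)) - f x))\<^sup>2) \<partial>(?P \<Otimes>\<^sub>M L))"
    by (rule Bochner_Integration.integral_sum[symmetric]) (rule term_i)
  also have "\<dots> \<le> (\<integral>q. M\<^sup>2 * (C / s) \<partial>(?P \<Otimes>\<^sub>M L))"
  proof (rule integral_mono)
    show "integrable (?P \<Otimes>\<^sub>M L) (\<lambda>q. \<Sum>i\<in>J. case q of (x, y) \<Rightarrow> (max 0 (f (x(i := y)) - f x))\<^sup>2)"
      by (rule Bochner_Integration.integrable_sum) (rule term_i)
  qed (use pointwise in \<open>auto simp: space_pair_measure\<close>)
  also have "\<dots> = M\<^sup>2 * (C / s)" by (simp add: PL.prob_space)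
  finally have main: "(\<integral>x. (f x)\<^sup>2 \<partial>?P) - (\<integral>x. f x \<partial>?P)\<^sup>2 \<le> M\<^sup>2 * (C / s)" using es by simp
  have restr: "?D \<tau> = f (restrict \<tau> J)" if \<tau>: "\<tau> \<in> space (weights L)" for \<tau>
  proof -
    have rs: "restrict \<tau> J \<in> space ?P" using \<tau> J(2) by (auto simp: weights_def space_PiM PiE_def Pi_def)
    have b: "s \<le> trunc_weight \<tau> M s e \<and> trunc_weight \<tau> M s e \<le> M + s" if "e \<in> lattice_edges" for e
      using weights_nonneg[OF \<tau> that] M by (auto simp: trunc_weight_def)
    have eq: "trunc_weight \<tau> M s e = trunc_weight (ext (restrict \<tau> J)) M s e" if "e \<in> local_edges u n" for e
      using that by (simp add: trunc_weight_def ext_def J_def)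
    have "f (restrict \<tau> J) \<le> ?D \<tau>" unfolding f_def
      by (rule walk_dist_local[OF s b _ eq]) (use bounds[OF rs] n M s in \<open>auto simp: C_def\<close>)
    moreover have "?D \<tau> \<le> f (restrict \<tau> J)" unfolding f_def
      by (rule walk_dist_local[OF s bounds[OF rs] _ eq[symmetric]]) (use b n M s in \<open>auto simp: C_def\<close>)
    ultimately show ?thesis by simp
  qed
  have tr: "(\<integral>\<tau>. g (?D \<tau>) \<partial>weights L) = (\<integral>x. g (f x) \<partial>?P)" if [measurable]: "g \<in> borel_measurable borel" for g :: "real \<Rightarrow> real"
  proof -
    have "(\<integral>x. g (f x) \<partial>?P) = (\<integral>x. g (f x) \<partial>distr (weights L) ?P (\<lambda>\<tau>. restrict \<tau> J))"
      unfolding weights_def by (simp add: PS.distr_PiM_restrict_finite[OF J])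
    also have "\<dots> = (\<integral>\<tau>. g (f (restrict \<tau> J)) \<partial>weights L)"
      unfolding weights_def by (rule integral_distr) (auto intro!: measurable_restrict_subset J)
    also have "\<dots> = (\<integral>\<tau>. g (?D \<tau>) \<partial>weights L)"
      by (rule Bochner_Integration.integral_cong) (auto simp: restr)
    finally show ?thesis by simp
  qed
  have Db: "\<bar>?D \<tau>\<bar> \<le> C" if "\<tau> \<in> space (weights L)" for \<tau>
    using trunc_dist_bounds[OF that M s, of u v] by (simp add: C_def)
  have i1: "integrable (weights L) ?D" by (rule W.integrable_bounded[OF _ Db]) measurable
  have i2: "integrable (weights L) (\<lambda>\<tau>. (?D \<tau>)\<^sup>2)"
    by (rule W.integrable_bounded[of _ "C\<^sup>2"]) (use square_abs_le[OF Db] in auto)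
  have "W.variance ?D = (\<integral>\<tau>. (?D \<tau>)\<^sup>2 \<partial>weights L) - (\<integral>\<tau>. ?D \<tau> \<partial>weights L)\<^sup>2" by (rule W.variance_eq[OF i1 i2])
  also have "\<dots> = (\<integral>x. (f x)\<^sup>2 \<partial>?P) - (\<integral>x. f x \<partial>?P)\<^sup>2"
    using tr[of "\<lambda>x. x\<^sup>2"] tr[of "\<lambda>x. x"] by simp
  finally show ?thesis using main by (simp add: C_def)
qed

subsection \<open>Mean passage times\<close>

definition mean_dist :: "real measure \<Rightarrow> real \<Rightarrow> real \<Rightarrow> int ^ 'd \<Rightarrow> real" where
  "mean_dist L M s z = (\<integral>\<tau>. walk_dist (trunc_weight \<tau> M s) 0 z \<partial>weights L)"

definition shift_edge :: "int ^ 'd \<Rightarrow> (int ^ 'd) set \<Rightarrow> (int ^ 'd) set" where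
  "shift_edge a e = (\<lambda>x. x + a) ` e"

lemma adjacent_shift [simp]: "adjacent (x + a) (y + a) \<longleftrightarrow> adjacent x y"
  by (simp add: adjacent_def)

lemma shift_edge_lattice: "e \<in> lattice_edges \<Longrightarrow> shift_edge a e \<in> lattice_edges"
  by (force simp: lattice_edges_def shift_edge_def)

lemma shift_edge_minus: "shift_edge (- a) (shift_edge a e) = e"
  by (simp add: shift_edge_def image_image)

lemma inj_shift_edge: "inj (shift_edge a)"
  by (rule inj_on_inverseI[of _ "shift_edge (- a)"]) (rule shift_edge_minus)

lemma edges_of_walk_shift: "edges_of_walk (map (\<lambda>x. x + a) p) = shift_edge a ` edges_of_walk p"
  by (induction p rule: induct_list012) (auto simp: shift_edge_def)

lemma walk_shift: "walk p u v \<Longrightarrow> walk (map (\<lambda>x. x + a) p) (u + a) (v + a)"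
  by (auto simp: walk_def hd_map last_map successively_map)

lemma walk_dist_shift_le:
  assumes "\<And>e. e \<in> lattice_edges \<Longrightarrow> 0 \<le> w e"
  shows "walk_dist w (u + a) (v + a) \<le> walk_dist (\<lambda>e. w (shift_edge a e)) u v"
proof (rule walk_dist_greatest)
  fix p assume p: "walk p u v"
  have "walk_dist w (u + a) (v + a) \<le> sum w (edges_of_walk (map (\<lambda>x. x + a) p))"
    using assms walk_shift[OF p] by (intro walk_dist_le) auto
  also have "\<dots> = (\<Sum>e\<in>edges_of_walk p. w (shift_edge a e))"
    unfolding edges_of_walk_shift by (rule sum.reindex_cong[OF inj_on_subset[OF inj_shift_edge]]) auto
  finally show "walk_dist w (u + a) (v + a) \<le> (\<Sum>e\<in>edges_of_walk p. w (shift_edge a e))" .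
qed (use assms shift_edge_lattice in blast)

lemma walk_dist_shift:
  assumes "\<And>e. e \<in> lattice_edges \<Longrightarrow> 0 \<le> w e"
  shows "walk_dist w (u + a) (v + a) = walk_dist (\<lambda>e. w (shift_edge a e)) u v"
proof (rule antisym)
  have "walk_dist (\<lambda>e. w (shift_edge a e)) (u + a + - a) (v + a + - a) \<le>
      walk_dist (\<lambda>e. w (shift_edge a (shift_edge (- a) e))) (u + a) (v + a)"
    by (rule walk_dist_shift_le) (use assms shift_edge_lattice in blast)
  then show "walk_dist (\<lambda>e. w (shift_edge a e)) u v \<le> walk_dist w (u + a) (v + a)"
    using shift_edge_minus[of "- a"] by simp
qed (rule walk_dist_shift_le[OF assms])

text \<open>Translating the edge indices preserves the product measure of identical factors. The map
  \<open>?t\<close> is restricted to \<open>lattice_edges\<close> in order to land in the product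
  space.\<close>

lemma (in weight_law) mean_dist_shift:
  assumes "0 \<le> M" "0 < s"
  shows "(\<integral>\<tau>. walk_dist (trunc_weight \<tau> M s) u v \<partial>weights L) = mean_dist L M s (v - u)"
proof -
  let ?I = "lattice_edges :: (int ^ 'a) set set"
  let ?t = "\<lambda>\<omega>. \<lambda>e\<in>?I. \<omega> (shift_edge u e)"
  have d: "distr (weights L) (weights L) ?t = weights L"
    unfolding weights_def using distr_PiM_reindex[of ?I "\<lambda>_. L" "shift_edge u" ?I]
      L.prob_space_axioms inj_on_subset[OF inj_shift_edge] shift_edge_lattice by auto
  have tm: "?t \<in> weights L \<rightarrow>\<^sub>M weights L"
    unfolding weights_def by (rule measurable_restrict) (auto intro!: measurable_component_singleton shift_edge_lattice)
  have "mean_dist L M s (v - u) = (\<integral>\<tau>. walk_dist (trunc_weight \<tau> M s) 0 (v - u) \<partial>distr (weights L) (weights L) ?t)"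
    by (simp add: mean_dist_def d)
  also have "\<dots> = (\<integral>\<tau>. walk_dist (trunc_weight (?t \<tau>) M s) 0 (v - u) \<partial>weights L)"
    by (rule integral_distr[OF tm]) measurable
  also have "\<dots> = (\<integral>\<tau>. walk_dist (trunc_weight \<tau> M s) u v \<partial>weights L)"
  proof (rule Bochner_Integration.integral_cong[OF refl])
    fix \<tau> :: "(int ^ 'a) set \<Rightarrow> real" assume \<tau>: "\<tau> \<in> space (weights L)"
    have "walk_dist (trunc_weight \<tau> M s) (0 + u) (v - u + u) = walk_dist (\<lambda>e. trunc_weight \<tau> M s (shift_edge u e)) 0 (v - u)"
      by (rule walk_dist_shift) (use weights_nonneg[OF \<tau>] assms in \<open>auto simp: trunc_weight_def\<close>)
    also have "\<dots> = walk_dist (trunc_weight (?t \<tau>) M s) 0 (v - u)"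
    proof -
      have "walk p 0 (v - u) \<Longrightarrow> (\<Sum>e\<in>edges_of_walk p. trunc_weight \<tau> M s (shift_edge u e)) =
          (\<Sum>e\<in>edges_of_walk p. trunc_weight (?t \<tau>) M s e)" for p
        using walk_edges_lattice[of p 0 "v - u"] by (intro sum.cong) (auto simp: trunc_weight_def)
      then show ?thesis unfolding walk_dist_def by (intro INF_cong) auto
    qed
    finally show "walk_dist (trunc_weight (?t \<tau>) M s) 0 (v - u) = walk_dist (trunc_weight \<tau> M s) u v" by simp
  qed
  finally show ?thesis by simp
qed

subsection \<open>Long chains of bad points are unlikely\<close>

definition incident :: "int ^ 'd \<Rightarrow> (int ^ 'd) set set" where
  "incident x = {e \<in> lattice_edges. x \<in> e}"

text \<open>Each point carries an incident edge, meant to witness its badness. Neighbouring points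
  share edges and are not independent, while the weights of distinct edges are, so probabilities are
  computed from the marks.\<close>

primrec marked_chains :: "nat \<Rightarrow> int ^ 'd \<Rightarrow> ((int ^ 'd) \<times> (int ^ 'd) set) list set" where
  "marked_chains 0 x = {[]}"
| "marked_chains (Suc n) x = (\<Union>e\<in>incident x. \<Union>y\<in>cube x 1. (\<lambda>g. (x, e) # g) ` marked_chains n y)"

lemma star_adj_cube: "star_adj x y \<longleftrightarrow> y \<in> cube x 1"
  by (simp add: star_adj_def cube_def abs_minus_commute)

lemma marked_chains_Cons:
  "e \<in> incident x \<Longrightarrow> y \<in> cube x 1 \<Longrightarrow> g \<in> marked_chains n y \<Longrightarrow> (x, e) # g \<in> marked_chains (Suc n) x"
  by auto

lemma incident_subset:
  "incident x \<subseteq> (\<lambda>(i, b). {x, x + (if b then axis i 1 else - axis i 1)}) ` UNIV"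
proof
  fix e assume "e \<in> incident x"
  then obtain u v where e: "e = {u, v}" "adjacent u v" "x \<in> {u, v}" by (auto simp: incident_def lattice_edges_def)
  have "\<exists>y. e = {x, y} \<and> adjacent x y"
    using e adjacent_sym[of u v] by (cases "x = u") (auto simp: insert_commute)
  then obtain y where y: "e = {x, y}" "adjacent x y" by blast
  then obtain i where "y = x + axis i 1 \<or> x = y + axis i 1" using adjacent_axis by blast
  then show "e \<in> (\<lambda>(i, b). {x, x + (if b then axis i 1 else - axis i 1)}) ` UNIV"
  proof
    assume "y = x + axis i 1"
    then show ?thesis by (intro image_eqI[where x = "(i, True)"]) (simp_all add: y(1))
  next
    assume "x = y + axis i 1"
    then have "y = x + - axis i 1" by simp
    then show ?thesis by (intro image_eqI[where x = "(i, False)"]) (simp_all add: y(1))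
  qed
qed

lemma finite_incident: "finite (incident x)"
  by (rule finite_subset[OF incident_subset]) auto

lemma card_incident_le: "card (incident (x :: int ^ 'd)) \<le> 2 * CARD('d)"
proof -
  have "card (incident x) \<le> card ((\<lambda>(i, b). {x, x + (if b then axis i 1 else - axis i 1)}) ` (UNIV :: ('d \<times> bool) set))"
    by (rule card_mono[OF _ incident_subset]) auto
  also have "\<dots> \<le> CARD('d \<times> bool)" by (rule card_image_le) auto
  finally show ?thesis by (simp add: card_prod mult.commute)
qed

lemma finite_marked_chains: "finite (marked_chains n x)"
  by (induction n arbitrary: x) (auto intro!: finite_incident finite_cube)

text \<open>The branching factor of marked chains: at most \<open>2 * CARD('d)\<close> incident
  edges, and \<open>3 ^ CARD('d)\<close> points of the unit cube for the next step.\<close>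

definition chain_base :: "'d itself \<Rightarrow> nat" where
  "chain_base _ = 2 * CARD('d) * 3 ^ CARD('d)"

lemma card_marked_chains_le:
  fixes x :: "int ^ 'd"
  shows "card (marked_chains n x) \<le> chain_base TYPE('d) ^ n"
proof (induction n arbitrary: x)
  case (Suc n)
  let ?B = "chain_base TYPE('d)"
  have "card (marked_chains (Suc n) x) \<le> (\<Sum>e\<in>incident x. card (\<Union>y\<in>cube x 1. (\<lambda>g. (x, e) # g) ` marked_chains n y))"
    by (simp add: card_UN_le finite_incident)
  also have "\<dots> \<le> (\<Sum>e\<in>incident x. \<Sum>y\<in>cube x 1. card ((\<lambda>g. (x, e) # g) ` marked_chains n y))"
    by (intro sum_mono card_UN_le finite_cube)
  also have "\<dots> \<le> (\<Sum>e\<in>incident x. \<Sum>y\<in>cube x 1. ?B ^ n)"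
    by (intro sum_mono order_trans[OF card_image_le Suc] finite_marked_chains)
  also have "\<dots> = card (incident x) * card (cube x 1) * ?B ^ n" by simp
  also have "\<dots> \<le> (2 * CARD('d)) * 3 ^ CARD('d) * ?B ^ n"
    using card_cube_le[of x 1] by (intro mult_mono card_incident_le) auto
  finally show ?case by (simp add: chain_base_def mult_ac)
qed auto

lemma marked_chains_elem:
  "g \<in> marked_chains n x \<Longrightarrow> length g = n \<and> (\<forall>q\<in>set g. fst q \<in> snd q \<and> snd q \<in> lattice_edges)"
proof (induction n arbitrary: x g)
  case (Suc n)
  then obtain e y g' where "e \<in> incident x" "g' \<in> marked_chains n y" "g = (x, e) # g'" by auto
  then show ?case using Suc.IH[of g' y] by (auto simp: incident_def)
qed auto

lemma bad_chain_marked: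
  assumes "successively star_adj (x # xs)" "set (x # xs) \<subseteq> bad_points \<tau> K"
  shows "\<exists>g\<in>marked_chains (Suc (length xs)) x. map fst g = x # xs \<and> (\<forall>q\<in>set g. K < \<tau> (snd q))"
  using assms
proof (induction xs arbitrary: x)
  case Nil
  then obtain e where e: "e \<in> incident x" "K < \<tau> e" by (auto simp: bad_points_def incident_def)
  moreover have "x \<in> cube x 1" by (simp add: cube_def)
  ultimately show ?case by (intro bexI[of _ "[(x, e)]"]) auto
next
  case (Cons y ys)
  obtain e where e: "e \<in> incident x" "K < \<tau> e" using Cons.prems(2) by (auto simp: bad_points_def incident_def)
  have "\<exists>g\<in>marked_chains (Suc (length ys)) y. map fst g = y # ys \<and> (\<forall>q\<in>set g. K < \<tau> (snd q))"
    by (rule Cons.IH) (use Cons.prems in auto)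
  then obtain g where g: "g \<in> marked_chains (Suc (length ys)) y" "map fst g = y # ys \<and> (\<forall>q\<in>set g. K < \<tau> (snd q))"
    by (rule bexE)
  have "y \<in> cube x 1" using Cons.prems(1) by (simp add: star_adj_cube)
  then have "(x, e) # g \<in> marked_chains (Suc (length (y # ys))) x"
    using marked_chains_Cons[OF e(1) _ g(1)] by simp
  then show ?case using e g by (intro bexI[of _ "(x, e) # g"]) auto
qed

text \<open>One edge can mark at most its two endpoints. Hence the exponent n/2 in the probability
  of a chain, and the square root in the condition on \<open>tail K\<close>.\<close>

lemma card_marks_ge:
  assumes g: "g \<in> marked_chains n x" and d: "distinct (map fst g)"
  shows "n \<le> 2 * card (snd ` set g)"
proof -
  have "fst ` set g \<subseteq> (\<Union>e\<in>snd ` set g. e)" using marked_chains_elem[OF g] by force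
  moreover have fin: "finite e" and c2: "card e \<le> 2" if "e \<in> snd ` set g" for e
  proof -
    have "e \<in> lattice_edges" using that marked_chains_elem[OF g] by force
    then obtain u v where "e = {u, v}" by (auto simp: lattice_edges_def)
    then show "finite e" "card e \<le> 2" by (auto simp: card_insert_if)
  qed
  ultimately have "card (fst ` set g) \<le> card (\<Union>e\<in>snd ` set g. e)"
    by (intro card_mono) auto
  also have "\<dots> \<le> (\<Sum>e\<in>snd ` set g. card e)" by (rule card_UN_le) auto
  also have "\<dots> \<le> (\<Sum>e\<in>snd ` set g. 2)" by (rule sum_mono) (rule c2)
  finally have "card (fst ` set g) \<le> 2 * card (snd ` set g)" by simp
  moreover have "card (fst ` set g) = n"
    using distinct_card[OF d] marked_chains_elem[OF g] by simp
  ultimately show ?thesis by simp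
qed

definition has_bad_chain :: "((int ^ 'd) set \<Rightarrow> real) \<Rightarrow> real \<Rightarrow> nat \<Rightarrow> int \<Rightarrow> bool" where
  "has_bad_chain \<tau> K n N \<longleftrightarrow>
    (\<exists>x\<in>cube 0 N. \<exists>g\<in>marked_chains n x. distinct (map fst g) \<and> (\<forall>q\<in>set g. K < \<tau> (snd q)))"

definition bad_event :: "real measure \<Rightarrow> real \<Rightarrow> nat \<Rightarrow> int \<Rightarrow> ((int ^ 'd) set \<Rightarrow> real) set" where
  "bad_event L K n N = {\<tau> \<in> space (weights L). has_bad_chain \<tau> K n N}"

lemma measurable_has_bad_chain:
  fixes w :: "'b \<Rightarrow> (int ^ 'a) set \<Rightarrow> real"
  assumes "\<And>e. e \<in> lattice_edges \<Longrightarrow> (\<lambda>x. w x e) \<in> borel_measurable R"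
  shows "{x \<in> space R. has_bad_chain (w x) K n N} \<in> sets R"
  unfolding has_bad_chain_def
proof (intro sets.sets_Collect_finite_Ex sets.sets_Collect_conj sets.sets_Collect_finite_All sets.sets_Collect_const
    finite_cube finite_marked_chains)
  fix y g and q :: "(int ^ 'a) \<times> (int ^ 'a) set" assume "g \<in> marked_chains n y" "q \<in> set g"
  then have [measurable]: "(\<lambda>x. w x (snd q)) \<in> borel_measurable R" using marked_chains_elem[of g n y] by (intro assms) auto
  show "{x \<in> space R. K < w x (snd q)} \<in> sets R" by measurable
qed auto

section \<open>Probability of bad chains\<close>

context weight_law
begin

definition tail :: "real \<Rightarrow> real" where
  "tail K = measure L {t \<in> space L. K < t}"

lemma tail_set [measurable]: "{t \<in> space L. K < t} \<in> sets L"
proof -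
  have [measurable]: "(\<lambda>t. t) \<in> borel_measurable L" by (rule borel_measurable_L) simp
  show ?thesis by measurable
qed

lemma tail_small:
  assumes "0 < \<epsilon>" shows "\<exists>K\<ge>0. tail K < \<epsilon>"
proof -
  have "(\<lambda>n. L.prob {t \<in> space L. real n < t}) \<longlonglongrightarrow> L.prob (\<Inter>n. {t \<in> space L. real n < t})"
    by (rule L.finite_Lim_measure_decseq) (auto simp: decseq_def)
  moreover have "(\<Inter>n. {t \<in> space L. real n < t}) = {}"
  proof -
    have "\<not> (\<forall>n. real n < t)" for t using real_arch_simple[of t] by (simp add: not_less)
    then show ?thesis by blast
  qed
  ultimately have "(\<lambda>n. tail (real n)) \<longlonglongrightarrow> 0" by (simp add: tail_def)
  then have "eventually (\<lambda>n. tail (real n) < \<epsilon>) sequentially" using assms by (rule order_tendstoD)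
  then obtain n where "tail (real n) < \<epsilon>" by (auto simp: eventually_sequentially)
  then show ?thesis by (intro exI[of _ "real n"]) auto
qed

lemma prob_all_bad:
  fixes E :: "(int ^ 'd) set set"
  assumes "finite E" "E \<subseteq> lattice_edges"
  shows "{\<tau> \<in> space (weights L). \<forall>e\<in>E. K < \<tau> e} \<in> sets (weights L)"
    "measure (weights L) {\<tau> \<in> space (weights L). \<forall>e\<in>E. K < \<tau> e} = tail K ^ card E"
proof -
  interpret PS: product_prob_space "\<lambda>_. L" "lattice_edges :: (int ^ 'd) set set" by unfold_locales
  interpret W: prob_space "weights L :: ((int ^ 'd) set \<Rightarrow> real) measure" by (rule prob_space_weights)
  have eq: "{\<tau> \<in> space (weights L). \<forall>e\<in>E. K < \<tau> e} = {\<tau> \<in> space (weights L). \<forall>e\<in>E. \<tau> e \<in> {t \<in> space L. K < t}}"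
    using assms(2) by (auto simp: weights_def space_PiM PiE_def Pi_def)
  show "{\<tau> \<in> space (weights L). \<forall>e\<in>E. K < \<tau> e} \<in> sets (weights L)"
  proof (rule sets.sets_Collect_finite_All[OF _ assms(1)])
    fix e assume "e \<in> E"
    then have [measurable]: "(\<lambda>\<tau>. \<tau> e) \<in> borel_measurable (weights L)" using assms(2) by (intro measurable_weight) auto
    show "{\<tau> \<in> space (weights L). K < \<tau> e} \<in> sets (weights L)" by measurable
  qed
  have "emeasure (weights L) {\<tau> \<in> space (weights L). \<forall>e\<in>E. K < \<tau> e} = (\<Prod>e\<in>E. emeasure L {t \<in> space L. K < t})"
    unfolding eq unfolding weights_def by (rule PS.emeasure_PiM_Collect) (use assms in auto)
  also have "\<dots> = ennreal (tail K ^ card E)" by (simp add: L.emeasure_eq_measure tail_def ennreal_power)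
  finally show "measure (weights L) {\<tau> \<in> space (weights L). \<forall>e\<in>E. K < \<tau> e} = tail K ^ card E"
    by (simp add: Sigma_Algebra.measure_def tail_def)
qed

text \<open>The Peierls count: at most \<open>chain_base TYPE('d) ^ n\<close> marked chains start at
  each point of the box, and each is entirely bad with probability at most
  \<open>sqrt (tail K) ^ n\<close>.\<close>

lemma bad_event_bound:
  fixes N :: int and n :: nat
  assumes K: "real (chain_base TYPE('d)) * sqrt (tail K) \<le> 1 / 2"
  shows "(bad_event L K n N :: ((int ^ 'd) set \<Rightarrow> real) set) \<in> sets (weights L)"
    "measure (weights L) (bad_event L K n N :: ((int ^ 'd) set \<Rightarrow> real) set) \<le> real (card (cube (0 :: int ^ 'd) N)) * (1 / 2) ^ n"
proof -
  interpret W: prob_space "weights L :: ((int ^ 'd) set \<Rightarrow> real) measure" by (rule prob_space_weights)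
  let ?W = "weights L :: ((int ^ 'd) set \<Rightarrow> real) measure"
  let ?B = "real (chain_base TYPE('d))"
  define G where "G x = {g \<in> marked_chains n x. distinct (map fst g)}" for x :: "int ^ 'd"
  define A where "A g = {\<tau> \<in> space ?W. \<forall>e\<in>snd ` set g. K < \<tau> e}" for g :: "((int ^ 'd) \<times> (int ^ 'd) set) list"
  have finG: "finite (G x)" for x unfolding G_def using finite_marked_chains[of n x] by simp
  have eq: "bad_event L K n N = (\<Union>x\<in>cube 0 N. \<Union>g\<in>G x. A g)"
    by (auto simp: bad_event_def has_bad_chain_def G_def A_def)
  have lat: "snd ` set g \<subseteq> lattice_edges" if "g \<in> G x" for g x
    using that marked_chains_elem[of g n x] by (auto simp: G_def)
  have Aset: "A g \<in> sets ?W" if "g \<in> G x" for g x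
    unfolding A_def by (rule prob_all_bad(1)) (use lat[OF that] in auto)
  have p: "0 \<le> tail K" "tail K \<le> 1" by (auto simp: tail_def)
  have Ap: "measure ?W (A g) \<le> sqrt (tail K) ^ n" if g: "g \<in> G x" for g x
  proof -
    have "measure ?W (A g) = tail K ^ card (snd ` set g)"
      unfolding A_def by (rule prob_all_bad(2)) (use lat[OF g] in auto)
    also have "\<dots> = (sqrt (tail K)) ^ (2 * card (snd ` set g))" using p by (simp add: power_mult)
    also have "\<dots> \<le> sqrt (tail K) ^ n"
      using card_marks_ge[of g n x] g p by (intro power_decreasing) (auto simp: G_def)
    finally show ?thesis .
  qed
  have sets_x: "(\<Union>g\<in>G x. A g) \<in> sets ?W" for x using finG Aset by (intro sets.finite_UN) auto
  then show "bad_event L K n N \<in> sets ?W" unfolding eq by (rule sets.finite_UN[OF finite_cube])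
  have "measure ?W (bad_event L K n N) \<le> (\<Sum>x\<in>cube 0 N. measure ?W (\<Union>g\<in>G x. A g))"
    unfolding eq by (rule measure_UNION_le) (auto intro: finite_cube sets_x)
  also have "\<dots> \<le> (\<Sum>x\<in>cube (0 :: int ^ 'd) N. (1 / 2) ^ n)"
  proof (rule sum_mono)
    fix x :: "int ^ 'd"
    have "measure ?W (\<Union>g\<in>G x. A g) \<le> (\<Sum>g\<in>G x. measure ?W (A g))"
      by (rule measure_UNION_le) (auto intro: finG Aset)
    also have "\<dots> \<le> (\<Sum>g\<in>G x. sqrt (tail K) ^ n)" by (rule sum_mono) (rule Ap)
    also have "\<dots> = real (card (G x)) * sqrt (tail K) ^ n" by simp
    also have "real (card (G x)) \<le> ?B ^ n"
    proof -
      have "card (G x) \<le> card (marked_chains n x)" unfolding G_def by (intro card_mono finite_marked_chains) auto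
      then have "card (G x) \<le> chain_base TYPE('d) ^ n" using card_marked_chains_le[of n x] by linarith
      then have "real (card (G x)) \<le> real (chain_base TYPE('d) ^ n)" by (simp only: of_nat_le_iff)
      then show ?thesis by simp
    qed
    then have "real (card (G x)) * sqrt (tail K) ^ n \<le> ?B ^ n * sqrt (tail K) ^ n"
      using p by (intro mult_right_mono) auto
    also have "\<dots> = (?B * sqrt (tail K)) ^ n" by (simp add: power_mult_distrib)
    also have "\<dots> \<le> (1 / 2) ^ n" using K p by (intro power_mono) auto
    finally show "measure ?W (\<Union>g\<in>G x. A g) \<le> (1 / 2) ^ n" .
  qed
  finally show "measure ?W (bad_event L K n N) \<le> real (card (cube (0 :: int ^ 'd) N)) * (1 / 2) ^ n" by simp
qed

end

text \<open>Chains are kept self-avoiding, since only distinct points force many distinct edges: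
  when the growing cluster returns to a point already on the chain, the chain is cut there.\<close>

lemma star_cluster_chain:
  assumes "y \<in> star_cluster B (cube v k)"
  shows "y \<in> cube v k \<or> (\<exists>x xs. distinct (x # xs) \<and> successively star_adj (x # xs) \<and> set (x # xs) \<subseteq> B \<and>
    x \<in> cube v (k + 1) \<and> last (x # xs) = y)"
  using assms
proof (induction rule: star_cluster.induct)
  case (step a y)
  show ?case
  proof (cases "a \<in> cube v k")
    case True
    have "y \<in> cube v (k + 1)"
      unfolding cube_def
    proof safe
      fix i
      have "\<bar>a $ i - v $ i\<bar> \<le> k" "\<bar>a $ i - y $ i\<bar> \<le> 1" using True step(2) by (auto simp: cube_def star_adj_def)
      then show "\<bar>y $ i - v $ i\<bar> \<le> k + 1" by linarith
    qed
    then show ?thesis using step(3) by (intro disjI2 exI[of _ y] exI[of _ "[]"]) auto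
  next
    case False
    then obtain x xs where c: "distinct (x # xs)" "successively star_adj (x # xs)" "set (x # xs) \<subseteq> B"
      "x \<in> cube v (k + 1)" "last (x # xs) = a" using step.IH by blast
    show ?thesis
    proof (cases "y \<in> set (x # xs)")
      case True
      obtain p q where pq: "x # xs = p @ y # q" using split_list[OF True] by blast
      obtain ys where ys: "p @ [y] = x # ys" using pq by (cases p) auto
      have "distinct (p @ [y])" "successively star_adj (p @ [y])" "set (p @ [y]) \<subseteq> B"
        using c(1-3) unfolding pq by (auto simp: successively_append_iff)
      moreover have "last (x # ys) = y" using ys by (metis last_snoc)
      ultimately show ?thesis unfolding ys using c(4) by blast
    next
      case False
      have "successively star_adj ((x # xs) @ [y])"
        unfolding successively_append_iff using c(2,5) step(2) by simp
      then have "distinct (x # xs @ [y])" "successively star_adj (x # xs @ [y])" "set (x # xs @ [y]) \<subseteq> B"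
        "last (x # xs @ [y]) = y" using c step(3) False by auto
      then show ?thesis using c(4) by blast
    qed
  qed
qed auto

lemma chain_in_cube:
  assumes "successively star_adj (x # xs)" "x \<in> cube v k"
  shows "last (x # xs) \<in> cube v (k + int (length xs))"
  using assms
proof (induction xs arbitrary: x k)
  case (Cons y ys)
  have "y \<in> cube v (k + 1)"
    unfolding cube_def
  proof safe
    fix i
    have "\<bar>x $ i - v $ i\<bar> \<le> k" "\<bar>x $ i - y $ i\<bar> \<le> 1" using Cons.prems by (auto simp: cube_def star_adj_def)
    then show "\<bar>y $ i - v $ i\<bar> \<le> k + 1" by linarith
  qed
  then show ?case using Cons.IH[of y "k + 1"] Cons.prems(1) by (simp add: algebra_simps)
qed simp

text \<open>A cluster that leaves the cube of radius \<open>k + int n - 1\<close> contains a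
  self-avoiding bad chain of at least \<open>n\<close> points, whose first \<open>n\<close> points
  the hypothesis forbids. The chain starts within \<open>k + 1\<close> of \<open>v\<close>, which
  explains the enlarged box.\<close>

lemma clusters_small:
  assumes \<tau>: "\<not> has_bad_chain \<tau> K n (N + int n + 1)"
    and n: "0 < n" and v: "v \<in> cube 0 N" and k: "0 \<le> k" "k \<le> int n"
  shows "star_cluster (bad_points \<tau> K) (cube v k) \<subseteq> cube v (k + int n - 1)"
proof
  fix y assume y: "y \<in> star_cluster (bad_points \<tau> K) (cube v k)"
  show "y \<in> cube v (k + int n - 1)"
  proof (rule ccontr)
    assume far: "y \<notin> cube v (k + int n - 1)"
    have mono: "cube v a \<subseteq> cube v b" if ab: "a \<le> b" for a b
    proof
      fix x assume "x \<in> cube v a"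
      then have "\<bar>x $ i - v $ i\<bar> \<le> a" for i by (simp add: cube_def)
      then have "\<bar>x $ i - v $ i\<bar> \<le> b" for i using ab order_trans by blast
      then show "x \<in> cube v b" by (simp add: cube_def)
    qed
    have "y \<notin> cube v k" using far mono[of k "k + int n - 1"] n by auto
    then obtain x xs where c: "distinct (x # xs)" "successively star_adj (x # xs)" "set (x # xs) \<subseteq> bad_points \<tau> K"
      "x \<in> cube v (k + 1)" "last (x # xs) = y" using star_cluster_chain[OF y] by blast
    have "y \<in> cube v (k + 1 + int (length xs))" using chain_in_cube[OF c(2,4)] c(5) by simp
    then have "\<not> k + 1 + int (length xs) \<le> k + int n - 1" using far mono by blast
    then have len: "n \<le> Suc (length xs)" by linarith
    define ys where "ys = take (n - 1) xs"
    have tk: "take n (x # xs) = x # ys" using n by (cases n) (auto simp: ys_def)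
    have "Suc (length ys) = n" using len n by (simp add: ys_def)
    have "successively star_adj (take n (x # xs) @ drop n (x # xs))" using c(2) by (simp only: append_take_drop_id)
    then have s: "successively star_adj (x # ys)" unfolding tk by (simp only: successively_append_iff)
    have d: "distinct (x # ys)" unfolding tk[symmetric] using c(1) by (rule distinct_take)
    have sub: "set (x # ys) \<subseteq> bad_points \<tau> K" unfolding tk[symmetric] using c(3) set_take_subset by (rule order_trans[rotated])
    have "\<exists>g\<in>marked_chains n x. map fst g = x # ys \<and> (\<forall>q\<in>set g. K < \<tau> (snd q))"
      using bad_chain_marked[OF s sub] unfolding \<open>Suc (length ys) = n\<close> .
    then obtain g where g: "g \<in> marked_chains n x" "map fst g = x # ys \<and> (\<forall>q\<in>set g. K < \<tau> (snd q))"
      by (rule bexE)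
    then have "distinct (map fst g)" using d by simp
    have "x \<in> cube 0 (N + int n + 1)"
      unfolding cube_def
    proof safe
      fix i
      have "\<bar>v $ i\<bar> \<le> N" "\<bar>x $ i - v $ i\<bar> \<le> k + 1" using v c(4) by (auto simp: cube_def)
      then show "\<bar>x $ i - 0 $ i\<bar> \<le> N + int n + 1" using k by simp
    qed
    then have "has_bad_chain \<tau> K n (N + int n + 1)"
      unfolding has_bad_chain_def using g \<open>distinct (map fst g)\<close> by blast
    then show False using \<tau> by blast
  qed
qed

subsection \<open>Nearly subadditive sequences\<close>

text \<open>At the extreme ratio 2 of \<open>a\<close> and \<open>b\<close>, the quotient of
  \<open>sqrt a + sqrt b\<close> by \<open>sqrt (a + b)\<close> is about 1.39, above 4/3. This gain
  lets a multiple of the square root absorb the error in near subadditivity.\<close>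

lemma sqrt_split_gain:
  fixes a b :: real
  assumes "0 < a" "0 < b" "a \<le> 2 * b" "b \<le> 2 * a"
  shows "4 * sqrt (a + b) \<le> 3 * (sqrt a + sqrt b)"
proof -
  have "0 \<le> (2 * b - a) * (2 * a - b)" using assms by (intro mult_nonneg_nonneg) auto
  then have ab: "2 * (a + b)\<^sup>2 \<le> 9 * (a * b)" by (simp add: power2_eq_square algebra_simps)
  \<comment> \<open>Squaring the claim leaves exactly this bound on \<open>sqrt (a * b)\<close>;
    there is room, as 49/324 is less than 2/9.\<close>
  have "7 / 18 * (a + b) \<le> sqrt (a * b)"
  proof (rule real_le_rsqrt)
    have "(7 / 18 * (a + b))\<^sup>2 = 49 / 324 * (a + b)\<^sup>2" by (simp add: power2_eq_square algebra_simps)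
    also have "\<dots> \<le> 2 / 9 * (a + b)\<^sup>2" by (intro mult_right_mono) auto
    finally show "(7 / 18 * (a + b))\<^sup>2 \<le> a * b" using ab by simp
  qed
  moreover have "(3 * (sqrt a + sqrt b))\<^sup>2 = 9 * (a + b) + 18 * sqrt (a * b)"
    using assms by (simp add: power_mult_distrib power2_sum real_sqrt_mult)
  ultimately have "16 * (a + b) \<le> (3 * (sqrt a + sqrt b))\<^sup>2"
    using assms by simp
  then have "sqrt (16 * (a + b)) \<le> 3 * (sqrt a + sqrt b)"
    using assms by (intro real_le_lsqrt) auto
  moreover have "sqrt (16 * (a + b)) = 4 * sqrt (a + b)" by (simp add: real_sqrt_mult del: distrib_left_numeral)
  ultimately show ?thesis by simp
qed

text \<open>The corrected sequence \<open>f n + 3 * C * sqrt n\<close> is exactly subadditive for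
  balanced splits, by \<open>sqrt_split_gain\<close>. Repeated halving extends this to multiples of
  a fixed \<open>m\<close>, and then Fekete's argument applies. Remainders modulo \<open>m\<close>
  may be smaller than \<open>N0\<close>, where \<open>sub\<close> says nothing; they are absorbed by
  \<open>ext\<close>.\<close>

lemma nearly_subadditive_converges:
  fixes f :: "nat \<Rightarrow> real"
  assumes f0: "\<And>n. 0 \<le> f n" and C: "0 \<le> C" and N0: "1 \<le> N0"
    and sub: "\<And>a b. N0 \<le> a \<Longrightarrow> N0 \<le> b \<Longrightarrow> f (a + b) \<le> f a + f b + C * sqrt (a + b)"
    and ext: "\<And>a b. N0 \<le> a \<Longrightarrow> f (a + b) \<le> f a + C * (b + 1) * sqrt (a + b)"
  shows "\<exists>l. (\<lambda>n. f n / n) \<longlonglongrightarrow> l"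
proof -
  define g where "g n = f n + 3 * C * sqrt n" for n :: nat
  have g0: "0 \<le> g n" for n using f0[of n] C by (simp add: g_def)
  have gsub: "g (a + b) \<le> g a + g b" if "N0 \<le> a" "N0 \<le> b" "a \<le> 2 * b" "b \<le> 2 * a" for a b
  proof -
    have "4 * sqrt (real a + real b) \<le> 3 * (sqrt a + sqrt b)"
      using that N0 by (intro sqrt_split_gain) auto
    then have "C * (4 * sqrt (real a + real b)) \<le> C * (3 * (sqrt a + sqrt b))" using C by (rule mult_left_mono)
    then show ?thesis using sub[OF that(1,2)] by (simp add: g_def algebra_simps)
  qed
  have gmult: "g (q * m) \<le> q * g m" if m: "N0 \<le> m" and q: "1 \<le> q" for q m
    using q
  proof (induction q rule: less_induct)
    case (less q)
    show ?case
    proof (cases "q = 1")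
      case False
      \<comment> \<open>The halves of \<open>q \<ge> 2\<close> differ by at most one, so their ratio
        is at most 2, with 3 = 1 + 2 as the extreme case.\<close>
      define a where "a = q div 2"
      define b where "b = q - a"
      have ab: "1 \<le> a" "1 \<le> b" "a < q" "b < q" "a + b = q" "a \<le> 2 * b" "b \<le> 2 * a"
        using less.prems False by (auto simp: a_def b_def)
      have "N0 \<le> a * m" "N0 \<le> b * m" using m ab by (metis le_trans mult_le_mono1 nat_mult_1)+
      moreover have "a * m \<le> 2 * (b * m)" "b * m \<le> 2 * (a * m)"
        using mult_le_mono1[OF ab(6), of m] mult_le_mono1[OF ab(7), of m] by (simp_all add: mult.assoc)
      ultimately have "g (a * m + b * m) \<le> g (a * m) + g (b * m)" by (rule gsub)
      also have "\<dots> \<le> a * g m + b * g m" using less.IH ab by (intro add_mono) auto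
      also have "\<dots> = q * g m" unfolding ab(5)[symmetric] by (simp add: algebra_simps)
      also have "a * m + b * m = q * m" unfolding ab(5)[symmetric] by (simp add: algebra_simps)
      finally show ?thesis .
    qed simp
  qed
  have sqrt0: "(\<lambda>n. c * sqrt n / n) \<longlonglongrightarrow> 0" for c
  proof -
    have "(\<lambda>n::nat. c / sqrt n) \<longlonglongrightarrow> 0"
      by (intro tendsto_divide_0[OF tendsto_const] filterlim_at_top_imp_at_infinity
          filterlim_compose[OF sqrt_at_top] filterlim_real_sequentially)
    moreover have "c * sqrt n / n = c / sqrt n" for n :: nat
      by (cases "n = 0") (simp_all add: field_simps)
    ultimately show ?thesis by simp
  qed
  define A where "A = (\<lambda>m. g m / m) ` {N0..}"
  define l where "l = Inf A"
  have bdd: "bdd_below A" unfolding A_def using g0 by (intro bdd_belowI2[of _ 0]) auto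
  have A: "A \<noteq> {}" by (auto simp: A_def)
  have lower: "l \<le> g n / n" if "N0 \<le> n" for n
    unfolding l_def using that by (intro cInf_lower bdd) (auto simp: A_def)
  have upper: "f n / n \<le> g m / m + C * (m + 1) * sqrt n / n" if m: "N0 \<le> m" "m \<le> n" for m n
  proof -
    define q where "q = n div m"
    define r where "r = n mod m"
    have n: "n = q * m + r" by (simp add: q_def r_def)
    have m0: "0 < m" using m N0 by auto
    have q: "1 \<le> q" using m m0 by (simp add: q_def div_greater_zero_iff Suc_leI)
    have r: "r \<le> m" using m0 by (simp add: r_def less_imp_le)
    have "N0 \<le> q * m" using m q by (metis le_trans mult_le_mono1 nat_mult_1)
    then have "f n \<le> f (q * m) + C * (r + 1) * sqrt n" using ext[of "q * m" r] by (simp add: n)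
    also have "f (q * m) \<le> g (q * m)" using C by (simp add: g_def)
    also have "g (q * m) \<le> q * g m" by (rule gmult[OF m(1) q])
    also have "C * (r + 1) * sqrt n \<le> C * (m + 1) * sqrt n" using r C by (intro mult_right_mono mult_left_mono) auto
    finally have "f n / n \<le> (q * g m + C * (m + 1) * sqrt n) / n" by (simp add: divide_right_mono)
    also have "\<dots> = q * g m / n + C * (m + 1) * sqrt n / n" by (simp add: add_divide_distrib)
    also have "q * g m / n \<le> g m / m"
    proof -
      have "real (q * m) \<le> n" using n by simp
      then have "q * g m * m \<le> g m * n" using mult_right_mono[OF _ g0[of m], of "real (q * m)" n] by (simp add: mult_ac)
      then show ?thesis using m m0 by (simp add: field_simps)
    qed
    finally show ?thesis by simp
  qed
  have "(\<lambda>n. f n / n) \<longlonglongrightarrow> l"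
  proof (rule LIMSEQ_I)
    fix \<epsilon> :: real assume \<epsilon>: "0 < \<epsilon>"
    have "\<exists>x\<in>A. x < l + \<epsilon> / 2" using cInf_lessD[OF A, of "l + \<epsilon> / 2"] \<epsilon> by (auto simp: l_def)
    then obtain m where m: "N0 \<le> m" "g m / m < l + \<epsilon> / 2" by (auto simp: A_def)
    have e1: "\<forall>\<^sub>F n in sequentially. C * (m + 1) * sqrt n / n < \<epsilon> / 2"
      by (rule order_tendstoD(2)[OF sqrt0]) (use \<epsilon> in simp)
    have e2: "\<forall>\<^sub>F n in sequentially. 3 * C * sqrt n / n < \<epsilon>" using order_tendstoD(2)[OF sqrt0 \<epsilon>] by simp
    have "\<forall>\<^sub>F n in sequentially. norm (f n / n - l) < \<epsilon>"
      using e1 e2 eventually_ge_at_top[of m] eventually_ge_at_top[of N0]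
    proof eventually_elim
      case (elim n)
      have "f n / n < l + \<epsilon>" using upper[OF m(1) elim(3)] elim(1) m(2) by linarith
      moreover have "f n / n = g n / n - 3 * C * sqrt n / n" by (simp add: g_def add_divide_distrib)
      then have "l - \<epsilon> < f n / n" using lower[OF elim(4)] elim(2) by linarith
      ultimately show ?case by (simp add: abs_less_iff)
    qed
    then show "\<exists>no. \<forall>n\<ge>no. norm (f n / n - l) < \<epsilon>" by (simp add: eventually_sequentially)
  qed
  then show ?thesis ..
qed

subsection \<open>Concave functions are differentiable off a countable set\<close>

text \<open>\<open>R x\<close> is the right derivative, taken as the supremum of the slopes to the
  right so that no limit has to be shown to exist. It is decreasing, hence continuous off a
  countable set, and at a continuity point \<open>h\<close> the difference quotients are squeezed
  between \<open>R y\<close> and \<open>R h\<close>.\<close>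

lemma concave_countable_nondiff:
  fixes \<mu> :: "real \<Rightarrow> real"
  assumes conc: "\<And>x y z. 0 < x \<Longrightarrow> x < y \<Longrightarrow> y < z \<Longrightarrow> (z - y) * \<mu> x + (y - x) * \<mu> z \<le> (z - x) * \<mu> y"
  shows "countable {h. 0 < h \<and> \<not> (\<exists>l. (\<mu> has_real_derivative l) (at h))}"
proof -
  define sl where "sl x y = (\<mu> y - \<mu> x) / (y - x)" for x y
  have sl1: "sl x z \<le> sl x y" and sl2: "sl y z \<le> sl x y" if "0 < x" "x < y" "y < z" for x y z
  proof -
    have "(\<mu> z - \<mu> x) * (y - x) \<le> (\<mu> y - \<mu> x) * (z - x)" "(\<mu> z - \<mu> y) * (y - x) \<le> (\<mu> y - \<mu> x) * (z - y)"
      using conc[OF that] by (simp_all add: algebra_simps)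
    then show "sl x z \<le> sl x y" "sl y z \<le> sl x y"
      using that by (simp_all add: sl_def pos_divide_le_eq pos_le_divide_eq)
  qed
  define R where "R x = Sup (sl x ` {x<..})" for x
  have bdd: "bdd_above (sl x ` {x<..})" if "0 < x" for x
    using that sl2[of "x / 2" x] by (intro bdd_aboveI2[of _ _ "sl (x / 2) x"]) auto
  have lo: "sl x y \<le> R x" if "0 < x" "x < y" for x y
    unfolding R_def using that by (intro cSup_upper bdd) auto
  have hi: "R y \<le> sl x y" if "0 < x" "x < y" for x y
    unfolding R_def
  proof (rule cSup_least)
    show "sl y ` {y<..} \<noteq> {}" using gt_ex[of y] by blast
    show "a \<le> sl x y" if "a \<in> sl y ` {y<..}" for a using that sl2[OF \<open>0 < x\<close> \<open>x < y\<close>] by auto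
  qed
  have anti: "R y \<le> R x" if "0 < x" "x < y" for x y
    using lo[OF that] hi[OF that] by linarith
  have "mono_on {0<..} (\<lambda>x. - R x)"
  proof (rule mono_onI)
    fix r s :: real assume "r \<in> {0<..}" "r \<le> s"
    then show "- R r \<le> - R s" using anti[of r s] by (cases "r = s") auto
  qed
  then have c1: "countable {a \<in> {0<..}. \<not> continuous (at a within {0<..}) (\<lambda>x. - R x)}"
    by (rule mono_on_ctble_discont)
  have c2: "\<exists>l. (\<mu> has_real_derivative l) (at h)"
    if h: "0 < h" and cont: "continuous (at h within {0<..}) (\<lambda>x. - R x)" for h
  proof -
    have "at h within {0<..} = at h" using h by (intro at_within_open) auto
    then have "(\<lambda>x. - R x) \<midarrow>h\<rightarrow> - R h" using cont by (simp add: isCont_def)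
    from tendsto_minus[OF this] have R: "R \<midarrow>h\<rightarrow> R h" by simp
    have ev: "\<forall>\<^sub>F y in at h. 0 < y" using h by (intro order_tendstoD(1)[OF tendsto_ident_at])
    have "((\<lambda>y. (\<mu> y - \<mu> h) / (y - h)) \<longlongrightarrow> R h) (at h)"
    proof (rule tendsto_sandwich)
      show "((\<lambda>y. min (R y) (R h)) \<longlongrightarrow> R h) (at h)"
        using tendsto_min[OF R tendsto_const[of "R h"]] by simp
      show "((\<lambda>y. max (R y) (R h)) \<longlongrightarrow> R h) (at h)"
        using tendsto_max[OF R tendsto_const[of "R h"]] by simp
      have q: "min (R y) (R h) \<le> (\<mu> y - \<mu> h) / (y - h) \<and> (\<mu> y - \<mu> h) / (y - h) \<le> max (R y) (R h)"
        if y: "0 < y" "y \<noteq> h" for y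
      proof (cases "y < h")
        case True
        have "(\<mu> y - \<mu> h) / (y - h) = sl y h"
          using minus_divide_divide[of "\<mu> y - \<mu> h" "y - h"] by (simp add: sl_def)
        then show ?thesis using lo[OF y(1) True] hi[OF y(1) True] by auto
      next
        case False
        then have "h < y" using y by simp
        then show ?thesis using lo[OF h \<open>h < y\<close>] hi[OF h \<open>h < y\<close>] by (auto simp: sl_def)
      qed
      have "\<forall>\<^sub>F y in at h. 0 < y \<and> y \<noteq> h"
        by (intro eventually_conj ev) (simp add: eventually_at_filter)
      then show "\<forall>\<^sub>F y in at h. min (R y) (R h) \<le> (\<mu> y - \<mu> h) / (y - h)"
        "\<forall>\<^sub>F y in at h. (\<mu> y - \<mu> h) / (y - h) \<le> max (R y) (R h)"
        using q by (auto elim!: eventually_mono)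
    qed
    then show ?thesis by (auto simp: has_field_derivative_iff)
  qed
  show ?thesis by (rule countable_subset[OF _ c1]) (use c2 in blast)
qed

subsection \<open>Choice of the scales\<close>

text \<open>At distance \<open>n\<close>, weights are truncated at \<open>lev d n\<close>, and the shells have radius \<open>rad d n\<close>.
  Both are small powers of \<open>n\<close>; a path around a shell is cheaper than the truncation level.\<close>

definition rad :: "nat \<Rightarrow> nat \<Rightarrow> nat" where
  "rad d n = nth_root_nat (12 * (d + 1)) n"

definition lev :: "nat \<Rightarrow> nat \<Rightarrow> real" where
  "lev d n = real (rad d n ^ (d + 1))"

text \<open>With exponent 12, the third power of the level, which enters the variance, is at most
  \<open>sqrt k\<close> at distance n = k^2.\<close>

lemma lev_pow: "lev d n ^ 12 \<le> n"
proof -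
  have "(rad d n ^ (d + 1)) ^ 12 = rad d n ^ (12 * (d + 1))" by (simp only: power_mult[symmetric] mult.commute)
  also have "\<dots> \<le> n" unfolding rad_def by (rule nth_root_nat_power_le) simp
  finally have "real ((rad d n ^ (d + 1)) ^ 12) \<le> real n" by (simp only: of_nat_le_iff)
  then show ?thesis by (simp add: lev_def)
qed

lemma lev_nonneg: "0 \<le> lev d n" by (simp add: lev_def)

lemma rad_le_lev: "real (rad d n) \<le> lev d n"
proof (cases "rad d n = 0")
  case False
  then have "rad d n ^ 1 \<le> rad d n ^ (d + 1)" by (intro power_increasing) auto
  then show ?thesis unfolding lev_def by (simp del: power_Suc)
qed (simp add: lev_def)

lemma lev_pow_le:
  assumes "1 \<le> k" "k \<le> 12" shows "lev d n ^ k \<le> n"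
proof (cases "rad d n = 0")
  case False
  then have "1 \<le> rad d n ^ (d + 1)" by (intro one_le_power) simp
  then have "1 \<le> lev d n" unfolding lev_def by (simp only: real_of_nat_ge_one_iff)
  then have "lev d n ^ k \<le> lev d n ^ 12" using assms by (intro power_increasing) auto
  then show ?thesis using lev_pow[of d n] by linarith
qed (use assms in \<open>simp add: lev_def power_0_left\<close>)

lemma lev_le: "lev d n \<le> n" using lev_pow_le[of 1 d n] by simp

lemma lev_square_le: "(lev d n)\<^sup>2 \<le> sqrt n"
  by (rule real_le_rsqrt) (use lev_pow_le[of 4 d n] in \<open>simp add: power_mult[symmetric]\<close>)

lemma rad_at_top: "filterlim (rad d) at_top sequentially"
  unfolding filterlim_at_top
proof
  fix R :: nat
  show "\<forall>\<^sub>F n in sequentially. R \<le> rad d n"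
    using eventually_ge_at_top[of "R ^ (12 * (d + 1))"]
    by eventually_elim (auto simp: rad_def intro: nth_root_nat_ge)
qed

lemma eventually_lev_ge: "\<forall>\<^sub>F n in sequentially. c \<le> lev d n"
proof -
  obtain R :: nat where R: "c \<le> real R" using real_arch_simple by blast
  have "\<forall>\<^sub>F n in sequentially. R \<le> rad d n" using rad_at_top[of d] unfolding filterlim_at_top by blast
  then show ?thesis
  proof eventually_elim
    case (elim n)
    then show ?case using R rad_le_lev[of d n] by linarith
  qed
qed

lemma eventually_shell_cost: "\<forall>\<^sub>F n in sequentially. real_of_int (4 * int (rad d n) + 1) ^ d * c < lev d n"
proof -
  \<comment> \<open>For a radius r of at least 1, 4r + 1 is at most 5r, and the spare factor r in
    the level outgrows the constant \<open>5 ^ d * \<bar>c\<bar>\<close>.\<close>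
  obtain R :: nat where R: "5 ^ d * \<bar>c\<bar> < real R" using reals_Archimedean2 by blast
  have "\<forall>\<^sub>F n in sequentially. max R 1 \<le> rad d n" using rad_at_top[of d] unfolding filterlim_at_top by blast
  then show ?thesis
  proof eventually_elim
    case (elim n)
    let ?r = "real (rad d n)"
    have r: "1 \<le> ?r" "real R \<le> ?r" using elim by auto
    have "real_of_int (4 * int (rad d n) + 1) ^ d * c \<le> real_of_int (4 * int (rad d n) + 1) ^ d * \<bar>c\<bar>"
      by (intro mult_left_mono) auto
    also have "\<dots> \<le> (5 * ?r) ^ d * \<bar>c\<bar>"
      using r by (intro mult_right_mono power_mono) auto
    also have "\<dots> = ?r ^ d * (5 ^ d * \<bar>c\<bar>)" by (simp add: power_mult_distrib)
    also have "\<dots> < ?r ^ d * ?r" using R r by (intro mult_strict_left_mono) auto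
    also have "\<dots> = lev d n" by (simp add: lev_def)
    finally show ?case .
  qed
qed

lemma eventually_lev_linear:
  assumes "0 \<le> c" shows "\<forall>\<^sub>F n in sequentially. c * (lev d n + s) \<le> n"
proof -
  have "\<forall>\<^sub>F n in sequentially. max (2 * c) \<bar>2 * c * s\<bar> \<le> lev d n" by (rule eventually_lev_ge)
  then show ?thesis
  proof eventually_elim
    case (elim n)
    have l: "0 \<le> lev d n" "2 * c \<le> lev d n" "2 * c * s \<le> lev d n" using elim lev_nonneg[of d n] by auto
    have "2 * c * lev d n \<le> lev d n * lev d n" using l by (intro mult_right_mono) auto
    also have "\<dots> \<le> n" using lev_pow_le[of 2 d n] by (simp add: power2_eq_square)
    finally have "c * lev d n \<le> n / 2" by simp
    moreover have "c * s \<le> n / 2" using l lev_le[of d n] by linarith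
    ultimately show ?case by (simp add: algebra_simps)
  qed
qed

lemma eventually_poly_le_exp:
  "\<forall>\<^sub>F r in sequentially. c * real (r + 1) ^ B \<le> 2 ^ r"
proof -
  \<comment> \<open>With the root of order \<open>Suc B\<close> of 1/2, the claim follows from the
    convergence of n y^n to 0, raised to the power \<open>Suc B\<close>.\<close>
  define y where "y = root (Suc B) (1 / 2)"
  have y: "0 < y" "y < 1" by (simp_all add: y_def)
  have yB: "y ^ Suc B = 1 / 2" unfolding y_def by (rule real_root_pow_pos2) simp_all
  have "(\<lambda>n. real n * y ^ n) \<longlonglongrightarrow> 0" using powser_times_n_limit_0[of y] y by simp
  then have "(\<lambda>n. real (n + 1) * y ^ (n + 1)) \<longlonglongrightarrow> 0" by (rule LIMSEQ_ignore_initial_segment)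
  then have "(\<lambda>n. (real (n + 1) * y ^ (n + 1)) ^ Suc B * (2 * c)) \<longlonglongrightarrow> 0 ^ Suc B * (2 * c)"
    by (intro tendsto_intros)
  then have "(\<lambda>n. (real (n + 1) * y ^ (n + 1)) ^ Suc B * (2 * c)) \<longlonglongrightarrow> 0" by simp
  then have "\<forall>\<^sub>F n in sequentially. (real (n + 1) * y ^ (n + 1)) ^ Suc B * (2 * c) < 1"
    by (rule order_tendstoD) simp
  then show ?thesis
  proof eventually_elim
    case (elim n)
    have "(real (n + 1) * y ^ (n + 1)) ^ Suc B * (2 * c) = real (n + 1) ^ Suc B * (y ^ Suc B) ^ (n + 1) * (2 * c)"
      by (simp only: power_mult_distrib power_mult[symmetric] mult.commute)
    also have "\<dots> = real (n + 1) ^ Suc B * c / 2 ^ n" unfolding yB by (simp add: power_one_over)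
    finally have "real (n + 1) ^ Suc B * c / 2 ^ n < 1" using elim by linarith
    then have "real (n + 1) ^ Suc B * c < 2 ^ n" by (subst (asm) pos_divide_less_eq) simp_all
    moreover have "c * real (n + 1) ^ B \<le> max 0 (real (n + 1) ^ Suc B * c)"
    proof (cases "0 \<le> c")
      case True
      have "real (n + 1) ^ B \<le> real (n + 1) ^ Suc B" by (intro power_increasing) auto
      then have "c * real (n + 1) ^ B \<le> c * real (n + 1) ^ Suc B" using True by (rule mult_left_mono)
      then show ?thesis by (simp add: mult.commute)
    next
      case False
      then have "c * real (n + 1) ^ B \<le> 0" by (intro mult_nonpos_nonneg) auto
      then show ?thesis by (rule max.coboundedI1)
    qed
    moreover have "(0::real) < 2 ^ n" by simp
    ultimately show ?case by linarith
  qed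
qed

section \<open>Good environments at large scales\<close>

context weight_law
begin

text \<open>The radius is a fixed root of \<open>n\<close>, so a polynomial in \<open>n\<close> is
  bounded by one in the radius, and 2 to the power of the radius outgrows it.\<close>

lemma eventually_bad_event_small:
  assumes K: "real (chain_base TYPE('d)) * sqrt (tail K) \<le> 1 / 2"
  shows "\<forall>\<^sub>F n in sequentially. measure (weights L :: ((int ^ 'd) set \<Rightarrow> real) measure)
    (bad_event L K (rad CARD('d) n) (int (n\<^sup>2) + int (rad CARD('d) n) + 1)) \<le> 1 / (real n)\<^sup>2"
proof -
  let ?d = "CARD('d)"
  let ?W = "weights L :: ((int ^ 'd) set \<Rightarrow> real) measure"
  define Q where "Q = 12 * (?d + 1)"
  \<comment> \<open>Of the exponent \<open>2 * ?d + 2\<close>, the part \<open>2 * ?d\<close> pays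
    for the points of a box of radius about n^2, and 2 is the desired decay.\<close>
  define B where "B = Q * (2 * ?d + 2)"
  have "\<forall>\<^sub>F r in sequentially. 7 ^ ?d * real (r + 1) ^ B \<le> 2 ^ r" by (rule eventually_poly_le_exp)
  then have "\<forall>\<^sub>F n in sequentially. 7 ^ ?d * real (rad ?d n + 1) ^ B \<le> 2 ^ rad ?d n"
    by (rule eventually_compose_filterlim[OF _ rad_at_top])
  then show ?thesis using eventually_ge_at_top[of 1]
  proof eventually_elim
    case (elim n)
    let ?r = "rad ?d n"
    have n: "1 \<le> n" using elim by simp
    have "n < (?r + 1) ^ Q"
    proof (rule ccontr)
      assume "\<not> ?thesis"
      then have "(?r + 1) ^ Q \<le> n" by simp
      then have "?r + 1 \<le> nth_root_nat Q n" by (rule nth_root_nat_ge[rotated]) (simp add: Q_def)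
      then show False by (simp add: rad_def Q_def)
    qed
    then have "real n \<le> real ((?r + 1) ^ Q)" by linarith
    then have "real n ^ (2 * ?d + 2) \<le> real ((?r + 1) ^ Q) ^ (2 * ?d + 2)" by (intro power_mono) auto
    also have "\<dots> = real (?r + 1) ^ B" by (simp only: B_def of_nat_power power_mult)
    finally have "7 ^ ?d * real n ^ (2 * ?d + 2) \<le> 7 ^ ?d * real (?r + 1) ^ B" by simp
    then have e: "7 ^ ?d * real n ^ (2 * ?d + 2) \<le> 2 ^ ?r" using elim(1) by linarith
    have rn: "?r \<le> n"
    proof -
      have "real ?r \<le> real n" using rad_le_lev[of ?d n] lev_le[of ?d n] by linarith
      then show ?thesis by simp
    qed
    have "2 * (int (n\<^sup>2) + int ?r + 1) + 1 = int (2 * n\<^sup>2 + 2 * ?r + 3)" by simp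
    then have "nat (2 * (int (n\<^sup>2) + int ?r + 1) + 1) = 2 * n\<^sup>2 + 2 * ?r + 3" by (simp only: nat_int)
    also have "\<dots> \<le> 7 * n\<^sup>2"
    proof -
      have "n \<le> n\<^sup>2" "1 \<le> n\<^sup>2" using n by (auto simp: power2_nat_le_imp_le power2_eq_square)
      then show ?thesis using rn by linarith
    qed
    finally have c: "card (cube (0 :: int ^ 'd) (int (n\<^sup>2) + int ?r + 1)) \<le> (7 * n\<^sup>2) ^ ?d"
      using card_cube_le[of "0 :: int ^ 'd" "int (n\<^sup>2) + int ?r + 1"] power_mono[of _ "7 * n\<^sup>2" ?d]
      by (meson le_trans zero_le)
    have "measure ?W (bad_event L K ?r (int (n\<^sup>2) + int ?r + 1)) \<le>
        real (card (cube (0 :: int ^ 'd) (int (n\<^sup>2) + int ?r + 1))) * (1 / 2) ^ ?r"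
      by (rule bad_event_bound(2)[OF K])
    also have "\<dots> \<le> real ((7 * n\<^sup>2) ^ ?d) * (1 / 2) ^ ?r"
      using c by (intro mult_right_mono) (simp_all only: of_nat_le_iff, simp)
    also have "\<dots> = 7 ^ ?d * real n ^ (2 * ?d + 2) / 2 ^ ?r / (real n)\<^sup>2"
    proof -
      have "real ((7 * n\<^sup>2) ^ ?d) = 7 ^ ?d * real n ^ (2 * ?d)" by (simp add: power_mult_distrib power_mult)
      moreover have "real n ^ (2 * ?d + 2) = real n ^ (2 * ?d) * (real n)\<^sup>2" by (rule power_add)
      ultimately show ?thesis using n by (simp only: power_one_over) simp
    qed
    also have "\<dots> \<le> 1 / (real n)\<^sup>2"
      using e by (intro divide_right_mono) (auto simp: divide_le_eq)
    finally show ?case .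
  qed
qed

end

text \<open>For large \<open>n\<close> everything but the absence of bad chains is deterministic,
  uniformly in the weights and in \<open>z\<close>. The box radius n^2 comes from
  \<open>reach\<close>: the level is o(n), so \<open>(M + s) * l1_dist 0 z / s\<close> is at most
  n^2 for \<open>z\<close> at distance O(n).\<close>

lemma eventually_good_environment:
  assumes d: "CARD('d) \<ge> 2" and K: "0 \<le> K" and s: "0 < s"
  shows "\<forall>\<^sub>F n in sequentially. \<forall>(\<tau> :: (int ^ 'd) set \<Rightarrow> real) (z :: int ^ 'd).
    (\<forall>e\<in>lattice_edges. 0 \<le> \<tau> e) \<longrightarrow>
    \<not> has_bad_chain \<tau> K (rad CARD('d) n) (int (n\<^sup>2) + int (rad CARD('d) n) + 1) \<longrightarrow>
    real_of_int (l1_dist 0 z) \<le> 6 * CARD('d) * real n \<longrightarrow> (\<exists>i. 4 * real (rad CARD('d) n) < \<bar>real_of_int (z $ i)\<bar>) \<longrightarrow>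
    good_environment \<tau> K (lev CARD('d) n) s (real_of_int (4 * int (rad CARD('d) n) + 1) ^ CARD('d) * (K + s))
      (int (rad CARD('d) n)) (int (n\<^sup>2)) z"
proof -
  let ?d = "CARD('d)"
  have e3: "\<forall>\<^sub>F n in sequentially. 6 * ?d / s * (lev ?d n + s) \<le> n" using s by (intro eventually_lev_linear) simp
  have "\<forall>\<^sub>F n in sequentially. 1 \<le> rad ?d n" using rad_at_top[of ?d] unfolding filterlim_at_top by blast
  then show ?thesis
    using eventually_shell_cost[of ?d "K + s"] e3
  proof eventually_elim
    case (elim n)
    have lin: "6 * ?d / s * (lev ?d n + s) \<le> n" using elim(3) s by simp
    show ?case
    proof (intro allI impI)
      fix \<tau> :: "(int ^ 'd) set \<Rightarrow> real" and z :: "int ^ 'd"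
      assume \<tau>: "\<forall>e\<in>lattice_edges. 0 \<le> \<tau> e"
        and nb: "\<not> has_bad_chain \<tau> K (rad ?d n) (int (n\<^sup>2) + int (rad ?d n) + 1)"
        and z: "real_of_int (l1_dist 0 z) \<le> 6 * ?d * real n" "\<exists>i. 4 * real (rad ?d n) < \<bar>real_of_int (z $ i)\<bar>"
      show "good_environment \<tau> K (lev ?d n) s (real_of_int (4 * int (rad ?d n) + 1) ^ ?d * (K + s))
        (int (rad ?d n)) (int (n\<^sup>2)) z"
      proof
        show "CARD('d) \<ge> 2" "0 < s" "0 \<le> K" by fact+
        show "1 \<le> int (rad ?d n)" using elim(1) by simp
        show "\<exists>i. \<bar>z $ i\<bar> > 4 * int (rad ?d n)"
        proof -
          obtain i where "4 * real (rad ?d n) < \<bar>real_of_int (z $ i)\<bar>" using z(2) by blast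
          then have "4 * int (rad ?d n) < \<bar>z $ i\<bar>" by linarith
          then show ?thesis by blast
        qed
        show "star_cluster (bad_points \<tau> K) (cube v k) \<subseteq> cube v (k + int (rad ?d n) - 1)"
          if "v \<in> cube 0 (int (n\<^sup>2))" "0 \<le> k" "k \<le> int (rad ?d n)" for v k
          using clusters_small[OF nb _ that] elim(1) by simp
        have "(lev ?d n + s) * l1_dist 0 z / s \<le> (lev ?d n + s) * (6 * ?d * real n) / s"
          using z(1) s lev_nonneg[of ?d n] by (intro divide_right_mono mult_left_mono) auto
        also have "\<dots> = 6 * ?d / s * (lev ?d n + s) * n" by simp
        also have "\<dots> \<le> real n * real n" by (rule mult_right_mono[OF lin]) simp
        finally show "(lev ?d n + s) * l1_dist 0 z / s \<le> real_of_int (int (n\<^sup>2))" by (simp add: power2_eq_square)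
      qed (use \<tau> elim(2) in auto)
    qed
  qed
qed

subsection \<open>Lattice points along a ray\<close>

definition ray_point :: "real ^ 'd \<Rightarrow> real \<Rightarrow> int ^ 'd" where
  "ray_point \<xi> t = int_point (t *\<^sub>R \<xi>)"

lemma ray_point_0 [simp]: "ray_point \<xi> 0 = 0"
  by (simp add: ray_point_def int_point_def vec_eq_iff)

lemma ray_point_nth: "ray_point \<xi> t $ i = \<lfloor>t * \<xi> $ i\<rfloor>"
  by (simp add: ray_point_def int_point_def)

lemma l1_ray_point_le:
  fixes \<xi> :: "real ^ 'd" and t t' :: real
  assumes "norm \<xi> = 1"
  shows "real_of_int (l1_dist (ray_point \<xi> t) (ray_point \<xi> t')) \<le> CARD('d) * (\<bar>t - t'\<bar> + 1)"
proof -
  have c: "\<bar>real_of_int (ray_point \<xi> t $ i - ray_point \<xi> t' $ i)\<bar> \<le> \<bar>t - t'\<bar> + 1" for i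
  proof -
    have "\<bar>\<xi> $ i\<bar> \<le> 1" using component_le_norm_cart[of \<xi> i] assms by simp
    then have "\<bar>t - t'\<bar> * \<bar>\<xi> $ i\<bar> \<le> \<bar>t - t'\<bar> * 1" by (intro mult_left_mono) auto
    then have "\<bar>t * \<xi> $ i - t' * \<xi> $ i\<bar> \<le> \<bar>t - t'\<bar>" by (simp add: abs_mult[symmetric] algebra_simps)
    then show ?thesis unfolding ray_point_nth by linarith
  qed
  have "real_of_int (l1_dist (ray_point \<xi> t) (ray_point \<xi> t')) = (\<Sum>i\<in>UNIV. \<bar>real_of_int (ray_point \<xi> t $ i - ray_point \<xi> t' $ i)\<bar>)"
    by (simp add: l1_dist_def)
  also have "\<dots> \<le> (\<Sum>i\<in>(UNIV :: 'd set). \<bar>t - t'\<bar> + 1)" by (rule sum_mono) (rule c)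
  finally show ?thesis by simp
qed

text \<open>Floors are additive up to one in each coordinate, so the increments along the
  discretised ray are stationary up to a bounded error.\<close>

lemma l1_ray_point_add:
  fixes \<xi> :: "real ^ 'd"
  shows "l1_dist (ray_point \<xi> (a + b) - ray_point \<xi> a) (ray_point \<xi> b) \<le> CARD('d)"
proof -
  have "\<bar>(ray_point \<xi> (a + b) - ray_point \<xi> a) $ i - ray_point \<xi> b $ i\<bar> \<le> 1" for i
    unfolding ray_point_nth vector_minus_component distrib_right by linarith
  then show ?thesis using l1_le_coord[of "ray_point \<xi> (a + b) - ray_point \<xi> a" "ray_point \<xi> b" 1] by simp
qed

text \<open>The l1 norm of a unit vector is at least 1, so some coordinate has absolute value at
  least \<open>1 / CARD('d)\<close>; taking the floor costs 1.\<close>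

lemma ray_point_far:
  fixes \<xi> :: "real ^ 'd"
  assumes "norm \<xi> = 1" "0 \<le> t"
  shows "\<exists>i. t / CARD('d) - 1 \<le> \<bar>real_of_int (ray_point \<xi> t $ i)\<bar>"
proof -
  have "\<exists>i. 1 / CARD('d) \<le> \<bar>\<xi> $ i\<bar>"
  proof (rule ccontr)
    assume "\<not> ?thesis"
    then have "\<bar>\<xi> $ i\<bar> < 1 / CARD('d)" for i by (simp add: not_le)
    then have "(\<Sum>i\<in>UNIV. \<bar>\<xi> $ i\<bar>) < (\<Sum>i\<in>(UNIV :: 'd set). 1 / CARD('d))" by (intro sum_strict_mono) auto
    then show False using norm_le_l1_cart[of \<xi>] assms(1) by simp
  qed
  then obtain i where "1 / CARD('d) \<le> \<bar>\<xi> $ i\<bar>" by blast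
  then have "t * (1 / CARD('d)) \<le> t * \<bar>\<xi> $ i\<bar>" using assms(2) by (rule mult_left_mono)
  also have "\<dots> = \<bar>t * \<xi> $ i\<bar>" using assms(2) by (simp add: abs_mult)
  finally have "t / CARD('d) \<le> \<bar>t * \<xi> $ i\<bar>" by simp
  then have "t / CARD('d) - 1 \<le> \<bar>real_of_int \<lfloor>t * \<xi> $ i\<rfloor>\<bar>" by linarith
  then show ?thesis unfolding ray_point_nth by blast
qed

subsection \<open>The truncated time constant\<close>

lemma l1_minus: "l1_dist 0 (x - y) = l1_dist x y"
  by (simp add: l1_dist_def abs_minus_commute)

lemma walk_dist_concave:
  assumes "0 < x" "x < y" "y < z" and \<tau>: "\<And>e. e \<in> lattice_edges \<Longrightarrow> 0 \<le> \<tau> e" and M: "0 \<le> M"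
  shows "(z - y) * walk_dist (trunc_weight \<tau> M x) u v + (y - x) * walk_dist (trunc_weight \<tau> M z) u v
    \<le> (z - x) * walk_dist (trunc_weight \<tau> M y) u v"
proof -
  have nn: "0 \<le> trunc_weight \<tau> M s e" if "0 < s" "e \<in> lattice_edges" for s e
    using that \<tau>[of e] M by (simp add: trunc_weight_def)
  let ?A = "(z - y) * walk_dist (trunc_weight \<tau> M x) u v + (y - x) * walk_dist (trunc_weight \<tau> M z) u v"
  have "?A / (z - x) \<le> walk_dist (trunc_weight \<tau> M y) u v"
  proof (rule walk_dist_greatest)
    fix p assume p: "walk p u v"
    have "?A \<le> (z - y) * sum (trunc_weight \<tau> M x) (edges_of_walk p) + (y - x) * sum (trunc_weight \<tau> M z) (edges_of_walk p)"
      using assms(1-3) nn p by (intro add_mono mult_left_mono walk_dist_le) auto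
    also have "\<dots> = (\<Sum>e\<in>edges_of_walk p. (z - y) * trunc_weight \<tau> M x e + (y - x) * trunc_weight \<tau> M z e)"
      by (simp add: sum.distrib sum_distrib_left)
    also have "\<dots> = (\<Sum>e\<in>edges_of_walk p. (z - x) * trunc_weight \<tau> M y e)"
      by (rule sum.cong) (simp_all add: trunc_weight_def algebra_simps)
    also have "\<dots> = (z - x) * sum (trunc_weight \<tau> M y) (edges_of_walk p)" by (simp add: sum_distrib_left)
    finally show "?A / (z - x) \<le> sum (trunc_weight \<tau> M y) (edges_of_walk p)"
      using assms(1-3) by (simp add: pos_divide_le_eq mult.commute)
  qed (use nn assms(1-3) in auto)
  then show ?thesis using assms(1-3) by (simp add: pos_divide_le_eq mult.commute)
qed

context weight_law
begin

lemma integrable_trunc_dist: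
  assumes "0 \<le> M" "0 < s"
  shows "integrable (weights L) (\<lambda>\<tau>. walk_dist (trunc_weight \<tau> M s) u v)"
proof -
  interpret W: prob_space "weights L :: ((int ^ 'a) set \<Rightarrow> real) measure" by (rule prob_space_weights)
  show ?thesis
  proof (rule W.integrable_bounded)
    show "\<bar>walk_dist (trunc_weight \<tau> M s) u v\<bar> \<le> (M + s) * l1_dist u v" if "\<tau> \<in> space (weights L)" for \<tau>
      using trunc_dist_bounds[OF that assms, of u v] by simp
  qed measurable
qed

lemma mean_dist_nonneg: "0 \<le> M \<Longrightarrow> 0 < s \<Longrightarrow> 0 \<le> mean_dist L M s z"
  unfolding mean_dist_def by (rule Bochner_Integration.integral_nonneg) (rule trunc_dist_bounds)

lemma mean_dist_le:
  assumes "0 \<le> M" "0 < s" shows "mean_dist L M s z \<le> (M + s) * l1_dist 0 z"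
proof -
  interpret W: prob_space "weights L :: ((int ^ 'a) set \<Rightarrow> real) measure" by (rule prob_space_weights)
  have "mean_dist L M s z \<le> (\<integral>\<tau>. (M + s) * l1_dist 0 z \<partial>(weights L :: ((int ^ 'a) set \<Rightarrow> real) measure))"
    unfolding mean_dist_def by (rule integral_mono[OF integrable_trunc_dist[OF assms]]) (use trunc_dist_bounds[OF _ assms] in auto)
  then show ?thesis by (simp add: W.prob_space)
qed

lemma mean_dist_triangle:
  assumes "0 \<le> M" "0 < s"
  shows "mean_dist L M s z \<le> mean_dist L M s y + mean_dist L M s (z - y)"
proof -
  have "mean_dist L M s z \<le> (\<integral>\<tau>. walk_dist (trunc_weight \<tau> M s) 0 y + walk_dist (trunc_weight \<tau> M s) y z \<partial>weights L)"
    unfolding mean_dist_def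
  proof (rule integral_mono)
    fix \<tau> :: "(int ^ 'a) set \<Rightarrow> real" assume \<tau>: "\<tau> \<in> space (weights L)"
    show "walk_dist (trunc_weight \<tau> M s) 0 z \<le> walk_dist (trunc_weight \<tau> M s) 0 y + walk_dist (trunc_weight \<tau> M s) y z"
    proof (rule walk_dist_triangle)
      show "0 \<le> trunc_weight \<tau> M s e" if "e \<in> lattice_edges" for e
        using weights_nonneg[OF \<tau> that] assms by (simp add: trunc_weight_def)
    qed
  qed (auto intro!: integrable_trunc_dist assms)
  also have "\<dots> = mean_dist L M s y + (\<integral>\<tau>. walk_dist (trunc_weight \<tau> M s) y z \<partial>weights L)"
    unfolding mean_dist_def by (intro Bochner_Integration.integral_add integrable_trunc_dist assms)
  finally show ?thesis by (simp add: mean_dist_shift[OF assms])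
qed

end

section \<open>Mean passage times along a ray\<close>

locale ray_model = weight_law +
  fixes \<xi> :: "real ^ 'd" and K :: real
  assumes dim: "CARD('d) \<ge> 2" and unit: "norm \<xi> = 1" and K: "0 \<le> K"
    and K_tail: "real (chain_base TYPE('d)) * sqrt (tail K) \<le> 1 / 2"
begin

abbreviation W where "W \<equiv> (weights L :: ((int ^ 'd) set \<Rightarrow> real) measure)"

definition scale_mean :: "real \<Rightarrow> nat \<Rightarrow> real" where
  "scale_mean s n = mean_dist L (lev CARD('d) n) s (ray_point \<xi> n)"

definition bad_at :: "nat \<Rightarrow> ((int ^ 'd) set \<Rightarrow> real) \<Rightarrow> bool" where
  "bad_at n \<tau> \<longleftrightarrow> has_bad_chain \<tau> K (rad CARD('d) n) (int (n\<^sup>2) + int (rad CARD('d) n) + 1)"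

lemma l1_ray_le: "real_of_int (l1_dist 0 (ray_point \<xi> t)) \<le> CARD('d) * (\<bar>t\<bar> + (1::real))"
  using l1_ray_point_le[OF unit, of 0 t] by simp

text \<open>The range up to \<open>4 * real n\<close> covers all distances between k^2 and (k + 1)^2
  at the scale n = k^2.\<close>

lemma eventually_environment:
  fixes s :: real
  assumes s: "0 < s"
  shows "\<forall>\<^sub>F n in sequentially. \<forall>\<tau> (t :: real). (\<forall>e\<in>lattice_edges. 0 \<le> \<tau> e) \<longrightarrow> \<not> bad_at n \<tau> \<longrightarrow>
    real n \<le> t \<longrightarrow> t \<le> 4 * real n \<longrightarrow>
    good_environment \<tau> K (lev CARD('d) n) s (real_of_int (4 * int (rad CARD('d) n) + 1) ^ CARD('d) * (K + s))
      (int (rad CARD('d) n)) (int (n\<^sup>2)) (ray_point \<xi> t)"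
proof -
  have gap: "4 * r < a" if "4 * (l + 1) \<le> q" "q - 1 \<le> a" "r \<le> l" for l q a r :: real
    using that by (simp add: distrib_left)
  have "\<forall>\<^sub>F n in sequentially. 4 * CARD('d) * (lev CARD('d) n + 1) \<le> n" by (rule eventually_lev_linear) simp
  then show ?thesis using eventually_good_environment[OF dim K s] eventually_ge_at_top[of 1]
  proof eventually_elim
    case (elim n)
    show ?case
    proof (intro allI impI)
      fix \<tau> :: "(int ^ 'd) set \<Rightarrow> real" and t :: real
      assume \<tau>: "\<forall>e\<in>lattice_edges. 0 \<le> \<tau> e" "\<not> bad_at n \<tau>" and t: "real n \<le> t" "t \<le> 4 * real n"
      have "real_of_int (l1_dist 0 (ray_point \<xi> t)) \<le> CARD('d) * (t + 1)" using l1_ray_le[of t] t by simp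
      also have "\<dots> \<le> CARD('d) * (6 * real n)" using t elim(3) by (intro mult_left_mono) auto
      finally have 1: "real_of_int (l1_dist 0 (ray_point \<xi> t)) \<le> 6 * CARD('d) * real n" by simp
      obtain i where i: "t / CARD('d) - 1 \<le> \<bar>real_of_int (ray_point \<xi> t $ i)\<bar>"
        using ray_point_far[OF unit, of t] t by auto
      have "4 * (lev CARD('d) n + 1) \<le> n / CARD('d)" using elim(1) by (simp add: field_simps)
      also have "n / CARD('d) \<le> t / CARD('d)" using t by (simp add: divide_right_mono)
      finally have "4 * real (rad CARD('d) n) < \<bar>real_of_int (ray_point \<xi> t $ i)\<bar>"
        using gap[OF _ i rad_le_lev] by blast
      then show "good_environment \<tau> K (lev CARD('d) n) s (real_of_int (4 * int (rad CARD('d) n) + 1) ^ CARD('d) * (K + s))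
        (int (rad CARD('d) n)) (int (n\<^sup>2)) (ray_point \<xi> t)"
        using elim(2) \<tau> 1 unfolding bad_at_def by blast
    qed
  qed
qed

text \<open>Off the bad event \<open>trunc_level_irrelevant\<close> applies. On it the crude bound
  of order n is used, but its probability is at most 1/n^2, so it adds only a bounded multiple of
  \<open>M + s\<close>: this is the 2 next to \<open>4 * rad CARD('d) n\<close>.\<close>

lemma eventually_level_change:
  fixes s :: real
  assumes s: "0 < s"
  shows "\<forall>\<^sub>F n in sequentially. \<forall>M\<ge>0. mean_dist L M s (ray_point \<xi> n) \<le>
    scale_mean s n + CARD('d) * (M + s) * (4 * rad CARD('d) n + 2)"
  using eventually_environment[OF s] eventually_bad_event_small[OF K_tail] eventually_ge_at_top[of 1]
proof eventually_elim
  case (elim n)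
  let ?z = "ray_point \<xi> n" and ?M = "lev CARD('d) n" and ?r = "real (rad CARD('d) n)" and ?d = "real CARD('d)"
  interpret W: prob_space W by (rule prob_space_weights)
  let ?B = "bad_event L K (rad CARD('d) n) (int (n\<^sup>2) + int (rad CARD('d) n) + 1) :: ((int ^ 'd) set \<Rightarrow> real) set"
  have Bset[measurable]: "?B \<in> sets W" by (rule bad_event_bound(1)[OF K_tail])
  show ?case
  proof (intro allI impI)
    fix M :: real assume M: "0 \<le> M"
    have l1: "real_of_int (l1_dist 0 ?z) \<le> ?d * (n + 1)" using l1_ray_le[of n] by (simp add: add.commute)
    define c where "c = (M + s) * (?d * (n + 1))"
    have c: "0 \<le> c" unfolding c_def using M s by simp
    have pw: "walk_dist (trunc_weight \<tau> M s) 0 ?z \<le>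
      walk_dist (trunc_weight \<tau> ?M s) 0 ?z + 4 * ?d * (M + s) * ?r + c * indicator ?B \<tau>" if \<tau>: "\<tau> \<in> space W" for \<tau>
    proof (cases "\<tau> \<in> ?B")
      case True
      have "walk_dist (trunc_weight \<tau> M s) 0 ?z \<le> (M + s) * l1_dist 0 ?z" by (rule trunc_dist_bounds[OF \<tau> M s])
      also have "\<dots> \<le> c" unfolding c_def using l1 M s by (intro mult_left_mono) auto
      moreover have "0 \<le> walk_dist (trunc_weight \<tau> ?M s) 0 ?z" by (rule trunc_dist_bounds[OF \<tau> lev_nonneg s])
      moreover have "0 \<le> 4 * ?d * (M + s) * ?r" using M s by simp
      moreover have "c * indicator ?B \<tau> = c" using True by simp
      ultimately show ?thesis by linarith
    next
      case False
      then have "\<not> bad_at n \<tau>" using \<tau> by (simp add: bad_event_def bad_at_def)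
      then interpret E: good_environment \<tau> K ?M s "real_of_int (4 * int (rad CARD('d) n) + 1) ^ CARD('d) * (K + s)"
        "int (rad CARD('d) n)" "int (n\<^sup>2)" ?z
        using elim(1) weights_nonneg[OF \<tau>] by auto
      have "walk_dist (trunc_weight \<tau> M s) 0 ?z \<le> walk_dist (trunc_weight \<tau> ?M s) 0 ?z
          + 2 * ((M + s) * real_of_int (int (2 * CARD('d)) * int (rad CARD('d) n)))"
        by (rule E.trunc_level_irrelevant[OF M])
      then show ?thesis using False by (simp add: algebra_simps)
    qed
    have "mean_dist L M s ?z \<le> (\<integral>\<tau>. walk_dist (trunc_weight \<tau> ?M s) 0 ?z + 4 * ?d * (M + s) * ?r + c * indicator ?B \<tau> \<partial>W)"
      unfolding mean_dist_def
    proof (rule integral_mono)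
      show "integrable W (\<lambda>\<tau>. walk_dist (trunc_weight \<tau> ?M s) 0 ?z + 4 * ?d * (M + s) * ?r + c * indicator ?B \<tau>)"
        by (intro Bochner_Integration.integrable_add integrable_trunc_dist lev_nonneg s W.integrable_const
            Bochner_Integration.integrable_mult_right integrable_real_indicator Bset W.emeasure_finite) (simp add: less_top[symmetric])
      show "integrable W (\<lambda>\<tau>. walk_dist (trunc_weight \<tau> M s) 0 ?z)" by (rule integrable_trunc_dist[OF M s])
    qed (rule pw)
    also have "\<dots> = scale_mean s n + 4 * ?d * (M + s) * ?r + c * measure W ?B"
    proof -
      have i1: "integrable W (\<lambda>\<tau>. walk_dist (trunc_weight \<tau> ?M s) 0 ?z)" by (rule integrable_trunc_dist[OF lev_nonneg s])
      have i2: "integrable W (\<lambda>\<tau>. c * indicator ?B \<tau>)"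
        by (intro Bochner_Integration.integrable_mult_right integrable_real_indicator Bset) (simp add: less_top[symmetric])
      have "W.expectation (\<lambda>\<tau>. c * indicator ?B \<tau>) = c * measure W ?B"
        using sets.sets_into_space[OF Bset] by (simp add: Int_absorb2)
      then show ?thesis using i1 i2 by (simp add: scale_mean_def mean_dist_def W.prob_space)
    qed
    also have "c * measure W ?B \<le> c * (1 / (real n)\<^sup>2)" by (rule mult_left_mono[OF elim(2) c])
    also have "\<dots> = ?d * (M + s) * ((n + 1) / (real n)\<^sup>2)" by (simp add: c_def)
    also have "\<dots> \<le> ?d * (M + s) * 2"
    proof (rule mult_left_mono)
      have "1 \<le> real n" using elim(3) by simp
      then have "real n \<le> (real n)\<^sup>2" by (intro self_le_power) auto
      then have "real n + 1 \<le> 2 * (real n)\<^sup>2" using \<open>1 \<le> real n\<close> by linarith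
      then show "real (n + 1) / (real n)\<^sup>2 \<le> 2" using elim(3) by (simp add: divide_le_eq)
    qed (use M s in simp)
    finally show "mean_dist L M s ?z \<le> scale_mean s n + ?d * (M + s) * (4 * rad CARD('d) n + 2)"
      by (simp add: algebra_simps)
  qed
qed

lemma rad_mono: "a \<le> b \<Longrightarrow> rad d a \<le> rad d b"
  unfolding rad_def by (rule nth_root_nat_mono)

text \<open>The triangle inequality holds at a fixed level, whereas \<open>scale_mean\<close>
  changes its level with \<open>n\<close>. Moving the summands to the level of \<open>a + b\<close>
  costs order level times radius, hence at most order level squared, and that is at most
  \<open>sqrt (a + b)\<close>.\<close>

lemma scale_mean_converges:
  assumes s: "0 < s" shows "\<exists>l. (\<lambda>n. scale_mean s n / n) \<longlonglongrightarrow> l"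
proof -
  let ?d = "real CARD('d)" and ?M = "lev CARD('d)"
  have "\<forall>\<^sub>F n in sequentially. 1 \<le> ?M n \<and> (\<forall>M\<ge>0. mean_dist L M s (ray_point \<xi> n) \<le>
      scale_mean s n + ?d * (M + s) * (4 * rad CARD('d) n + 2))"
    using eventually_level_change[OF s] eventually_lev_ge[of 1] by eventually_elim auto
  then obtain N where N: "\<And>n. N \<le> n \<Longrightarrow> 1 \<le> ?M n"
    "\<And>n M. N \<le> n \<Longrightarrow> 0 \<le> M \<Longrightarrow> mean_dist L M s (ray_point \<xi> n) \<le> scale_mean s n + ?d * (M + s) * (4 * rad CARD('d) n + 2)"
    unfolding eventually_sequentially by blast
  define N0 where "N0 = max 1 N"
  \<comment> \<open>13 = 6 + 6 + 1: two changes of level and one rounding error.\<close>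
  define C where "C = 13 * ?d * (1 + s)"
  have step: "mean_dist L (?M (a + b)) s (ray_point \<xi> a) \<le> scale_mean s a + 6 * ?d * (1 + s) * sqrt (a + b)"
    and lin: "(?M (a + b) + s) \<le> (1 + s) * sqrt (a + b)" if a: "N0 \<le> a" for a b
  proof -
    let ?m = "?M (a + b)"
    have m1: "1 \<le> ?m" using N(1)[of "a + b"] a by (simp add: N0_def)
    have mm: "?m \<le> ?m\<^sup>2" using m1 by (simp add: power2_eq_square)
    have sq: "?m\<^sup>2 \<le> sqrt (a + b)" using lev_square_le[of "CARD('d)" "a + b"] by simp
    have ms: "?m + s \<le> (1 + s) * ?m" using m1 s by (simp add: algebra_simps)
    have "rad CARD('d) a \<le> rad CARD('d) (a + b)" by (rule rad_mono) simp
    then have "real (rad CARD('d) a) \<le> ?m" using rad_le_lev[of "CARD('d)" "a + b"] by linarith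
    then have "4 * real (rad CARD('d) a) + 2 \<le> 6 * ?m" using m1 by linarith
    then have "(?m + s) * (4 * real (rad CARD('d) a) + 2) \<le> ((1 + s) * ?m) * (6 * ?m)"
      using ms s m1 by (intro mult_mono) auto
    also have "\<dots> = 6 * (1 + s) * ?m\<^sup>2" by (simp add: power2_eq_square)
    also have "\<dots> \<le> 6 * (1 + s) * sqrt (a + b)" using sq s by (intro mult_left_mono) auto
    finally have "?d * ((?m + s) * (4 * real (rad CARD('d) a) + 2)) \<le> ?d * (6 * (1 + s) * sqrt (a + b))"
      by (intro mult_left_mono) auto
    then show "mean_dist L ?m s (ray_point \<xi> a) \<le> scale_mean s a + 6 * ?d * (1 + s) * sqrt (a + b)"
      using N(2)[of a ?m] a lev_nonneg by (simp add: N0_def algebra_simps)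
    show "?m + s \<le> (1 + s) * sqrt (a + b)"
      using ms mult_left_mono[of ?m "sqrt (a + b)" "1 + s"] mm sq s by linarith
  qed
  show ?thesis
  proof (rule nearly_subadditive_converges)
    show "0 \<le> scale_mean s n" for n unfolding scale_mean_def by (rule mean_dist_nonneg[OF lev_nonneg s])
    show "0 \<le> C" using s by (simp add: C_def)
    show "1 \<le> N0" by (simp add: N0_def)
  next
    fix a b assume ab: "N0 \<le> a" "N0 \<le> b"
    let ?m = "?M (a + b)" and ?z = "\<lambda>n::nat. ray_point \<xi> n"
    have "scale_mean s (a + b) \<le> mean_dist L ?m s (?z a) + mean_dist L ?m s (?z (a + b) - ?z a)"
      unfolding scale_mean_def by (rule mean_dist_triangle[OF lev_nonneg s])
    \<comment> \<open>The increment is not \<open>?z b\<close> itself; the rounding remainder has l1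
      size at most \<open>?d\<close>.\<close>
    also have "mean_dist L ?m s (?z (a + b) - ?z a) \<le> mean_dist L ?m s (?z b) + mean_dist L ?m s (?z (a + b) - ?z a - ?z b)"
      by (rule mean_dist_triangle[OF lev_nonneg s])
    also have "mean_dist L ?m s (?z (a + b) - ?z a - ?z b) \<le> (?m + s) * l1_dist (?z (a + b) - ?z a) (?z b)"
      by (rule order_trans[OF mean_dist_le[OF lev_nonneg s]]) (simp add: l1_minus)
    also have "\<dots> \<le> (?m + s) * ?d"
    proof (rule mult_left_mono)
      have "l1_dist (?z (a + b) - ?z a) (?z b) \<le> int CARD('d)" using l1_ray_point_add[of \<xi> "real a" "real b"] by simp
      then show "real_of_int (l1_dist (?z (a + b) - ?z a) (?z b)) \<le> ?d" by linarith
    qed (use lev_nonneg[of "CARD('d)" "a + b"] s in simp)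
    also have "\<dots> \<le> ?d * ((1 + s) * sqrt (a + b))" using mult_left_mono[OF lin[OF ab(1), of b], of ?d] by (simp add: mult.commute)
    finally show "scale_mean s (a + b) \<le> scale_mean s a + scale_mean s b + C * sqrt (a + b)"
      using step[OF ab(1), of b] step[OF ab(2), of a] by (simp add: C_def algebra_simps add.commute[of b a])
  next
    fix a b assume a: "N0 \<le> a"
    let ?m = "?M (a + b)" and ?z = "\<lambda>n::nat. ray_point \<xi> n"
    have "scale_mean s (a + b) \<le> mean_dist L ?m s (?z a) + mean_dist L ?m s (?z (a + b) - ?z a)"
      unfolding scale_mean_def by (rule mean_dist_triangle[OF lev_nonneg s])
    also have "mean_dist L ?m s (?z (a + b) - ?z a) \<le> (?m + s) * l1_dist (?z (a + b)) (?z a)"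
      by (rule order_trans[OF mean_dist_le[OF lev_nonneg s]]) (simp add: l1_minus)
    also have "\<dots> \<le> ((1 + s) * sqrt (a + b)) * (?d * (b + 1))"
    proof (rule mult_mono)
      show "real_of_int (l1_dist (?z (a + b)) (?z a)) \<le> ?d * (b + 1)"
        using l1_ray_point_le[OF unit, of "real (a + b)" "real a"] by (simp add: add.commute)
    qed (use lin[OF a, of b] l1_nonneg[of "?z (a + b)" "?z a"] s in auto)
    also have "mean_dist L ?m s (?z a) \<le> scale_mean s a + 6 * ?d * (1 + s) * sqrt (a + b)" by (rule step[OF a])
    finally have "scale_mean s (a + b) \<le> scale_mean s a + (6 + (real b + 1)) * (?d * (1 + s) * sqrt (a + b))"
      by (simp add: algebra_simps)
    also have "(6 + (real b + 1)) * (?d * (1 + s) * sqrt (a + b)) \<le> (13 * (real b + 1)) * (?d * (1 + s) * sqrt (a + b))"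
      using s by (intro mult_right_mono) auto
    finally show "scale_mean s (a + b) \<le> scale_mean s a + C * (b + 1) * sqrt (a + b)"
      by (simp add: C_def mult_ac add.commute)
  qed
qed

definition time_const :: "real \<Rightarrow> real" where
  "time_const s = lim (\<lambda>n. scale_mean s n / n)"

lemma scale_mean_tendsto: "0 < s \<Longrightarrow> (\<lambda>n. scale_mean s n / n) \<longlonglongrightarrow> time_const s"
  unfolding time_const_def using scale_mean_converges convergent_LIMSEQ_iff convergent_def by blast

lemma time_const_concave:
  assumes "0 < x" "x < y" "y < z"
  shows "(z - y) * time_const x + (y - x) * time_const z \<le> (z - x) * time_const y"
proof (rule LIMSEQ_le)
  show "(\<lambda>n. (z - y) * (scale_mean x n / n) + (y - x) * (scale_mean z n / n)) \<longlonglongrightarrow> (z - y) * time_const x + (y - x) * time_const z"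
    using assms by (intro tendsto_intros scale_mean_tendsto) auto
  show "(\<lambda>n. (z - x) * (scale_mean y n / n)) \<longlonglongrightarrow> (z - x) * time_const y"
    using assms by (intro tendsto_intros scale_mean_tendsto) auto
  have "(z - y) * scale_mean x n + (y - x) * scale_mean z n \<le> (z - x) * scale_mean y n" for n
  proof -
    let ?D = "\<lambda>s \<tau>. walk_dist (trunc_weight \<tau> (lev CARD('d) n) s) 0 (ray_point \<xi> n)"
    have i: "integrable W (?D s)" if "0 < s" for s by (rule integrable_trunc_dist[OF lev_nonneg that])
    have "(\<integral>\<tau>. (z - y) * ?D x \<tau> + (y - x) * ?D z \<tau> \<partial>W) \<le> (\<integral>\<tau>. (z - x) * ?D y \<tau> \<partial>W)"
    proof (rule integral_mono)
      fix \<tau> assume "\<tau> \<in> space W"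
      then show "(z - y) * ?D x \<tau> + (y - x) * ?D z \<tau> \<le> (z - x) * ?D y \<tau>"
        using assms weights_nonneg by (intro walk_dist_concave lev_nonneg) auto
    qed (use assms i in auto)
    then show ?thesis using assms i[of x] i[of y] i[of z] by (simp add: scale_mean_def mean_dist_def)
  qed
  then have "((z - y) * scale_mean x n + (y - x) * scale_mean z n) / n \<le> ((z - x) * scale_mean y n) / n" for n
    by (rule divide_right_mono) simp
  then show "\<exists>N. \<forall>n\<ge>N. (z - y) * (scale_mean x n / n) + (y - x) * (scale_mean z n / n) \<le> (z - x) * (scale_mean y n / n)"
    by (simp add: add_divide_distrib)
qed

subsection \<open>Almost sure convergence along the squares\<close>

text \<open>Not divided by the distance: the name refers to the truncation at the scale of the
  target.\<close>

definition scaled_time :: "real \<Rightarrow> nat \<Rightarrow> ((int ^ 'd) set \<Rightarrow> real) \<Rightarrow> real" where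
  "scaled_time s k \<tau> = walk_dist (trunc_weight \<tau> (lev CARD('d) (k\<^sup>2)) s) 0 (ray_point \<xi> (real (k\<^sup>2)))"

lemma summable_sqrt_over_square: "summable (\<lambda>k. c * (sqrt k / (real k)\<^sup>2))"
proof -
  have "sqrt k / (real k)\<^sup>2 = real k powr (- 3 / 2)" for k :: nat
  proof (cases "k = 0")
    case False
    then have "sqrt k / (real k)\<^sup>2 = real k powr (1 / 2) / real k powr 2" by (simp add: powr_half_sqrt)
    also have "\<dots> = real k powr (1 / 2 - 2)" by (rule powr_diff[symmetric])
    finally show ?thesis by simp
  qed simp
  moreover have "summable (\<lambda>k. real k powr (- 3 / 2))" by (simp add: summable_real_powr_iff)
  ultimately show ?thesis by (intro summable_mult) simp
qed

text \<open>Chebyshev's inequality, with a variance of order distance times the third power of the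
  level. At distance k^2 this leaves order k^(-3/2), which is summable.\<close>

lemma deviation_bound:
  fixes s \<epsilon> :: real
  assumes s: "0 < s" and \<epsilon>: "0 < \<epsilon>" and k: "1 \<le> k"
  shows "measure W {\<tau> \<in> space W. \<epsilon> * (real k)\<^sup>2 \<le> \<bar>scaled_time s k \<tau> - scale_mean s (k\<^sup>2)\<bar>} \<le>
    2 * CARD('d) * (1 + s) / (s * \<epsilon>\<^sup>2) * (sqrt k / (real k)\<^sup>2)"
proof -
  interpret W: prob_space W by (rule prob_space_weights)
  let ?M = "lev CARD('d) (k\<^sup>2)" and ?d = "real CARD('d)" and ?z = "ray_point \<xi> (real (k\<^sup>2))"
  have m[measurable]: "scaled_time s k \<in> borel_measurable W" unfolding scaled_time_def by measurable
  have sq: "integrable W (\<lambda>\<tau>. (scaled_time s k \<tau>)\<^sup>2)"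
    by (rule W.integrable_bounded[of _ "((?M + s) * l1_dist 0 ?z)\<^sup>2"])
      (use trunc_dist_bounds[OF _ lev_nonneg s, where u = 0 and v = ?z] in \<open>auto simp: scaled_time_def intro!: power_mono\<close>)
  have ex: "W.expectation (scaled_time s k) = scale_mean s (k\<^sup>2)"
    unfolding scale_mean_def mean_dist_def by (rule Bochner_Integration.integral_cong) (simp_all add: scaled_time_def)
  have "W.variance (scaled_time s k) \<le> ?M\<^sup>2 * ((?M + s) * l1_dist 0 ?z / s)"
    unfolding scaled_time_def by (rule variance_walk_dist[OF lev_nonneg s])
  also have "\<dots> \<le> ?M\<^sup>2 * ((?M + s) * (?d * (2 * (real k)\<^sup>2)) / s)"
  proof -
    have "1 \<le> (real k)\<^sup>2" using k by (intro one_le_power) simp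
    then have "real_of_int (l1_dist 0 ?z) \<le> ?d * (2 * (real k)\<^sup>2)"
      using l1_ray_le[of "real (k\<^sup>2)"] by (intro order_trans[OF l1_ray_le] mult_left_mono) auto
    then show ?thesis using s lev_nonneg[of "CARD('d)" "k\<^sup>2"]
      by (intro mult_left_mono divide_right_mono) auto
  qed
  also have "\<dots> = (?M ^ 3 + s * ?M\<^sup>2) * (2 * ?d * (real k)\<^sup>2 / s)"
    by (simp add: power2_eq_square power3_eq_cube algebra_simps add_divide_distrib)
  also have "\<dots> \<le> ((1 + s) * sqrt k) * (2 * ?d * (real k)\<^sup>2 / s)"
  proof (rule mult_right_mono)
    \<comment> \<open>The route to \<open>?M ^ 3 \<le> sqrt k\<close> is to take square roots twice,
      starting from the twelfth power, which is at most \<open>k\<^sup>2\<close>.\<close>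
    have "?M ^ 6 \<le> k"
      by (rule power2_le_imp_le) (use lev_pow_le[of 12 "CARD('d)" "k\<^sup>2"] in \<open>simp_all add: power_mult[symmetric]\<close>)
    moreover have "?M ^ 4 \<le> k"
      by (rule power2_le_imp_le) (use lev_pow_le[of 8 "CARD('d)" "k\<^sup>2"] in \<open>simp_all add: power_mult[symmetric]\<close>)
    ultimately have "(?M ^ 3)\<^sup>2 \<le> k" "(?M\<^sup>2)\<^sup>2 \<le> k" by (simp_all add: power_mult[symmetric])
    then have "?M ^ 3 \<le> sqrt k" "?M\<^sup>2 \<le> sqrt k" by (auto intro: real_le_rsqrt)
    then have "?M ^ 3 + s * ?M\<^sup>2 \<le> sqrt k + s * sqrt k" using s by (intro add_mono mult_left_mono) auto
    then show "?M ^ 3 + s * ?M\<^sup>2 \<le> (1 + s) * sqrt k" by (simp add: algebra_simps)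
  qed (use s in simp)
  finally have var: "W.variance (scaled_time s k) \<le> ((1 + s) * sqrt k) * (2 * ?d * (real k)\<^sup>2 / s)" .
  have a: "0 < \<epsilon> * (real k)\<^sup>2" using \<epsilon> k by simp
  have "measure W {\<tau> \<in> space W. \<epsilon> * (real k)\<^sup>2 \<le> \<bar>scaled_time s k \<tau> - scale_mean s (k\<^sup>2)\<bar>} \<le>
      W.variance (scaled_time s k) / (\<epsilon> * (real k)\<^sup>2)\<^sup>2"
    using W.Chebyshev_inequality[OF m sq a] unfolding ex .
  also have "\<dots> \<le> ((1 + s) * sqrt k) * (2 * ?d * (real k)\<^sup>2 / s) / (\<epsilon> * (real k)\<^sup>2)\<^sup>2"
    by (rule divide_right_mono[OF var]) simp
  also have "\<dots> = 2 * CARD('d) * (1 + s) / (s * \<epsilon>\<^sup>2) * (sqrt k / (real k)\<^sup>2)"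
  proof -
    have "(u * r) * (v * q / s) / (\<epsilon> * q)\<^sup>2 = v * u / (s * \<epsilon>\<^sup>2) * (r / q)" if "q \<noteq> 0" for u r v q :: real
      using that s \<epsilon> by (simp add: power2_eq_square field_simps)
    then show ?thesis using k by simp
  qed
  finally show ?thesis .
qed

lemma AE_scaled_time:
  fixes s :: real
  assumes s: "0 < s"
  shows "AE \<tau> in W. (\<lambda>k. scaled_time s k \<tau> / (real k)\<^sup>2) \<longlonglongrightarrow> time_const s"
proof -
  interpret W: prob_space W by (rule prob_space_weights)
  have [measurable]: "scaled_time s k \<in> borel_measurable W" for k unfolding scaled_time_def by measurable
  let ?A = "\<lambda>\<epsilon> k. {\<tau> \<in> space W. \<epsilon> * (real k)\<^sup>2 \<le> \<bar>scaled_time s k \<tau> - scale_mean s (k\<^sup>2)\<bar>}"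
  have BC: "AE \<tau> in W. \<forall>\<^sub>F k in sequentially. \<tau> \<in> space W - ?A \<epsilon> k" if \<epsilon>: "0 < \<epsilon>" for \<epsilon> :: real
  proof (rule borel_cantelli_AE1)
    show "summable (\<lambda>k. measure W (?A \<epsilon> k))"
    proof (rule summable_comparison_test'[OF summable_sqrt_over_square, of 1])
      show "norm (measure W (?A \<epsilon> k)) \<le> 2 * CARD('d) * (1 + s) / (s * \<epsilon>\<^sup>2) * (sqrt k / (real k)\<^sup>2)" if "1 \<le> k" for k
        using deviation_bound[OF s \<epsilon> that] by simp
    qed
  qed (auto simp: less_top[symmetric])
  have "AE \<tau> in W. \<forall>\<^sub>F k in sequentially. \<tau> \<in> space W - ?A (1 / real (Suc j)) k" for j by (rule BC) simp
  then have "AE \<tau> in W. \<forall>j::nat. \<forall>\<^sub>F k in sequentially. \<tau> \<in> space W - ?A (1 / real (Suc j)) k"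
    by (intro AE_all_countable[THEN iffD2] allI)
  then show ?thesis
  proof (rule AE_mp, intro AE_I2 impI)
    fix \<tau> assume ev: "\<forall>j::nat. \<forall>\<^sub>F k in sequentially. \<tau> \<in> space W - ?A (1 / real (Suc j)) k"
    have "(\<lambda>k. (scaled_time s k \<tau> - scale_mean s (k\<^sup>2)) / (real k)\<^sup>2) \<longlonglongrightarrow> 0"
    proof (rule tendstoI)
      fix \<epsilon> :: real assume "0 < \<epsilon>"
      then obtain j where j: "1 / real (Suc j) < \<epsilon>" using reals_Archimedean[of \<epsilon>] by (auto simp: inverse_eq_divide)
      have "\<forall>\<^sub>F k in sequentially. \<tau> \<in> space W - ?A (1 / real (Suc j)) k" using ev by blast
      then show "\<forall>\<^sub>F k in sequentially. dist ((scaled_time s k \<tau> - scale_mean s (k\<^sup>2)) / (real k)\<^sup>2) 0 < \<epsilon>"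
        using eventually_ge_at_top[of 1]
      proof eventually_elim
        case (elim k)
        have k: "0 < (real k)\<^sup>2" using elim(2) by simp
        have "\<bar>scaled_time s k \<tau> - scale_mean s (k\<^sup>2)\<bar> < 1 / real (Suc j) * (real k)\<^sup>2" using elim(1) by auto
        also have "\<dots> < \<epsilon> * (real k)\<^sup>2" using j k by (rule mult_strict_right_mono)
        finally show ?case using k by (simp add: dist_norm pos_divide_less_eq)
      qed
    qed
    moreover have "(\<lambda>k. scale_mean s (k\<^sup>2) / real (k\<^sup>2)) \<longlonglongrightarrow> time_const s"
    proof (rule filterlim_compose[OF scale_mean_tendsto[OF s]])
      show "filterlim (\<lambda>k::nat. k\<^sup>2) at_top sequentially"
        by (rule filterlim_at_top_mono[OF filterlim_ident]) (auto simp: power2_nat_le_imp_le power2_eq_square)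
    qed
    ultimately have "(\<lambda>k. (scaled_time s k \<tau> - scale_mean s (k\<^sup>2)) / (real k)\<^sup>2 + scale_mean s (k\<^sup>2) / real (k\<^sup>2)) \<longlonglongrightarrow> 0 + time_const s"
      by (rule tendsto_add)
    then show "(\<lambda>k. scaled_time s k \<tau> / (real k)\<^sup>2) \<longlonglongrightarrow> time_const s" by (simp add: diff_divide_distrib)
  qed
qed

lemma AE_not_bad: "AE \<tau> in W. \<forall>\<^sub>F k in sequentially. \<not> bad_at (k\<^sup>2) \<tau>"
proof -
  interpret W: prob_space W by (rule prob_space_weights)
  let ?B = "\<lambda>n. bad_event L K (rad CARD('d) n) (int (n\<^sup>2) + int (rad CARD('d) n) + 1) :: ((int ^ 'd) set \<Rightarrow> real) set"
  have "filterlim (\<lambda>k::nat. k\<^sup>2) at_top sequentially"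
    by (rule filterlim_at_top_mono[OF filterlim_ident]) (auto simp: power2_nat_le_imp_le power2_eq_square)
  then have ev: "\<forall>\<^sub>F k in sequentially. measure W (?B (k\<^sup>2)) \<le> 1 / (real (k\<^sup>2))\<^sup>2"
    by (rule eventually_compose_filterlim[OF eventually_bad_event_small[OF K_tail]])
  have "AE \<tau> in W. \<forall>\<^sub>F k in sequentially. \<tau> \<in> space W - ?B (k\<^sup>2)"
  proof (rule borel_cantelli_AE1)
    show "?B (k\<^sup>2) \<in> sets W" for k by (rule bad_event_bound(1)[OF K_tail])
    show "summable (\<lambda>k. measure W (?B (k\<^sup>2)))"
    proof (rule summable_comparison_test_ev)
      show "summable (\<lambda>k. 1 / (real k)\<^sup>2)" using inverse_power_summable[of 2, where 'a = real] by (simp add: inverse_eq_divide)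
      show "\<forall>\<^sub>F k in sequentially. norm (measure W (?B (k\<^sup>2))) \<le> 1 / (real k)\<^sup>2"
        using ev eventually_ge_at_top[of 1]
      proof eventually_elim
        case (elim k)
        have "(real k)\<^sup>2 \<le> (real (k\<^sup>2))\<^sup>2" using elim(2) by (intro power_mono) (auto simp: power2_eq_square)
        then have "1 / (real (k\<^sup>2))\<^sup>2 \<le> 1 / (real k)\<^sup>2" using elim(2) by (intro divide_left_mono) auto
        then show ?case using elim(1) by simp
      qed
    qed
  qed (auto simp: less_top[symmetric])
  then show ?thesis
    by (rule AE_mp, intro AE_I2 impI) (auto elim!: eventually_mono simp: bad_event_def bad_at_def)
qed

end

subsection \<open>Lengths of geodesics\<close>

lemma walk_dist_cong:
  assumes "\<And>e. e \<in> lattice_edges \<Longrightarrow> w e = w' e" shows "walk_dist w u v = walk_dist w' u v"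
  unfolding walk_dist_def
proof (rule INF_cong[OF refl])
  fix p assume "p \<in> {p. walk p u v}"
  then have "edges_of_walk p \<subseteq> lattice_edges" using walk_edges_lattice by blast
  then show "sum w (edges_of_walk p) = sum w' (edges_of_walk p)" using assms by (intro sum.cong) auto
qed

context ray_model
begin

text \<open>All the randomness behind geodesic lengths. Its consequences hold for every choice of
  geodesics and all real distances at once, so a single null set is enough.\<close>

definition good_weights :: "real set \<Rightarrow> ((int ^ 'd) set \<Rightarrow> real) \<Rightarrow> bool" where
  "good_weights S \<tau> \<longleftrightarrow> (\<forall>\<^sub>F k in sequentially. \<not> bad_at (k\<^sup>2) \<tau>) \<and>
    (\<forall>s\<in>S. (\<lambda>k. scaled_time s k \<tau> / (real k)\<^sup>2) \<longlonglongrightarrow> time_const s)"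

lemma AE_good_weights:
  assumes "countable S" "S \<subseteq> {0<..}" shows "AE \<tau> in W. good_weights S \<tau>"
proof -
  have "AE \<tau> in W. \<forall>s\<in>S. (\<lambda>k. scaled_time s k \<tau> / (real k)\<^sup>2) \<longlonglongrightarrow> time_const s"
    by (rule AE_ball_countable'[OF AE_scaled_time assms(1)]) (use assms(2) in auto)
  then show ?thesis using AE_not_bad by eventually_elim (simp add: good_weights_def)
qed

text \<open>Three sources: the detours along the two shells; the two end pieces, inside cubes of
  radius at most \<open>2 * M\<close>; and the move from distance t back to k^2, made once for the
  shift \<open>s\<close> and once for \<open>h\<close>.\<close>

definition slope_error :: "real \<Rightarrow> real \<Rightarrow> nat \<Rightarrow> real" where
  "slope_error h s k = (let M = lev CARD('d) (k\<^sup>2); d = real CARD('d) in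
     2 * M + 4 * d * ((M + s) * M) + d * ((2 * M + s + h) * (2 * real k + 2)))"

lemma lev_over_k: "(\<lambda>k. lev CARD('d) (k\<^sup>2) / k) \<longlonglongrightarrow> 0"
proof (rule tendsto_sandwich)
  show "\<forall>\<^sub>F k in sequentially. 0 \<le> lev CARD('d) (k\<^sup>2) / k" using lev_nonneg by auto
  show "\<forall>\<^sub>F k in sequentially. lev CARD('d) (k\<^sup>2) / k \<le> 1 / sqrt k"
    using eventually_ge_at_top[of 1]
  proof eventually_elim
    case (elim k)
    have "(lev CARD('d) (k\<^sup>2))\<^sup>2 \<le> k" using lev_square_le[of "CARD('d)" "k\<^sup>2"] by simp
    then have "lev CARD('d) (k\<^sup>2) \<le> sqrt k" by (rule real_le_rsqrt)
    then have "lev CARD('d) (k\<^sup>2) / k \<le> sqrt k / k" by (rule divide_right_mono) simp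
    also have "sqrt k / k = 1 / sqrt k" using elim by (simp add: field_simps)
    finally show ?case .
  qed
  show "(\<lambda>k::nat. 1 / sqrt k) \<longlonglongrightarrow> 0"
    by (intro tendsto_divide_0[OF tendsto_const] filterlim_at_top_imp_at_infinity
        filterlim_compose[OF sqrt_at_top] filterlim_real_sequentially)
qed simp

lemma slope_error_tendsto: "(\<lambda>k. slope_error h s k / (real k)\<^sup>2) \<longlonglongrightarrow> 0"
proof -
  let ?d = "real CARD('d)"
  let ?a = "\<lambda>k. lev CARD('d) (k\<^sup>2) / real k" and ?b = "\<lambda>k. 1 / real k"
  have b: "?b \<longlonglongrightarrow> 0" by (rule lim_1_over_n)
  have "(\<lambda>k. 2 * ?a k * ?b k + 4 * ?d * ((?a k + s * ?b k) * ?a k) + ?d * ((2 * ?a k + (s + h) * ?b k) * (2 + 2 * ?b k))) \<longlonglongrightarrow>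
      2 * 0 * 0 + 4 * ?d * ((0 + s * 0) * 0) + ?d * ((2 * 0 + (s + h) * 0) * (2 + 2 * 0))"
    by (intro tendsto_intros lev_over_k b)
  moreover have "slope_error h s k / (real k)\<^sup>2 =
      2 * ?a k * ?b k + 4 * ?d * ((?a k + s * ?b k) * ?a k) + ?d * ((2 * ?a k + (s + h) * ?b k) * (2 + 2 * ?b k))" for k
  proof (cases "k = 0")
    case False
    then show ?thesis by (simp add: slope_error_def Let_def field_simps power2_eq_square)
  qed simp
  ultimately show ?thesis by simp
qed

lemma scaled_time_near:
  assumes \<tau>: "\<And>e. e \<in> lattice_edges \<Longrightarrow> 0 \<le> \<tau> e" and s: "0 < s"
    and t: "(real k)\<^sup>2 \<le> t" "t \<le> (real k + 1)\<^sup>2"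
  shows "\<bar>walk_dist (trunc_weight \<tau> (lev CARD('d) (k\<^sup>2)) s) 0 (ray_point \<xi> t) - scaled_time s k \<tau>\<bar> \<le>
    (lev CARD('d) (k\<^sup>2) + s) * (CARD('d) * (2 * real k + 2))"
proof -
  let ?M = "lev CARD('d) (k\<^sup>2)"
  let ?w = "trunc_weight \<tau> ?M s" and ?y = "ray_point \<xi> (real (k\<^sup>2))" and ?z = "ray_point \<xi> t"
  have w: "0 \<le> ?w e \<and> ?w e \<le> ?M + s" if "e \<in> lattice_edges" for e
    using \<tau>[OF that] lev_nonneg[of "CARD('d)" "k\<^sup>2"] s by (simp add: trunc_weight_def)
  have "real_of_int (l1_dist ?z ?y) \<le> CARD('d) * (\<bar>t - real (k\<^sup>2)\<bar> + 1)" by (rule l1_ray_point_le[OF unit])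
  \<comment> \<open>Consecutive squares differ by 2k + 1, and rounding to the lattice adds
    1.\<close>
  also have "\<dots> \<le> CARD('d) * (2 * real k + 2)"
    using t by (intro mult_left_mono) (auto simp: power2_eq_square algebra_simps)
  finally have l: "real_of_int (l1_dist ?z ?y) \<le> CARD('d) * (2 * real k + 2)" .
  have "walk_dist ?w ?z ?y \<le> (?M + s) * l1_dist ?z ?y"
    by (rule walk_dist_le_l1[OF w]) (use lev_nonneg[of "CARD('d)" "k\<^sup>2"] s in auto)
  also have "\<dots> \<le> (?M + s) * (CARD('d) * (2 * real k + 2))"
    using l lev_nonneg[of "CARD('d)" "k\<^sup>2"] s by (intro mult_left_mono) auto
  finally have zy: "walk_dist ?w ?z ?y \<le> (?M + s) * (CARD('d) * (2 * real k + 2))" .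
  have "walk_dist ?w 0 ?z \<le> walk_dist ?w 0 ?y + walk_dist ?w ?y ?z"
    "walk_dist ?w 0 ?y \<le> walk_dist ?w 0 ?z + walk_dist ?w ?z ?y"
    by (rule walk_dist_triangle; use w in blast)+
  then show ?thesis using zy unfolding scaled_time_def walk_dist_commute[of ?w ?y ?z] by linarith
qed

text \<open>Transfers \<open>length_vs_derivative\<close> from an endpoint at distance t to the
  passage times at k^2, which are those known to converge. The same \<open>m\<close> serves all
  \<open>s\<close>: shifts above \<open>h\<close> bound it from below, shifts below \<open>h\<close>
  from above.\<close>

lemma eventually_length_bounds:
  fixes h :: real and \<tau> x :: "(int ^ 'd) set \<Rightarrow> real"
  assumes h: "0 < h" and nn: "\<And>e. e \<in> lattice_edges \<Longrightarrow> 0 \<le> \<tau> e"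
    and x: "\<And>e. e \<in> lattice_edges \<Longrightarrow> x e = \<tau> e + h"
    and good: "\<forall>\<^sub>F k in sequentially. \<not> bad_at (k\<^sup>2) \<tau>"
  shows "\<forall>\<^sub>F k in sequentially. \<forall>t \<gamma>. (real k)\<^sup>2 \<le> t \<longrightarrow> t \<le> (real k + 1)\<^sup>2 \<longrightarrow> \<gamma> \<in> geodesics x 0 (t *\<^sub>R \<xi>) \<longrightarrow>
    (\<exists>m::nat. m \<le> pos_length x \<gamma> \<and> pos_length x \<gamma> \<le> m + 2 * lev CARD('d) (k\<^sup>2) \<and>
      (\<forall>s>0. scaled_time s k \<tau> - scaled_time h k \<tau> \<le> (s - h) * m + slope_error h s k))"
proof -
  have sq: "filterlim (\<lambda>k::nat. k\<^sup>2) at_top sequentially"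
    by (rule filterlim_at_top_mono[OF filterlim_ident]) (auto simp: power2_nat_le_imp_le power2_eq_square)
  show ?thesis
    using eventually_compose_filterlim[OF eventually_environment[OF h] sq] good eventually_ge_at_top[of 1]
      eventually_compose_filterlim[OF eventually_shell_cost[of "CARD('d)" 1] sq]
  proof eventually_elim
    case (elim k)
    let ?M = "lev CARD('d) (k\<^sup>2)" and ?d = "real CARD('d)" and ?r = "int (rad CARD('d) (k\<^sup>2))"
    show ?case
    proof (intro allI impI)
      fix t :: real and \<gamma> assume t: "(real k)\<^sup>2 \<le> t" "t \<le> (real k + 1)\<^sup>2" and \<gamma>: "\<gamma> \<in> geodesics x 0 (t *\<^sub>R \<xi>)"
      have "(real k + 1)\<^sup>2 \<le> (2 * real k)\<^sup>2" using elim(3) by (intro power_mono) auto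
      then have t4: "t \<le> 4 * real (k\<^sup>2)" using t(2) by simp
      let ?z = "ray_point \<xi> t"
      interpret E: good_environment \<tau> K ?M h "real_of_int (4 * ?r + 1) ^ CARD('d) * (K + h)" ?r "int ((k\<^sup>2)\<^sup>2)" ?z
        using elim(1,2) nn t(1) t4 by auto
      \<comment> \<open>Strict positivity, from \<open>h > 0\<close>, makes
        \<open>pos_length\<close> the full number of edges.\<close>
      have xpos: "0 < x e" if "e \<in> lattice_edges" for e using x[OF that] nn[OF that] h by simp
      obtain p where p: "\<gamma> = edges_of_walk p" "walk p 0 ?z" "distinct p" and cost: "path_time x \<gamma> = passage_time x 0 (t *\<^sub>R \<xi>)"
        using \<gamma> by (auto simp: geodesics_def paths_def walk_def ray_point_def int_point_def vec_eq_iff)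
      have lat: "edges_of_walk p \<subseteq> lattice_edges" by (rule walk_edges_lattice[OF p(2)])
      have "passage_time x 0 (t *\<^sub>R \<xi>) = walk_dist x 0 ?z"
        using walk_dist_eq_passage_time[of x 0 "t *\<^sub>R \<xi>"] xpos
        by (simp add: less_imp_le ray_point_def int_point_def vec_eq_iff zero_vec_def)
      also have "\<dots> = walk_dist (\<lambda>e. \<tau> e + h) 0 ?z" by (rule walk_dist_cong[OF x])
      finally have "sum x (edges_of_walk p) = walk_dist (\<lambda>e. \<tau> e + h) 0 ?z" using cost by (simp add: p(1) path_time_def)
      moreover have "sum x (edges_of_walk p) = (\<Sum>e\<in>edges_of_walk p. \<tau> e + h)" using lat x by (intro sum.cong) auto
      ultimately have geo: "(\<Sum>e\<in>edges_of_walk p. \<tau> e + h) = walk_dist (\<lambda>e. \<tau> e + h) 0 ?z" by simp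
      have len: "pos_length x \<gamma> = card (edges_of_walk p)"
      proof -
        have "{e \<in> \<gamma>. x e > 0} = edges_of_walk p" using lat xpos by (auto simp: p(1))
        then show ?thesis by (simp add: pos_length_def)
      qed
      obtain m :: nat where m: "m \<le> card (edges_of_walk p)"
        "int (card (edges_of_walk p)) \<le> int m + 2 * (4 * ?r + 1) ^ CARD('d)"
        "\<forall>s'>0. walk_dist (trunc_weight \<tau> ?M s') 0 ?z - walk_dist (trunc_weight \<tau> ?M h) 0 ?z \<le>
          (s' - h) * m + 2 * (real_of_int (4 * ?r + 1) ^ CARD('d) * (K + h)) + 2 * ((?M + s') * real_of_int (int (2 * CARD('d)) * ?r))"
        using E.length_vs_derivative[OF p(2,3) geo] by blast
      have "real_of_int (int (card (edges_of_walk p))) \<le> real_of_int (int m + 2 * (4 * ?r + 1) ^ CARD('d))"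
        using m(2) by (simp only: of_int_le_iff)
      then have m2: "real (card (edges_of_walk p)) \<le> m + 2 * ?M" using elim(4) by simp
      have sl: "scaled_time s k \<tau> - scaled_time h k \<tau> \<le> (s - h) * m + slope_error h s k" if s: "0 < s" for s
      proof -
        have "(?M + s) * real_of_int (int (2 * CARD('d)) * ?r) \<le> (?M + s) * (2 * ?d * ?M)"
          using rad_le_lev[of "CARD('d)" "k\<^sup>2"] lev_nonneg[of "CARD('d)" "k\<^sup>2"] s by (intro mult_left_mono) auto
        moreover have "\<bar>walk_dist (trunc_weight \<tau> ?M s) 0 ?z - scaled_time s k \<tau>\<bar> \<le> (?M + s) * (?d * (2 * real k + 2))"
          "\<bar>walk_dist (trunc_weight \<tau> ?M h) 0 ?z - scaled_time h k \<tau>\<bar> \<le> (?M + h) * (?d * (2 * real k + 2))"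
          by (rule scaled_time_near[OF nn _ t]; use s h in simp)+
        moreover have "walk_dist (trunc_weight \<tau> ?M s) 0 ?z - walk_dist (trunc_weight \<tau> ?M h) 0 ?z \<le>
          (s - h) * m + 2 * (real_of_int (4 * ?r + 1) ^ CARD('d) * (K + h)) + 2 * ((?M + s) * real_of_int (int (2 * CARD('d)) * ?r))"
          using m(3) s by blast
        moreover have "slope_error h s k = 2 * ?M + 2 * ((?M + s) * (2 * ?d * ?M)) + (?M + s) * (?d * (2 * real k + 2)) + (?M + h) * (?d * (2 * real k + 2))"
          by (simp add: slope_error_def Let_def algebra_simps)
        ultimately show ?thesis using E.M by linarith
      qed
      show "\<exists>m::nat. m \<le> pos_length x \<gamma> \<and> pos_length x \<gamma> \<le> m + 2 * ?M \<and>
        (\<forall>s>0. scaled_time s k \<tau> - scaled_time h k \<tau> \<le> (s - h) * m + slope_error h s k)"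
        unfolding len using m(1) m2 sl by (intro exI[of _ m]) auto
    qed
  qed
qed

text \<open>Countable, so that one null set serves all these shifts, and accumulating at
  \<open>h\<close> from both sides. The offset 2 keeps \<open>h - h / (j + 2)\<close>
  positive.\<close>

definition nearby :: "real \<Rightarrow> real set" where
  "nearby h = insert h (range (\<lambda>j::nat. h + h / (j + 2)) \<union> range (\<lambda>j::nat. h - h / (j + 2)))"

lemma nearby_countable: "countable (nearby h)"
  by (simp add: nearby_def)

lemma nearby_pos: "0 < h \<Longrightarrow> nearby h \<subseteq> {0<..}"
proof -
  assume h: "0 < h"
  have "0 < h + h / (real j + 2)" "h / (real j + 2) < h" for j :: nat
    using h by (simp_all add: add_pos_pos divide_less_eq)
  then show ?thesis using h by (auto simp: nearby_def)
qed

lemma floor_sqrt_at_top: "filterlim (\<lambda>t. nat \<lfloor>sqrt t\<rfloor>) sequentially at_top"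
  by (rule filterlim_compose[OF filterlim_nat_sequentially filterlim_compose[OF filterlim_floor_sequentially sqrt_at_top]])

text \<open>Passes from squares to all real distances: t is asymptotic to the largest square not
  exceeding it.\<close>

lemma floor_sqrt_ratio: "((\<lambda>t. (real (nat \<lfloor>sqrt t\<rfloor>))\<^sup>2 / t) \<longlongrightarrow> 1) at_top"
proof (rule tendsto_sandwich)
  have "((\<lambda>t. (1 - 1 / sqrt t)\<^sup>2) \<longlongrightarrow> (1 - 0)\<^sup>2) at_top"
    by (intro tendsto_intros tendsto_divide_0[OF tendsto_const] filterlim_at_top_imp_at_infinity sqrt_at_top)
  then show "((\<lambda>t. (1 - 1 / sqrt t)\<^sup>2) \<longlongrightarrow> 1) at_top" by simp
  show "\<forall>\<^sub>F t in at_top. (1 - 1 / sqrt t)\<^sup>2 \<le> (real (nat \<lfloor>sqrt t\<rfloor>))\<^sup>2 / t"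
    using eventually_ge_at_top[of 1]
  proof eventually_elim
    case (elim t)
    have "1 \<le> sqrt t" using elim by simp
    then have "(sqrt t - 1)\<^sup>2 \<le> (real (nat \<lfloor>sqrt t\<rfloor>))\<^sup>2" by (intro power_mono) linarith+
    then have "(sqrt t - 1)\<^sup>2 / t \<le> (real (nat \<lfloor>sqrt t\<rfloor>))\<^sup>2 / t" using elim by (intro divide_right_mono) auto
    moreover have "(1 - 1 / sqrt t)\<^sup>2 = (sqrt t - 1)\<^sup>2 / t"
    proof -
      have "1 - 1 / sqrt t = (sqrt t - 1) / sqrt t" using elim by (simp add: field_simps)
      then show ?thesis using elim by (simp add: power_divide)
    qed
    ultimately show ?case by simp
  qed
  show "\<forall>\<^sub>F t in at_top. (real (nat \<lfloor>sqrt t\<rfloor>))\<^sup>2 / t \<le> 1"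
    using eventually_ge_at_top[of 1]
  proof eventually_elim
    case (elim t)
    have "real (nat \<lfloor>sqrt t\<rfloor>) \<le> sqrt t" using elim by (simp add: of_nat_nat)
    then have "(real (nat \<lfloor>sqrt t\<rfloor>))\<^sup>2 \<le> (sqrt t)\<^sup>2" by (intro power_mono) auto
    then show ?case using elim by simp
  qed
qed simp

text \<open>The step \<open>u\<close> is fixed first, such that the quotients of
  \<open>time_const\<close> with steps \<open>u\<close> and \<open>- u\<close> are within half of
  \<open>\<epsilon>\<close> of \<open>l\<close>; only then does the distance grow. For fixed
  \<open>u\<close> the errors, divided by u k^2, vanish in the limit.\<close>

lemma geodesic_length_limit:
  assumes h: "0 < h" and deriv: "(time_const has_real_derivative l) (at h)"
    and nn: "\<And>e. e \<in> lattice_edges \<Longrightarrow> 0 \<le> \<tau> e" and good: "good_weights (nearby h) \<tau>"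
    and x: "\<And>e. e \<in> lattice_edges \<Longrightarrow> x e = \<tau> e + h"
    and \<gamma>: "\<And>t. 0 < t \<Longrightarrow> \<gamma> t \<in> geodesics x 0 (t *\<^sub>R \<xi>)"
  shows "((\<lambda>t. real (pos_length x (\<gamma> t)) / t) \<longlongrightarrow> l) at_top"
proof (rule tendstoI)
  fix \<epsilon> :: real assume \<epsilon>: "0 < \<epsilon>"
  define q where "q \<delta> = (time_const (h + \<delta>) - time_const h) / \<delta>" for \<delta>
  have q: "q \<midarrow>0\<rightarrow> l" using deriv unfolding DERIV_def q_def .
  define \<delta> where "\<delta> j = h / (real j + 2)" for j
  have \<delta>pos: "0 < \<delta> j" for j using h by (simp add: \<delta>_def)
  have \<delta>lt: "\<delta> j < h" for j using h by (simp add: \<delta>_def divide_less_eq)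
  have \<delta>0: "\<delta> \<longlonglongrightarrow> 0"
  proof -
    have "(\<lambda>j. h * inverse (real (Suc j))) \<longlonglongrightarrow> h * 0" by (intro tendsto_intros LIMSEQ_inverse_real_of_nat)
    then have "(\<lambda>j. h * inverse (real (Suc j))) \<longlonglongrightarrow> 0" by simp
    from LIMSEQ_Suc[OF this] have "(\<lambda>j. h * inverse (real (Suc (Suc j)))) \<longlonglongrightarrow> 0" .
    then show ?thesis by (simp add: \<delta>_def[abs_def] divide_inverse add.commute)
  qed
  have ne: "\<delta> j \<noteq> 0" for j using \<delta>pos[of j] by simp
  have lim1: "filterlim \<delta> (at 0) sequentially" by (rule filterlim_atI[OF \<delta>0]) (simp add: ne)
  have "(\<lambda>j. - \<delta> j) \<longlonglongrightarrow> 0" using tendsto_minus[OF \<delta>0] by simp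
  then have lim2: "filterlim (\<lambda>j. - \<delta> j) (at 0) sequentially" by (rule filterlim_atI) (simp add: ne)
  have \<epsilon>2: "0 < \<epsilon> / 2" using \<epsilon> by simp
  have "\<forall>\<^sub>F j in sequentially. dist (q (\<delta> j)) l < \<epsilon> / 2" by (rule tendstoD[OF filterlim_compose[OF q lim1] \<epsilon>2])
  moreover have "\<forall>\<^sub>F j in sequentially. dist (q (- \<delta> j)) l < \<epsilon> / 2" by (rule tendstoD[OF filterlim_compose[OF q lim2] \<epsilon>2])
  ultimately have "\<forall>\<^sub>F j in sequentially. dist (q (\<delta> j)) l < \<epsilon> / 2 \<and> dist (q (- \<delta> j)) l < \<epsilon> / 2" by (rule eventually_conj)
  from eventually_happens'[OF sequentially_bot this]
  obtain j where j: "dist (q (\<delta> j)) l < \<epsilon> / 2" "dist (q (- \<delta> j)) l < \<epsilon> / 2" by blast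
  define u where "u = \<delta> j"
  have u: "0 < u" "u < h" using \<delta>pos \<delta>lt by (auto simp: u_def)
  have mem: "h \<in> nearby h" "h + u \<in> nearby h" "h - u \<in> nearby h"
    by (auto simp: nearby_def u_def \<delta>_def)
  let ?X = "\<lambda>s k. scaled_time s k \<tau> / (real k)\<^sup>2"
  have X: "(\<lambda>k. ?X s k) \<longlonglongrightarrow> time_const s" if "s \<in> nearby h" for s using good that by (simp add: good_weights_def)
  \<comment> \<open>\<open>A\<close> bounds the length divided by k^2 from below by the quotient to
    the right of \<open>h\<close>, and \<open>B\<close> from above by the quotient to the left. The
    last term of \<open>B\<close> accounts for the edges near the endpoints, which \<open>m\<close>
    omits.\<close>
  define A where "A k = (?X (h + u) k - ?X h k - slope_error h (h + u) k / (real k)\<^sup>2) / u" for k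
  define B where "B k = (?X h k - ?X (h - u) k + slope_error h (h - u) k / (real k)\<^sup>2) / u
    + 2 * (lev CARD('d) (k\<^sup>2) / k) * (1 / real k)" for k
  have "A \<longlonglongrightarrow> (time_const (h + u) - time_const h - 0) / u"
    unfolding A_def[abs_def] using u mem by (intro tendsto_intros X slope_error_tendsto) auto
  then have A: "A \<longlonglongrightarrow> q u" by (simp add: q_def)
  have "B \<longlonglongrightarrow> (time_const h - time_const (h - u) + 0) / u + 2 * 0 * 0"
    unfolding B_def[abs_def] using u mem by (intro tendsto_intros X slope_error_tendsto lev_over_k lim_1_over_n) auto
  moreover have "(time_const h - time_const (h - u) + 0) / u + 2 * 0 * 0 = q (- u)"
    using u by (simp add: q_def field_simps)
  ultimately have B: "B \<longlonglongrightarrow> q (- u)" by simp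
  define k where "k t = nat \<lfloor>sqrt t\<rfloor>" for t
  have klim: "filterlim k sequentially at_top" unfolding k_def by (rule floor_sqrt_at_top)
  have ratio: "((\<lambda>t. (real (k t))\<^sup>2 / t) \<longlongrightarrow> 1) at_top" unfolding k_def by (rule floor_sqrt_ratio)
  have At: "((\<lambda>t. A (k t) * ((real (k t))\<^sup>2 / t)) \<longlongrightarrow> q u * 1) at_top"
    by (rule tendsto_mult[OF filterlim_compose[OF A klim] ratio])
  have Bt: "((\<lambda>t. B (k t) * ((real (k t))\<^sup>2 / t)) \<longlongrightarrow> q (- u) * 1) at_top"
    by (rule tendsto_mult[OF filterlim_compose[OF B klim] ratio])
  have "l - \<epsilon> < q u * 1" "q (- u) * 1 < l + \<epsilon>" using j \<epsilon> unfolding dist_real_def u_def by linarith+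
  then have ev: "\<forall>\<^sub>F t in at_top. l - \<epsilon> < A (k t) * ((real (k t))\<^sup>2 / t)"
    "\<forall>\<^sub>F t in at_top. B (k t) * ((real (k t))\<^sup>2 / t) < l + \<epsilon>"
    using order_tendstoD(1)[OF At] order_tendstoD(2)[OF Bt] by auto
  have nb: "\<forall>\<^sub>F k in sequentially. \<not> bad_at (k\<^sup>2) \<tau>" using good by (simp add: good_weights_def)
  have bounds: "\<forall>\<^sub>F t in at_top. \<forall>t' \<gamma>. (real (k t))\<^sup>2 \<le> t' \<longrightarrow> t' \<le> (real (k t) + 1)\<^sup>2 \<longrightarrow> \<gamma> \<in> geodesics x 0 (t' *\<^sub>R \<xi>) \<longrightarrow>
    (\<exists>m::nat. m \<le> pos_length x \<gamma> \<and> pos_length x \<gamma> \<le> m + 2 * lev CARD('d) ((k t)\<^sup>2) \<and>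
      (\<forall>s>0. scaled_time s (k t) \<tau> - scaled_time h (k t) \<tau> \<le> (s - h) * m + slope_error h s (k t)))"
    by (rule eventually_compose_filterlim[OF eventually_length_bounds[OF h nn x nb] klim])
  show "\<forall>\<^sub>F t in at_top. dist (real (pos_length x (\<gamma> t)) / t) l < \<epsilon>"
    using ev bounds eventually_ge_at_top[of 1]
  proof eventually_elim
    case (elim t)
    define n where "n = real (k t)"
    have t: "1 \<le> t" using elim(4) .
    have s1: "1 \<le> sqrt t" using t by simp
    have "n = real_of_int \<lfloor>sqrt t\<rfloor>" using s1 unfolding n_def k_def by simp
    moreover have "1 \<le> \<lfloor>sqrt t\<rfloor>" using s1 by simp
    ultimately have n1: "1 \<le> n" "n \<le> sqrt t" "sqrt t \<le> n + 1" by linarith+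
    have "n\<^sup>2 \<le> (sqrt t)\<^sup>2" by (rule power_mono[OF n1(2)]) (use n1 in simp)
    moreover have "(sqrt t)\<^sup>2 \<le> (n + 1)\<^sup>2" by (rule power_mono[OF n1(3)]) (use s1 in simp)
    ultimately have nt: "n\<^sup>2 \<le> t" "t \<le> (n + 1)\<^sup>2" using t by auto
    have "\<gamma> t \<in> geodesics x 0 (t *\<^sub>R \<xi>)" using \<gamma> t by simp
    then obtain m :: nat where m: "m \<le> pos_length x (\<gamma> t)" "pos_length x (\<gamma> t) \<le> m + 2 * lev CARD('d) ((k t)\<^sup>2)"
      "\<forall>s>0. scaled_time s (k t) \<tau> - scaled_time h (k t) \<tau> \<le> (s - h) * m + slope_error h s (k t)"
      using elim(3) nt unfolding n_def by blast
    have n2: "0 < n\<^sup>2" using n1 by simp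
    have up: "scaled_time (h + u) (k t) \<tau> - scaled_time h (k t) \<tau> \<le> u * m + slope_error h (h + u) (k t)"
      using m(3)[rule_format, of "h + u"] u h by simp
    have dn: "scaled_time (h - u) (k t) \<tau> - scaled_time h (k t) \<tau> \<le> - u * m + slope_error h (h - u) (k t)"
      using m(3)[rule_format, of "h - u"] u h by simp
    have "A (k t) * n\<^sup>2 = (scaled_time (h + u) (k t) \<tau> - scaled_time h (k t) \<tau> - slope_error h (h + u) (k t)) / u"
      using n2 u by (simp add: A_def n_def[symmetric] diff_divide_distrib[symmetric])
    also have "\<dots> \<le> m" using up u by (simp add: divide_le_eq mult.commute)
    finally have "A (k t) * n\<^sup>2 \<le> real (pos_length x (\<gamma> t))" using m(1) by linarith
    then have "A (k t) * n\<^sup>2 / t \<le> real (pos_length x (\<gamma> t)) / t" using t by (intro divide_right_mono) auto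
    then have low: "l - \<epsilon> < real (pos_length x (\<gamma> t)) / t" using elim(1) by (simp add: n_def)
    have "real m \<le> (scaled_time h (k t) \<tau> - scaled_time (h - u) (k t) \<tau> + slope_error h (h - u) (k t)) / u"
      using dn u by (simp add: le_divide_eq mult.commute)
    moreover have "B (k t) * n\<^sup>2 = (scaled_time h (k t) \<tau> - scaled_time (h - u) (k t) \<tau> + slope_error h (h - u) (k t)) / u
        + 2 * lev CARD('d) ((k t)\<^sup>2)"
    proof -
      have n0: "n \<noteq> 0" using n1 by simp
      have "B (k t) = (scaled_time h (k t) \<tau> - scaled_time (h - u) (k t) \<tau> + slope_error h (h - u) (k t)) / n\<^sup>2 / u
          + 2 * lev CARD('d) ((k t)\<^sup>2) / n\<^sup>2"
        by (simp add: B_def n_def[symmetric] diff_divide_distrib add_divide_distrib power2_eq_square)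
      moreover have "z / n\<^sup>2 / u * n\<^sup>2 = z / u" "z / n\<^sup>2 * n\<^sup>2 = z" for z using n0 by simp_all
      ultimately show ?thesis by (simp only: distrib_right)
    qed
    ultimately have "real (pos_length x (\<gamma> t)) \<le> B (k t) * n\<^sup>2" using m(2) by linarith
    then have "real (pos_length x (\<gamma> t)) / t \<le> B (k t) * n\<^sup>2 / t" using t by (intro divide_right_mono) auto
    then have "real (pos_length x (\<gamma> t)) / t < l + \<epsilon>" using elim(2) by (simp add: n_def)
    then show ?case using low by (simp add: dist_real_def abs_less_iff)
  qed
qed

end

subsection \<open>The shifted law\<close>

context weight_law
begin

lemma measurable_shift: "0 \<le> h \<Longrightarrow> (\<lambda>t. t + h) \<in> L \<rightarrow>\<^sub>M nonneg_borel"
  unfolding nonneg_borel_def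
  by (rule measurable_restrict_space2) (auto simp: space_L intro!: borel_measurable_L)

lemma shift_law_weight_law:
  assumes "0 \<le> h" shows "weight_law (shift_law L h)"
proof
  have "prob_space (distr L nonneg_borel (\<lambda>t. t + h))" by (rule L.prob_space_distr[OF measurable_shift[OF assms]])
  then show "shift_law L h \<in> weight_laws" by (simp add: weight_laws_def shift_law_def)
qed

text \<open>Couples all shifted models: each is realised on \<open>weights L\<close> by adding
  \<open>h\<close> to every weight. The two measures are compared on cylinders.\<close>

lemma weights_shift_law:
  assumes h: "0 \<le> h"
  shows "(weights (shift_law L h) :: ((int ^ 'd) set \<Rightarrow> real) measure) =
    distr (weights L) (weights (shift_law L h)) (\<lambda>\<tau>. \<lambda>e\<in>lattice_edges. \<tau> e + h)" (is "?P = distr _ _ ?T")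
    and "(\<lambda>\<tau> :: (int ^ 'd) set \<Rightarrow> real. \<lambda>e\<in>lattice_edges. \<tau> e + h) \<in> weights L \<rightarrow>\<^sub>M weights (shift_law L h)"
proof -
  interpret S: weight_law "shift_law L h" by (rule shift_law_weight_law[OF h])
  interpret PS: product_prob_space "\<lambda>_. shift_law L h" "lattice_edges :: (int ^ 'd) set set" by unfold_locales
  interpret PL: product_prob_space "\<lambda>_. L" "lattice_edges :: (int ^ 'd) set set" by unfold_locales
  have m: "(\<lambda>t. t + h) \<in> L \<rightarrow>\<^sub>M shift_law L h"
    using measurable_shift[OF h] by (simp add: shift_law_def)
  show T: "?T \<in> weights L \<rightarrow>\<^sub>M weights (shift_law L h)"
    unfolding weights_def
  proof (rule measurable_restrict)
    fix e :: "(int ^ 'd) set" assume "e \<in> lattice_edges"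
    then have "(\<lambda>\<tau>. \<tau> e) \<in> PiM lattice_edges (\<lambda>_. L) \<rightarrow>\<^sub>M L" by (rule measurable_component_singleton)
    from measurable_compose[OF this m]
    show "(\<lambda>\<tau>. \<tau> e + h) \<in> PiM lattice_edges (\<lambda>_. L) \<rightarrow>\<^sub>M shift_law L h" .
  qed
  have "distr (weights L) ?P ?T = PiM lattice_edges (\<lambda>_. shift_law L h)"
  proof (rule PS.PiM_eq)
    show "sets (distr (weights L) ?P ?T) = sets (PiM lattice_edges (\<lambda>_. shift_law L h))" by (simp add: weights_def)
    fix J and F :: "(int ^ 'd) set \<Rightarrow> real set"
    assume J: "finite J" "J \<subseteq> lattice_edges" and F: "\<And>j. j \<in> J \<Longrightarrow> F j \<in> sets (shift_law L h)"
    let ?E = "prod_emb lattice_edges (\<lambda>_. shift_law L h) J (PiE J F)"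
    have E: "?E \<in> sets ?P" unfolding weights_def by (rule sets_PiM_I) (use J F in auto)
    have "emeasure (distr (weights L) ?P ?T) ?E = emeasure (weights L) (?T -` ?E \<inter> space (weights L))"
      by (rule emeasure_distr[OF T E])
    also have "?T -` ?E \<inter> space (weights L) = {\<tau> \<in> space (weights L). \<forall>e\<in>J. \<tau> e \<in> (\<lambda>t. t + h) -` F e \<inter> space L}"
    proof -
      have emb: "g \<in> ?E \<longleftrightarrow> (\<forall>e\<in>J. g e \<in> F e)" if "g \<in> PiE lattice_edges (\<lambda>_. space (shift_law L h))" for g
        using that by (simp add: prod_emb_def restrict_PiE_iff Pi_iff)
      have "?T \<tau> \<in> ?E \<longleftrightarrow> (\<forall>e\<in>J. \<tau> e \<in> (\<lambda>t. t + h) -` F e \<inter> space L)" if \<tau>: "\<tau> \<in> space (weights L)" for \<tau>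
      proof -
        have "?T \<tau> \<in> PiE lattice_edges (\<lambda>_. space (shift_law L h))"
          using measurable_space[OF T \<tau>] by (simp add: weights_def space_PiM)
        then have "?T \<tau> \<in> ?E \<longleftrightarrow> (\<forall>e\<in>J. ?T \<tau> e \<in> F e)" by (rule emb)
        also have "\<dots> \<longleftrightarrow> (\<forall>e\<in>J. \<tau> e + h \<in> F e)" using J(2) by (intro ball_cong refl) auto
        finally show ?thesis using J(2) \<tau> by (auto simp: weights_def space_PiM PiE_def Pi_def)
      qed
      then show ?thesis by blast
    qed
    also have "emeasure (weights L) \<dots> = (\<Prod>e\<in>J. emeasure L ((\<lambda>t. t + h) -` F e \<inter> space L))"
      unfolding weights_def by (rule PL.emeasure_PiM_Collect) (use J F in \<open>auto intro!: measurable_sets[OF m]\<close>)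
    also have "\<dots> = (\<Prod>e\<in>J. emeasure (shift_law L h) (F e))"
    proof (rule prod.cong[OF refl])
      fix e assume "e \<in> J"
      then have "F e \<in> sets nonneg_borel" using F S.sets_L by auto
      then show "emeasure L ((\<lambda>t. t + h) -` F e \<inter> space L) = emeasure (shift_law L h) (F e)"
        unfolding shift_law_def by (rule emeasure_distr[OF measurable_shift[OF h], symmetric])
    qed
    finally show "emeasure (distr (weights L) ?P ?T) ?E = (\<Prod>e\<in>J. emeasure (shift_law L h) (F e))" .
  qed
  then show "?P = distr (weights L) ?P ?T" by (simp add: weights_def)
qed

end

text \<open>A statement about all choices of geodesics is not evidently measurable. It is therefore
  deduced pointwise from the measurable property \<open>P\<close> of the shifted weights, and
  \<open>P\<close> is transferred from \<open>weights L\<close> through the image measure.\<close>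

lemma (in ray_model) differentiable_imp_length_law:
  assumes h: "0 < h" and deriv: "(time_const has_real_derivative l) (at h)"
  shows "shift_law L h \<in> length_laws \<xi>"
proof -
  interpret S: weight_law "shift_law L h" by (rule shift_law_weight_law) (use h in simp)
  let ?W' = "weights (shift_law L h) :: ((int ^ 'd) set \<Rightarrow> real) measure"
  let ?u = "\<lambda>x. \<lambda>e\<in>lattice_edges. x e - h :: real"
  \<comment> \<open>Subtracting \<open>h\<close> recovers the original weights, and
    \<open>h \<le> x e\<close> their nonnegativity, so \<open>P\<close> is stated without reference
    to the coupling.\<close>
  define P where "P x \<longleftrightarrow> good_weights (nearby h) (?u x) \<and> (\<forall>e\<in>lattice_edges. h \<le> x e)" for x :: "(int ^ 'd) set \<Rightarrow> real"
  have um: "(\<lambda>x. ?u x e) \<in> borel_measurable ?W'" if "e \<in> lattice_edges" for e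
    using S.measurable_weight[OF that] that by simp
  have count: "countable (lattice_edges :: (int ^ 'd) set set)"
  proof -
    have "lattice_edges \<subseteq> (\<lambda>(u, v). {u, v}) ` (UNIV :: ((int ^ 'd) \<times> (int ^ 'd)) set)" by (auto simp: lattice_edges_def)
    then show ?thesis by (rule countable_subset) auto
  qed
  have Pset: "{x \<in> space ?W'. P x} \<in> sets ?W'"
    unfolding P_def good_weights_def
  proof (intro sets.sets_Collect_conj sets_Collect_eventually_sequentially sets.sets_Collect_neg
      sets.sets_Collect_countable_All' nearby_countable count)
    show "{x \<in> space ?W'. bad_at (k\<^sup>2) (?u x)} \<in> sets ?W'" for k
      unfolding bad_at_def by (rule measurable_has_bad_chain[OF um])
    fix e :: "(int ^ 'd) set" assume "e \<in> lattice_edges"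
    then have [measurable]: "(\<lambda>x. x e) \<in> borel_measurable ?W'" by (rule S.measurable_weight)
    show "{x \<in> space ?W'. h \<le> x e} \<in> sets ?W'" by measurable
  next
    fix s
    have [measurable]: "(\<lambda>x. scaled_time s k (?u x)) \<in> borel_measurable ?W'" for k
      unfolding scaled_time_def
      by (rule measurable_walk_dist) (auto simp: trunc_weight_def intro!: borel_measurable_add borel_measurable_min S.measurable_weight borel_measurable_diff)
    show "{x \<in> space ?W'. (\<lambda>k. scaled_time s k (?u x) / (real k)\<^sup>2) \<longlonglongrightarrow> time_const s} \<in> sets ?W'" by measurable
  qed
  have "AE \<tau> in W. P (\<lambda>e\<in>lattice_edges. \<tau> e + h)"
  proof (rule AE_mp[OF AE_good_weights[OF nearby_countable nearby_pos[OF h]]], intro AE_I2 impI)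
    fix \<tau> :: "(int ^ 'd) set \<Rightarrow> real" assume \<tau>: "\<tau> \<in> space W" "good_weights (nearby h) \<tau>"
    have "?u (\<lambda>e\<in>lattice_edges. \<tau> e + h) = \<tau>"
      using \<tau>(1) by (auto simp: weights_def space_PiM PiE_def extensional_def restrict_def fun_eq_iff)
    then show "P (\<lambda>e\<in>lattice_edges. \<tau> e + h)" using \<tau> weights_nonneg[OF \<tau>(1)] by (simp add: P_def)
  qed
  then have "AE x in distr W ?W' (\<lambda>\<tau>. \<lambda>e\<in>lattice_edges. \<tau> e + h). P x"
    using h by (subst AE_distr_iff[OF weights_shift_law(2) Pset]) auto
  moreover have eq: "?W' = distr W ?W' (\<lambda>\<tau>. \<lambda>e\<in>lattice_edges. \<tau> e + h)" using h by (intro weights_shift_law(1)) simp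
  ultimately have "AE x in ?W'. P x" by (subst eq)
  then have "AE x in ?W'. \<forall>\<gamma>. (\<forall>n>0. \<gamma> n \<in> geodesics x 0 (n *\<^sub>R \<xi>)) \<longrightarrow>
      ((\<lambda>n. real (pos_length x (\<gamma> n)) / n) \<longlongrightarrow> l) at_top"
  proof (rule AE_mp, intro AE_I2 impI allI)
    fix x :: "(int ^ 'd) set \<Rightarrow> real" and \<gamma> assume P: "P x" and \<gamma>: "\<forall>n>0. \<gamma> n \<in> geodesics x 0 (n *\<^sub>R \<xi>)"
    show "((\<lambda>n. real (pos_length x (\<gamma> n)) / n) \<longlongrightarrow> l) at_top"
      by (rule geodesic_length_limit[OF h deriv, of "?u x"]) (use P \<gamma> in \<open>auto simp: P_def\<close>)
  qed
  then have "AE x in fpp_model (shift_law L h). \<forall>\<gamma>. (\<forall>n>0. \<gamma> n \<in> geodesics x 0 (n *\<^sub>R \<xi>)) \<longrightarrow>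
      ((\<lambda>n. real (pos_length x (\<gamma> n)) / n) \<longlongrightarrow> l) at_top"
    unfolding fpp_model_def weights_def[symmetric] by (rule AE_completion)
  then show ?thesis using S.law by (auto simp: length_laws_def)
qed

theorem theorem1p25:
  fixes \<xi> :: "real ^ 'd" and L :: "real measure"
  assumes "CARD('d) \<ge> 2"
    and "\<xi> \<in> sphere 0 1"
    and "L \<in> weight_laws"
  shows "countable {h::real. h > 0 \<and> shift_law L h \<notin> length_laws \<xi>}"
proof -
  interpret weight_law L by unfold_locales (rule assms)
  define c where "c = real (chain_base TYPE('d))"
  have c: "0 < c" by (simp add: c_def chain_base_def)
  \<comment> \<open>The tail of any law tends to 0, so the Peierls condition is met by a large
    \<open>K\<close> without any moment assumption.\<close>
  obtain K where K: "0 \<le> K" "tail K < (1 / (2 * c))\<^sup>2" using tail_small[of "(1 / (2 * c))\<^sup>2"] c by auto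
  have "sqrt (tail K) \<le> 1 / (2 * c)" using K(2) c by (intro real_le_lsqrt) (auto simp: less_imp_le)
  then have "c * sqrt (tail K) \<le> 1 / 2" using c mult_left_mono[of "sqrt (tail K)" "1 / (2 * c)" c] by simp
  then interpret ray_model L \<xi> K
    using assms K by unfold_locales (auto simp: c_def)
  have "countable {h. 0 < h \<and> \<not> (\<exists>l. (time_const has_real_derivative l) (at h))}"
    by (rule concave_countable_nondiff) (rule time_const_concave)
  then show ?thesis by (rule countable_subset[rotated]) (use differentiable_imp_length_law in blast)
qed

end
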